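(* Let $l\ge 1$ be an integer. The theory $\mathcal{G}or_l$ of all Artinian local Gorenstein rings of length $l$ having an algebraically closed residue field is model-complete.
   Context: Rings are commutative with identity. The language is the language of rings $\langle +,\cdot,-;0,1\rangle$. $\mathcal{G}or_l$ is the first-order theory whose models are exactly the Artinian local Gorenstein rings of length exactly $l$ (as a module over themselves) with algebraically closed residue field. An Artinian local ring is Gorenstein if its socle (the annihilator of the maximal ideal) is a principal ideal. A theory is model-complete if every embedding between its models is elementary. *)

theory Defs
  imports "HOL-Algebra.Algebraic_Closure" "HOL-Library.Extended_Nat"
begin

section \<open>First-order logic in the language of rings\<close>

datatype rterm =
    Var nat
  | Zero
  | One
  | Plus rterm rterm
  | Times rterm rterm
  | Minus rterm

datatype rform =
    FEq rterm rterm
  | FNot rform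
  | FAnd rform rform
  | FEx nat rform

definition FImp :: "rform \<Rightarrow> rform \<Rightarrow> rform" where
  "FImp p q = FNot (FAnd p (FNot q))"

definition FIff :: "rform \<Rightarrow> rform \<Rightarrow> rform" where
  "FIff p q = FAnd (FImp p q) (FImp q p)"

definition FAll :: "nat \<Rightarrow> rform \<Rightarrow> rform" where
  "FAll v p = FNot (FEx v (FNot p))"

primrec FExs :: "nat list \<Rightarrow> rform \<Rightarrow> rform" where
  "FExs [] p = p"
| "FExs (v # vs) p = FEx v (FExs vs p)"

primrec FAlls :: "nat list \<Rightarrow> rform \<Rightarrow> rform" where
  "FAlls [] p = p"
| "FAlls (v # vs) p = FAll v (FAlls vs p)"

primrec FConj :: "rform list \<Rightarrow> rform" where
  "FConj [] = FEq Zero Zero"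
| "FConj (p # ps) = FAnd p (FConj ps)"

primrec tvars :: "rterm \<Rightarrow> nat set" where
  "tvars (Var v) = {v}"
| "tvars Zero = {}"
| "tvars One = {}"
| "tvars (Plus t u) = tvars t \<union> tvars u"
| "tvars (Times t u) = tvars t \<union> tvars u"
| "tvars (Minus t) = tvars t"

primrec fvars :: "rform \<Rightarrow> nat set" where
  "fvars (FEq t u) = tvars t \<union> tvars u"
| "fvars (FNot p) = fvars p"
| "fvars (FAnd p q) = fvars p \<union> fvars q"
| "fvars (FEx v p) = fvars p - {v}"

definition sentence :: "rform \<Rightarrow> bool" where
  "sentence p \<longleftrightarrow> fvars p = {}"

text \<open>An arbitrary structure for the language of rings: nothing but closure of the carrier under
  the operations is required.  The record extends that of HOL-Algebra rings by the interpretation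
  of the unary minus symbol, which there is a derived operation.\<close>

record 'a ring_structure = "'a ring" +
  neg :: "'a \<Rightarrow> 'a"

definition is_structure :: "'a ring_structure \<Rightarrow> bool" where
  "is_structure M \<longleftrightarrow>
     \<zero>\<^bsub>M\<^esub> \<in> carrier M \<and> \<one>\<^bsub>M\<^esub> \<in> carrier M \<and>
     (\<forall>x \<in> carrier M. \<forall>y \<in> carrier M. x \<oplus>\<^bsub>M\<^esub> y \<in> carrier M \<and> x \<otimes>\<^bsub>M\<^esub> y \<in> carrier M) \<and>
     (\<forall>x \<in> carrier M. neg M x \<in> carrier M)"

primrec tval :: "'a ring_structure \<Rightarrow> (nat \<Rightarrow> 'a) \<Rightarrow> rterm \<Rightarrow> 'a" where
  "tval M s (Var v) = s v"
| "tval M s Zero = \<zero>\<^bsub>M\<^esub>"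
| "tval M s One = \<one>\<^bsub>M\<^esub>"
| "tval M s (Plus t u) = tval M s t \<oplus>\<^bsub>M\<^esub> tval M s u"
| "tval M s (Times t u) = tval M s t \<otimes>\<^bsub>M\<^esub> tval M s u"
| "tval M s (Minus t) = neg M (tval M s t)"

primrec sat :: "'a ring_structure \<Rightarrow> (nat \<Rightarrow> 'a) \<Rightarrow> rform \<Rightarrow> bool" where
  "sat M s (FEq t u) \<longleftrightarrow> tval M s t = tval M s u"
| "sat M s (FNot p) \<longleftrightarrow> \<not> sat M s p"
| "sat M s (FAnd p q) \<longleftrightarrow> sat M s p \<and> sat M s q"
| "sat M s (FEx v p) \<longleftrightarrow> (\<exists>x \<in> carrier M. sat M (s(v := x)) p)"

definition is_model :: "'a ring_structure \<Rightarrow> rform set \<Rightarrow> bool" where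
  "is_model M T \<longleftrightarrow>
     is_structure M \<and> (\<forall>p \<in> T. \<forall>s. range s \<subseteq> carrier M \<longrightarrow> sat M s p)"

definition embedding :: "'a ring_structure \<Rightarrow> 'b ring_structure \<Rightarrow> ('a \<Rightarrow> 'b) \<Rightarrow> bool" where
  "embedding M N f \<longleftrightarrow>
     f \<in> carrier M \<rightarrow> carrier N \<and> inj_on f (carrier M) \<and>
     f \<zero>\<^bsub>M\<^esub> = \<zero>\<^bsub>N\<^esub> \<and> f \<one>\<^bsub>M\<^esub> = \<one>\<^bsub>N\<^esub> \<and>
     (\<forall>x \<in> carrier M. \<forall>y \<in> carrier M.
        f (x \<oplus>\<^bsub>M\<^esub> y) = f x \<oplus>\<^bsub>N\<^esub> f y \<and> f (x \<otimes>\<^bsub>M\<^esub> y) = f x \<otimes>\<^bsub>N\<^esub> f y) \<and>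
     (\<forall>x \<in> carrier M. f (neg M x) = neg N (f x))"

definition elementary :: "'a ring_structure \<Rightarrow> 'b ring_structure \<Rightarrow> ('a \<Rightarrow> 'b) \<Rightarrow> bool" where
  "elementary M N f \<longleftrightarrow>
     (\<forall>p s. range s \<subseteq> carrier M \<longrightarrow> (sat M s p \<longleftrightarrow> sat N (f \<circ> s) p))"

text \<open>HOL cannot quantify over types inside a formula, so the types over which the carriers of
  the two models range are parameters.  A theorem in which these are type variables asserts the
  property for all models.\<close>

definition model_complete :: "'a itself \<Rightarrow> 'b itself \<Rightarrow> rform set \<Rightarrow> bool" where
  "model_complete _ _ T \<longleftrightarrow>
     (\<forall>(M :: 'a ring_structure) (N :: 'b ring_structure) f.
        is_model M T \<and> is_model N T \<and> embedding M N f \<longrightarrow> elementary M N f)"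


section \<open>Artinian local Gorenstein rings\<close>

definition artinian_ring :: "('a, 'm) ring_scheme \<Rightarrow> bool" where
  "artinian_ring R \<longleftrightarrow> cring R \<and>
     (\<forall>I :: nat \<Rightarrow> 'a set. (\<forall>n. ideal (I n) R) \<and> (\<forall>n. I (Suc n) \<subseteq> I n) \<longrightarrow>
        (\<exists>N. \<forall>n \<ge> N. I n = I N))"

definition local_ring :: "('a, 'm) ring_scheme \<Rightarrow> bool" where
  "local_ring R \<longleftrightarrow> cring R \<and> (\<exists>!I. maximalideal I R)"

definition max_ideal :: "('a, 'm) ring_scheme \<Rightarrow> 'a set" where
  "max_ideal R = (THE I. maximalideal I R)"

definition socle :: "('a, 'm) ring_scheme \<Rightarrow> 'a set" where
  "socle R = {x \<in> carrier R. \<forall>y \<in> max_ideal R. y \<otimes>\<^bsub>R\<^esub> x = \<zero>\<^bsub>R\<^esub>}"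

text \<open>The length as a module over itself; the submodules are the ideals.\<close>

definition ideal_chain :: "('a, 'm) ring_scheme \<Rightarrow> nat \<Rightarrow> (nat \<Rightarrow> 'a set) \<Rightarrow> bool" where
  "ideal_chain R n I \<longleftrightarrow> (\<forall>i \<le> n. ideal (I i) R) \<and> (\<forall>i < n. I i \<subset> I (Suc i))"

definition ring_length :: "('a, 'm) ring_scheme \<Rightarrow> enat" where
  "ring_length R = Sup {enat n | n. \<exists>I. ideal_chain R n I}"

definition gorenstein_ring :: "('a, 'm) ring_scheme \<Rightarrow> bool" where
  "gorenstein_ring R \<longleftrightarrow> artinian_ring R \<and> local_ring R \<and> principalideal (socle R) R"

definition gor_class :: "nat \<Rightarrow> ('a, 'm) ring_scheme \<Rightarrow> bool" where
  "gor_class l R \<longleftrightarrow>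
     gorenstein_ring R \<and> ring_length R = enat l \<and> algebraically_closed (R Quot max_ideal R)"


section \<open>The theory\<close>

definition ring_axs :: "rform set" where
  "ring_axs = (let x = Var 0; y = Var 1; z = Var 2 in FAlls [0, 1, 2] `
    {FEq (Plus (Plus x y) z) (Plus x (Plus y z)),
     FEq (Plus x y) (Plus y x),
     FEq (Plus Zero x) x,
     FEq (Plus (Minus x) x) Zero,
     FEq (Times (Times x y) z) (Times x (Times y z)),
     FEq (Times x y) (Times y x),
     FEq (Times One x) x,
     FEq (Times (Plus x y) z) (Plus (Times x z) (Times y z))})"

text \<open>The number \<open>v\<close> is a bound variable and must not occur in \<open>t\<close>.\<close>

definition nonunit_fm :: "nat \<Rightarrow> rterm \<Rightarrow> rform" where
  "nonunit_fm v t = FNot (FEx v (FEq (Times t (Var v)) One))"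

definition local_ax :: rform where
  "local_ax = FAnd (FNot (FEq Zero One))
     (FAlls [0, 1] (FImp (FAnd (nonunit_fm 2 (Var 0)) (nonunit_fm 2 (Var 1)))
        (nonunit_fm 2 (Plus (Var 0) (Var 1)))))"

primrec sum_tm :: "(nat \<Rightarrow> rterm) \<Rightarrow> nat \<Rightarrow> rterm" where
  "sum_tm f 0 = Zero"
| "sum_tm f (Suc n) = Plus (sum_tm f n) (f n)"

primrec pow_tm :: "rterm \<Rightarrow> nat \<Rightarrow> rterm" where
  "pow_tm t 0 = One"
| "pow_tm t (Suc n) = Times (pow_tm t n) t"

text \<open>\<open>t\<close> lies in the ideal generated by the values \<open>a\<^sub>j\<close> of the variables \<open>j < i\<close>; the
  coefficients are the bound variables \<open>l + j\<close>, so \<open>i \<le> l\<close> and these must not occur in \<open>t\<close>.\<close>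

definition span_fm :: "nat \<Rightarrow> nat \<Rightarrow> rterm \<Rightarrow> rform" where
  "span_fm l i t =
     FExs (map (\<lambda>j. l + j) [0..<i]) (FEq t (sum_tm (\<lambda>j. Times (Var (l + j)) (Var j)) i))"

text \<open>There are \<open>a\<^sub>0, \<dots>, a\<^bsub>l-1\<^esub>\<close> such that the ideals \<open>(a\<^sub>0, \<dots>, a\<^bsub>i-1\<^esub>)\<close>,
  \<open>i \<le> l\<close>, form a composition series: each quotient of successive ideals is nonzero, cyclic and
  annihilated by the maximal ideal.\<close>

definition length_ax :: "nat \<Rightarrow> rform" where
  "length_ax l = FExs [0..<l] (FAnd
     (FConj (map (\<lambda>i. FAnd (FNot (span_fm l i (Var i)))
        (FAll (2 * l) (FImp (nonunit_fm (2 * l + 1) (Var (2 * l)))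
           (span_fm l i (Times (Var (2 * l)) (Var i)))))) [0..<l]))
     (FAll (2 * l) (span_fm l l (Var (2 * l)))))"

definition gorenstein_ax :: rform where
  "gorenstein_ax = FEx 0 (FAll 1 (FIff
     (FAll 2 (FImp (nonunit_fm 3 (Var 2)) (FEq (Times (Var 2) (Var 1)) Zero)))
     (FEx 2 (FEq (Var 1) (Times (Var 2) (Var 0))))))"

text \<open>Every monic polynomial of degree \<open>n\<close> has a root modulo the maximal ideal.\<close>

definition alg_closed_ax :: "nat \<Rightarrow> rform" where
  "alg_closed_ax n = FAlls [0..<n] (FEx n (nonunit_fm (n + 1)
     (Plus (pow_tm (Var n) n) (sum_tm (\<lambda>j. Times (Var j) (pow_tm (Var n) j)) n))))"

definition Gor :: "nat \<Rightarrow> rform set" where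
  "Gor l = ring_axs \<union> {local_ax, length_ax l, gorenstein_ax} \<union> {alg_closed_ax n | n. n \<ge> 1}"


section \<open>The models of the theory\<close>

text \<open>The final theorem of this section, \<open>is_model_Gor_iff\<close>, shows that the models of \<open>Gor l\<close>
  are exactly the members of \<open>gor_class l\<close>, with the minus symbol interpreted as additive inverse.\<close>

lemma fvars_simps [simp]:
  "fvars (FImp p q) = fvars p \<union> fvars q"
  "fvars (FIff p q) = fvars p \<union> fvars q"
  "fvars (FAll v p) = fvars p - {v}"
  "fvars (FExs vs p) = fvars p - set vs"
  "fvars (FAlls vs p) = fvars p - set vs"
  "fvars (FConj ps) = (\<Union>p \<in> set ps. fvars p)"
proof -
  show 3: "fvars (FAll v p) = fvars p - {v}" for v p
    by (simp add: FAll_def)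
  show "fvars (FExs vs p) = fvars p - set vs" by (induction vs) auto
  show "fvars (FAlls vs p) = fvars p - set vs" by (induction vs) (auto simp: 3)
  show "fvars (FConj ps) = (\<Union>p \<in> set ps. fvars p)" by (induction ps) auto
qed (auto simp: FImp_def FIff_def)

lemma tvars_sum_tm: "tvars (sum_tm f n) = (\<Union>j < n. tvars (f j))"
  by (induction n) (auto simp: lessThan_Suc)

lemma tvars_pow_tm: "tvars (pow_tm t n) \<subseteq> tvars t"
  by (induction n) auto

lemma fvars_span_fm: "fvars (span_fm l i t) = (tvars t \<union> {..<i}) - {l..<l + i}"
proof -
  have "(+) l ` {0..<i} = {l..<l + i}" by (simp add: add.commute)
  then show ?thesis
    by (auto simp: span_fm_def tvars_sum_tm image_iff)
qed

lemma Gor_sentence: "p \<in> Gor l \<Longrightarrow> sentence p"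
proof -
  have "fvars (length_ax l) = {}"
    by (auto simp: length_ax_def nonunit_fm_def fvars_span_fm)
  moreover have "fvars (alg_closed_ax n) = {}" for n
    using tvars_pow_tm[of "Var n"] 
    by (fastforce simp: alg_closed_ax_def nonunit_fm_def tvars_sum_tm)
  moreover have "p \<in> ring_axs \<Longrightarrow> fvars p = {}" for p
    by (auto simp: ring_axs_def Let_def)
  moreover have "fvars local_ax = {}" "fvars gorenstein_ax = {}"
    by (auto simp: local_ax_def gorenstein_ax_def nonunit_fm_def)
  ultimately show "p \<in> Gor l \<Longrightarrow> sentence p"
    by (auto simp: Gor_def sentence_def)
qed

lemma sat_simps [simp]:
  "sat M s (FImp p q) \<longleftrightarrow> (sat M s p \<longrightarrow> sat M s q)"
  "sat M s (FIff p q) \<longleftrightarrow> (sat M s p \<longleftrightarrow> sat M s q)"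
  "sat M s (FAll v p) \<longleftrightarrow> (\<forall>x \<in> carrier M. sat M (s(v := x)) p)"
  "sat M s (FConj ps) \<longleftrightarrow> (\<forall>p \<in> set ps. sat M s p)"
  by (auto simp: FImp_def FIff_def FAll_def) (induction ps; auto)+

lemma sat_FExs:
  assumes "carrier M \<noteq> {}"
  shows "sat M s (FExs vs p) \<longleftrightarrow>
    (\<exists>t. (\<forall>v \<in> set vs. t v \<in> carrier M) \<and> (\<forall>v. v \<notin> set vs \<longrightarrow> t v = s v) \<and> sat M t p)"
proof (induction vs arbitrary: s)
  case Nil
  have "t = s" if "\<forall>v. t v = s v" for t using that by auto
  then show ?case by auto
next
  case (Cons w vs)
  show ?case
  proof
    assume "sat M s (FExs (w # vs) p)"
    then obtain x t where x: "x \<in> carrier M" and t: "\<forall>v \<in> set vs. t v \<in> carrier M"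
      "\<forall>v. v \<notin> set vs \<longrightarrow> t v = (s(w := x)) v" "sat M t p"
      using Cons by auto
    have "t w \<in> carrier M" using t x by (cases "w \<in> set vs") auto
    then show "\<exists>t. (\<forall>v \<in> set (w # vs). t v \<in> carrier M) \<and>
      (\<forall>v. v \<notin> set (w # vs) \<longrightarrow> t v = s v) \<and> sat M t p"
      using t by (intro exI[of _ t]) auto
  next
    assume "\<exists>t. (\<forall>v \<in> set (w # vs). t v \<in> carrier M) \<and>
      (\<forall>v. v \<notin> set (w # vs) \<longrightarrow> t v = s v) \<and> sat M t p"
    then obtain t where t: "\<forall>v \<in> set (w # vs). t v \<in> carrier M"
      "\<forall>v. v \<notin> set (w # vs) \<longrightarrow> t v = s v" "sat M t p" by blast
    then have "sat M (s(w := t w)) (FExs vs p)"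
      unfolding Cons by (intro exI[of _ t]) auto
    then show "sat M s (FExs (w # vs) p)" using t(1) by auto
  qed
qed

lemma sat_FAlls:
  assumes "carrier M \<noteq> {}"
  shows "sat M s (FAlls vs p) \<longleftrightarrow>
    (\<forall>t. (\<forall>v \<in> set vs. t v \<in> carrier M) \<and> (\<forall>v. v \<notin> set vs \<longrightarrow> t v = s v) \<longrightarrow> sat M t p)"
proof -
  have "sat M s (FAlls vs p) \<longleftrightarrow> \<not> sat M s (FExs vs (FNot p))"
    by (induction vs arbitrary: s) auto
  then show ?thesis using sat_FExs[OF assms] by auto
qed

lemma tval_cong: "(\<And>v. v \<in> tvars t \<Longrightarrow> s v = s' v) \<Longrightarrow> tval M s t = tval M s' t"
  by (induction t) auto

lemma sat_cong: "(\<And>v. v \<in> fvars p \<Longrightarrow> s v = s' v) \<Longrightarrow> sat M s p \<longleftrightarrow> sat M s' p"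
proof (induction p arbitrary: s s')
  case (FEq t u)
  then show ?case using tval_cong[of t s s' M] tval_cong[of u s s' M] by auto
next
  case (FNot p)
  then show ?case by (metis fvars.simps(2) sat.simps(2))
next
  case (FAnd p q)
  then show ?case by (metis UnCI fvars.simps(3) sat.simps(3))
next
  case (FEx v p)
  have "sat M (s(v := x)) p \<longleftrightarrow> sat M (s'(v := x)) p" for x
    by (rule FEx.IH) (use FEx.prems in auto)
  then show ?case by simp
qed

lemma sat_nonunit_fm:
  assumes "v \<notin> tvars t"
  shows "sat M s (nonunit_fm v t) \<longleftrightarrow> (\<forall>y \<in> carrier M. tval M s t \<otimes>\<^bsub>M\<^esub> y \<noteq> \<one>\<^bsub>M\<^esub>)"
proof -
  have "tval M (s(v := y)) t = tval M s t" for y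
    by (rule tval_cong) (use assms in auto)
  then show ?thesis by (simp add: nonunit_fm_def)
qed

primrec lin :: "('a, 'm) ring_scheme \<Rightarrow> (nat \<Rightarrow> 'a) \<Rightarrow> nat \<Rightarrow> 'a" where
  "lin R f 0 = \<zero>\<^bsub>R\<^esub>"
| "lin R f (Suc n) = lin R f n \<oplus>\<^bsub>R\<^esub> f n"

lemma lin_cong: "(\<And>j. j < n \<Longrightarrow> f j = g j) \<Longrightarrow> lin R f n = lin R g n"
  by (induction n) auto

lemma tval_sum_tm: "tval M s (sum_tm f n) = lin M (\<lambda>j. tval M s (f j)) n"
  by (induction n) auto

lemma tval_pow_tm: "tval M s (pow_tm t n) = tval M s t [^]\<^bsub>M\<^esub> n"
  by (induction n) (auto simp: nat_pow_def)

lemma sat_span_fm: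
  assumes "carrier M \<noteq> {}" "i \<le> l" "tvars t \<inter> {l..<l + i} = {}"
  shows "sat M s (span_fm l i t) \<longleftrightarrow>
    (\<exists>r. (\<forall>j < i. r j \<in> carrier M) \<and> tval M s t = lin M (\<lambda>j. r j \<otimes>\<^bsub>M\<^esub> s j) i)"
proof -
  have set: "set (map (\<lambda>j. l + j) [0..<i]) = {l..<l + i}" by (simp add: add.commute)
  show ?thesis
    unfolding span_fm_def sat_FExs[OF assms(1)] set
  proof
    assume "\<exists>u. (\<forall>v \<in> {l..<l + i}. u v \<in> carrier M) \<and> (\<forall>v. v \<notin> {l..<l + i} \<longrightarrow> u v = s v) \<and>
      sat M u (FEq t (sum_tm (\<lambda>j. Times (Var (l + j)) (Var j)) i))"
    then obtain u where u: "\<forall>v \<in> {l..<l + i}. u v \<in> carrier M"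
      "\<forall>v. v \<notin> {l..<l + i} \<longrightarrow> u v = s v"
      "tval M u t = lin M (\<lambda>j. u (l + j) \<otimes>\<^bsub>M\<^esub> u j) i"
      by (auto simp: tval_sum_tm)
    have "tval M u t = tval M s t" by (rule tval_cong) (use u assms(3) in \<open>auto simp: disjoint_iff\<close>)
    moreover have "lin M (\<lambda>j. u (l + j) \<otimes>\<^bsub>M\<^esub> u j) i = lin M (\<lambda>j. u (l + j) \<otimes>\<^bsub>M\<^esub> s j) i"
      by (rule lin_cong) (use u assms in auto)
    ultimately show "\<exists>r. (\<forall>j < i. r j \<in> carrier M) \<and> tval M s t = lin M (\<lambda>j. r j \<otimes>\<^bsub>M\<^esub> s j) i"
      using u by (intro exI[of _ "\<lambda>j. u (l + j)"]) auto
  next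
    assume "\<exists>r. (\<forall>j < i. r j \<in> carrier M) \<and> tval M s t = lin M (\<lambda>j. r j \<otimes>\<^bsub>M\<^esub> s j) i"
    then obtain r where r: "\<forall>j < i. r j \<in> carrier M" "tval M s t = lin M (\<lambda>j. r j \<otimes>\<^bsub>M\<^esub> s j) i"
      by blast
    define u where "u = (\<lambda>v. if v \<in> {l..<l + i} then r (v - l) else s v)"
    have "tval M u t = tval M s t" by (rule tval_cong) (use assms(3) in \<open>auto simp: u_def disjoint_iff\<close>)
    moreover have "lin M (\<lambda>j. u (l + j) \<otimes>\<^bsub>M\<^esub> u j) i = lin M (\<lambda>j. r j \<otimes>\<^bsub>M\<^esub> s j) i"
      by (rule lin_cong) (use assms in \<open>auto simp: u_def\<close>)
    ultimately show "\<exists>u. (\<forall>v \<in> {l..<l + i}. u v \<in> carrier M) \<and> (\<forall>v. v \<notin> {l..<l + i} \<longrightarrow> u v = s v) \<and>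
      sat M u (FEq t (sum_tm (\<lambda>j. Times (Var (l + j)) (Var j)) i))"
      using r by (intro exI[of _ u]) (auto simp: tval_sum_tm u_def)
  qed
qed

lemma sat_all_iff:
  assumes "sentence p" "carrier M \<noteq> {}"
  shows "(\<forall>s. range s \<subseteq> carrier M \<longrightarrow> sat M s p) \<longleftrightarrow> sat M s p"
proof -
  obtain c where "c \<in> carrier M" using assms(2) by blast
  then have "range (\<lambda>_::nat. c) \<subseteq> carrier M" by auto
  moreover have "sat M s' p = sat M s p" for s' by (rule sat_cong) (use assms in \<open>auto simp: sentence_def\<close>)
  ultimately show ?thesis by blast
qed

definition nonunits :: "('a, 'm) ring_scheme \<Rightarrow> 'a set" where
  "nonunits R = {x \<in> carrier R. \<forall>y \<in> carrier R. x \<otimes>\<^bsub>R\<^esub> y \<noteq> \<one>\<^bsub>R\<^esub>}"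

lemma is_model_Gor_iff_sat:
  "is_model M (Gor l) \<longleftrightarrow> is_structure M \<and> (\<forall>p \<in> Gor l. \<forall>s. sat M s p)"
proof (cases "is_structure M")
  case True
  then have "carrier M \<noteq> {}" by (auto simp: is_structure_def)
  then show ?thesis using sat_all_iff Gor_sentence unfolding is_model_def by metis
qed (simp add: is_model_def)

lemma ring_axs_iff:
  assumes "is_structure M"
  shows "(\<forall>p \<in> ring_axs. \<forall>s. sat M s p) \<longleftrightarrow>
    cring M \<and> (\<forall>x \<in> carrier M. neg M x = \<ominus>\<^bsub>M\<^esub> x)"
proof
  assume *: "\<forall>p \<in> ring_axs. \<forall>s. sat M s p"
  have cl: "\<zero>\<^bsub>M\<^esub> \<in> carrier M" "\<one>\<^bsub>M\<^esub> \<in> carrier M"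
    "\<And>x y. x \<in> carrier M \<Longrightarrow> y \<in> carrier M \<Longrightarrow> x \<oplus>\<^bsub>M\<^esub> y \<in> carrier M"
    "\<And>x y. x \<in> carrier M \<Longrightarrow> y \<in> carrier M \<Longrightarrow> x \<otimes>\<^bsub>M\<^esub> y \<in> carrier M"
    "\<And>x. x \<in> carrier M \<Longrightarrow> neg M x \<in> carrier M"
    using assms by (auto simp: is_structure_def)
  have eqs: "(x \<oplus>\<^bsub>M\<^esub> y) \<oplus>\<^bsub>M\<^esub> z = x \<oplus>\<^bsub>M\<^esub> (y \<oplus>\<^bsub>M\<^esub> z)" "(x \<otimes>\<^bsub>M\<^esub> y) \<otimes>\<^bsub>M\<^esub> z = x \<otimes>\<^bsub>M\<^esub> (y \<otimes>\<^bsub>M\<^esub> z)"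
    "(x \<oplus>\<^bsub>M\<^esub> y) \<otimes>\<^bsub>M\<^esub> z = x \<otimes>\<^bsub>M\<^esub> z \<oplus>\<^bsub>M\<^esub> y \<otimes>\<^bsub>M\<^esub> z"
    if "x \<in> carrier M" "y \<in> carrier M" "z \<in> carrier M" for x y z
    using * that by (simp_all add: ring_axs_def Let_def)
  have eqs2: "x \<oplus>\<^bsub>M\<^esub> y = y \<oplus>\<^bsub>M\<^esub> x" "x \<otimes>\<^bsub>M\<^esub> y = y \<otimes>\<^bsub>M\<^esub> x"
    if "x \<in> carrier M" "y \<in> carrier M" for x y
    using * that cl(1) by (auto simp: ring_axs_def Let_def)
  have eqs1: "\<zero>\<^bsub>M\<^esub> \<oplus>\<^bsub>M\<^esub> x = x" "neg M x \<oplus>\<^bsub>M\<^esub> x = \<zero>\<^bsub>M\<^esub>" "\<one>\<^bsub>M\<^esub> \<otimes>\<^bsub>M\<^esub> x = x"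
    if "x \<in> carrier M" for x
    using * that cl(1) by (auto simp: ring_axs_def Let_def)
  have "abelian_group M"
  proof (rule abelian_groupI)
    show "\<exists>y \<in> carrier M. y \<oplus>\<^bsub>M\<^esub> x = \<zero>\<^bsub>M\<^esub>" if "x \<in> carrier M" for x
      using eqs1(2) cl(5) that by blast
  qed (rule cl eqs eqs1 eqs2(1); assumption)+
  moreover have "Group.comm_monoid M"
    by (rule comm_monoidI) (rule cl eqs eqs1 eqs2(2); assumption?)+
  ultimately have cr: "cring M"
    by (rule cringI) (rule eqs)
  interpret cring M by (rule cr)
  have "neg M x = \<ominus>\<^bsub>M\<^esub> x" if "x \<in> carrier M" for x
    using minus_equality[OF eqs1(2)[OF that] that cl(5)[OF that]] by simp
  with cr show "cring M \<and> (\<forall>x \<in> carrier M. neg M x = \<ominus>\<^bsub>M\<^esub> x)" by blast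
next
  assume *: "cring M \<and> (\<forall>x \<in> carrier M. neg M x = \<ominus>\<^bsub>M\<^esub> x)"
  interpret cring M using * by blast
  show "\<forall>p \<in> ring_axs. \<forall>s. sat M s p"
    using * by (auto simp: ring_axs_def Let_def a_ac m_ac l_neg r_neg l_distr r_distr)
qed

lemma ball_nonunits:
  "(\<forall>x \<in> nonunits M. P x) \<longleftrightarrow>
    (\<forall>x \<in> carrier M. (\<forall>y \<in> carrier M. x \<otimes>\<^bsub>M\<^esub> y \<noteq> \<one>\<^bsub>M\<^esub>) \<longrightarrow> P x)"
  by (auto simp: nonunits_def)

lemma local_ax_iff:
  "(\<forall>s. sat M s local_ax) \<longleftrightarrow> \<zero>\<^bsub>M\<^esub> \<noteq> \<one>\<^bsub>M\<^esub> \<and>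
    (\<forall>x \<in> nonunits M. \<forall>y \<in> nonunits M. \<forall>z \<in> carrier M. (x \<oplus>\<^bsub>M\<^esub> y) \<otimes>\<^bsub>M\<^esub> z \<noteq> \<one>\<^bsub>M\<^esub>)"
  unfolding local_ax_def ball_nonunits by (simp add: sat_nonunit_fm) blast

lemma gorenstein_ax_iff:
  "(\<forall>s. sat M s gorenstein_ax) \<longleftrightarrow> (\<exists>s \<in> carrier M. \<forall>x \<in> carrier M.
     (\<forall>y \<in> nonunits M. y \<otimes>\<^bsub>M\<^esub> x = \<zero>\<^bsub>M\<^esub>) \<longleftrightarrow> (\<exists>r \<in> carrier M. x = r \<otimes>\<^bsub>M\<^esub> s))"
  unfolding gorenstein_ax_def ball_nonunits by (simp add: sat_nonunit_fm)

definition spanned :: "('a, 'm) ring_scheme \<Rightarrow> (nat \<Rightarrow> 'a) \<Rightarrow> nat \<Rightarrow> 'a set" where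
  "spanned R a i = {lin R (\<lambda>j. r j \<otimes>\<^bsub>R\<^esub> a j) i | r. \<forall>j < i. r j \<in> carrier R}"

lemma spanned_cong: "(\<And>j. j < i \<Longrightarrow> a j = b j) \<Longrightarrow> spanned R a i = spanned R b i"
proof -
  assume *: "\<And>j. j < i \<Longrightarrow> a j = b j"
  have "lin R (\<lambda>j. r j \<otimes>\<^bsub>R\<^esub> a j) i = lin R (\<lambda>j. r j \<otimes>\<^bsub>R\<^esub> b j) i" for r
    by (rule lin_cong) (simp add: *)
  then show ?thesis by (simp add: spanned_def)
qed

lemma length_ax_iff:
  assumes "carrier M \<noteq> {}"
  shows "(\<forall>s. sat M s (length_ax l)) \<longleftrightarrow> (\<exists>a. (\<forall>i < l. a i \<in> carrier M) \<and>
    (\<forall>i < l. a i \<notin> spanned M a i \<and> (\<forall>x \<in> nonunits M. x \<otimes>\<^bsub>M\<^esub> a i \<in> spanned M a i)) \<and>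
    carrier M \<subseteq> spanned M a l)"
proof -
  have *: "sat M s (FAnd
     (FConj (map (\<lambda>i. FAnd (FNot (span_fm l i (Var i)))
        (FAll (2 * l) (FImp (nonunit_fm (2 * l + 1) (Var (2 * l)))
           (span_fm l i (Times (Var (2 * l)) (Var i)))))) [0..<l]))
     (FAll (2 * l) (span_fm l l (Var (2 * l))))) \<longleftrightarrow>
    (\<forall>i < l. s i \<notin> spanned M s i \<and> (\<forall>x \<in> nonunits M. x \<otimes>\<^bsub>M\<^esub> s i \<in> spanned M s i)) \<and>
    carrier M \<subseteq> spanned M s l" for s
  proof -
    have 1: "sat M s (span_fm l i t) \<longleftrightarrow> tval M s t \<in> spanned M s i"
      if "i \<le> l" "tvars t \<inter> {l..<l + i} = {}" for s i t
      using sat_span_fm[OF assms that, of s] by (auto simp: spanned_def)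
    have 2: "spanned M (s(2 * l := x)) i = spanned M s i" if "i \<le> l" for x i
      by (rule spanned_cong) (use that in auto)
    have 3: "(\<forall>x \<in> carrier M. sat M (s(2*l := x)) (nonunit_fm (2 * l + 1) (Var (2 * l))) \<longrightarrow> P x) \<longleftrightarrow>
       (\<forall>x \<in> nonunits M. P x)" for P
      by (auto simp: sat_nonunit_fm nonunits_def)
    have "sat M s (FNot (span_fm l i (Var i))) \<longleftrightarrow> s i \<notin> spanned M s i" if "i < l" for i
      using that by (simp add: 1)
    moreover have "sat M s (FAll (2 * l) (FImp (nonunit_fm (2 * l + 1) (Var (2 * l)))
           (span_fm l i (Times (Var (2 * l)) (Var i))))) \<longleftrightarrow> (\<forall>x \<in> nonunits M. x \<otimes>\<^bsub>M\<^esub> s i \<in> spanned M s i)"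
       if "i < l" for i
      unfolding sat_simps 3 using that by (subst 1) (auto simp: 2)
    moreover have "sat M s (FAll (2 * l) (span_fm l l (Var (2 * l)))) \<longleftrightarrow> carrier M \<subseteq> spanned M s l"
    proof (cases "l = 0")
      case True
      then show ?thesis unfolding sat_simps by (subst 1) (auto simp: spanned_def)
    next
      case False
      then show ?thesis unfolding sat_simps by (subst 1) (auto simp: 2)
    qed
    ultimately show ?thesis by (auto simp del: sat_simps(3) simp: atLeast0LessThan)
  qed
  define P where "P a \<longleftrightarrow>
    (\<forall>i < l. a i \<notin> spanned M a i \<and> (\<forall>x \<in> nonunits M. x \<otimes>\<^bsub>M\<^esub> a i \<in> spanned M a i)) \<and>
    carrier M \<subseteq> spanned M a l" for a
  have P: "P a" if "P b" "\<And>i. i < l \<Longrightarrow> a i = b i" for a b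
  proof -
    have "spanned M a i = spanned M b i" if "i \<le> l" for i
      by (rule spanned_cong) (use that \<open>\<And>i. i < l \<Longrightarrow> a i = b i\<close> in auto)
    then show ?thesis using that by (simp add: P_def)
  qed
  have "(\<forall>s. \<exists>t. (\<forall>v \<in> set [0..<l]. t v \<in> carrier M) \<and> (\<forall>v. v \<notin> set [0..<l] \<longrightarrow> t v = s v) \<and> P t) \<longleftrightarrow>
    (\<exists>a. (\<forall>i < l. a i \<in> carrier M) \<and> P a)" (is "?L \<longleftrightarrow> ?R")
  proof
    assume ?L
    from this[rule_format, of undefined] show ?R by (metis atLeastLessThan_iff le0 set_upt)
  next
    assume ?R
    then obtain a where a: "\<forall>i < l. a i \<in> carrier M" "P a" by blast
    show ?L
    proof
      fix s
      have "P (\<lambda>v. if v < l then a v else s v)" by (rule P[OF a(2)]) simp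
      then show "\<exists>t. (\<forall>v \<in> set [0..<l]. t v \<in> carrier M) \<and> (\<forall>v. v \<notin> set [0..<l] \<longrightarrow> t v = s v) \<and> P t"
        using a(1) by (intro exI[of _ "\<lambda>v. if v < l then a v else s v"]) auto
    qed
  qed
  then show ?thesis
    unfolding length_ax_def sat_FExs[OF assms] * P_def .
qed

lemma alg_closed_ax_iff:
  assumes "is_structure M"
  shows "(\<forall>s. sat M s (alg_closed_ax n)) \<longleftrightarrow> (\<forall>c. (\<forall>i < n. c i \<in> carrier M) \<longrightarrow>
    (\<exists>x \<in> carrier M. \<forall>y \<in> carrier M.
       (x [^]\<^bsub>M\<^esub> n \<oplus>\<^bsub>M\<^esub> lin M (\<lambda>j. c j \<otimes>\<^bsub>M\<^esub> x [^]\<^bsub>M\<^esub> j) n) \<otimes>\<^bsub>M\<^esub> y \<noteq> \<one>\<^bsub>M\<^esub>))"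
    (is "?L \<longleftrightarrow> ?R")
proof -
  have ne: "carrier M \<noteq> {}" using assms by (auto simp: is_structure_def)
  define Q where "Q c \<longleftrightarrow> (\<exists>x \<in> carrier M. \<forall>y \<in> carrier M.
       (x [^]\<^bsub>M\<^esub> n \<oplus>\<^bsub>M\<^esub> lin M (\<lambda>j. c j \<otimes>\<^bsub>M\<^esub> x [^]\<^bsub>M\<^esub> j) n) \<otimes>\<^bsub>M\<^esub> y \<noteq> \<one>\<^bsub>M\<^esub>)" for c
  have Qc: "Q c = Q d" if "\<And>i. i < n \<Longrightarrow> c i = d i" for c d
  proof -
    have "lin M (\<lambda>j. c j \<otimes>\<^bsub>M\<^esub> x [^]\<^bsub>M\<^esub> j) n = lin M (\<lambda>j. d j \<otimes>\<^bsub>M\<^esub> x [^]\<^bsub>M\<^esub> j) n" for x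
      by (rule lin_cong) (use that in auto)
    then show ?thesis by (simp add: Q_def)
  qed
  have "sat M s (FEx n (nonunit_fm (n + 1)
     (Plus (pow_tm (Var n) n) (sum_tm (\<lambda>j. Times (Var j) (pow_tm (Var n) j)) n)))) \<longleftrightarrow> Q s" for s
  proof -
    have "n + 1 \<notin> tvars (Plus (pow_tm (Var n) n) (sum_tm (\<lambda>j. Times (Var j) (pow_tm (Var n) j)) n))"
      using tvars_pow_tm[of "Var n"] by (fastforce simp: tvars_sum_tm)
    moreover have "lin M (\<lambda>j. (s(n := x)) j \<otimes>\<^bsub>M\<^esub> x [^]\<^bsub>M\<^esub> j) n = lin M (\<lambda>j. s j \<otimes>\<^bsub>M\<^esub> x [^]\<^bsub>M\<^esub> j) n" for x
      by (rule lin_cong) auto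
    ultimately show ?thesis
      by (simp add: sat_nonunit_fm tval_sum_tm tval_pow_tm Q_def)
  qed
  then have "?L \<longleftrightarrow> (\<forall>s t. (\<forall>v < n. t v \<in> carrier M) \<and> (\<forall>v. \<not> v < n \<longrightarrow> t v = s v) \<longrightarrow> Q t)"
    unfolding alg_closed_ax_def sat_FAlls[OF ne] by (simp add: Ball_def del: sat.simps)
  also have "\<dots> \<longleftrightarrow> (\<forall>c. (\<forall>i < n. c i \<in> carrier M) \<longrightarrow> Q c)" by blast
  finally show ?thesis unfolding Q_def .
qed

context cring begin

lemma nonunits_eq: "nonunits R = carrier R - Units R"
  by (auto simp: nonunits_def Units_def m_comm)

lemma mult_nonunit: "x \<in> nonunits R \<Longrightarrow> y \<in> carrier R \<Longrightarrow> y \<otimes> x \<in> nonunits R"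
  unfolding nonunits_def by (auto simp: m_comm m_assoc) (metis m_assoc m_closed m_comm)

lemma nonunits_ideal:
  assumes "\<zero> \<noteq> \<one>" "\<And>x y. x \<in> nonunits R \<Longrightarrow> y \<in> nonunits R \<Longrightarrow> x \<oplus> y \<in> nonunits R"
  shows "ideal (nonunits R) R"
proof (rule idealI)
  have z: "\<zero> \<in> nonunits R" using assms(1) by (auto simp: nonunits_def)
  have m: "\<ominus> x \<in> nonunits R" if "x \<in> nonunits R" for x
  proof -
    have "x \<in> carrier R" using that by (auto simp: nonunits_def)
    then have "\<ominus> x = (\<ominus> \<one>) \<otimes> x" by (simp add: l_minus)
    then show ?thesis using mult_nonunit[OF that, of "\<ominus> \<one>"] by simp
  qed
  show "subgroup (nonunits R) (add_monoid R)"
    by (rule add.subgroupI) (use z m assms(2) in \<open>auto simp: nonunits_def a_inv_def\<close>)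
  show "ring R" by (rule ring_axioms)
  show "x \<otimes> a \<in> nonunits R" "a \<otimes> x \<in> nonunits R" if "a \<in> nonunits R" "x \<in> carrier R" for a x
    using mult_nonunit[OF that] that m_comm[of a x] by (auto simp: nonunits_def)
qed

lemma proper_ideal_nonunits:
  assumes "ideal J R" "J \<noteq> carrier R"
  shows "J \<subseteq> nonunits R"
proof
  interpret J: ideal J R by fact
  fix x assume x: "x \<in> J"
  show "x \<in> nonunits R"
  proof (rule ccontr)
    assume "x \<notin> nonunits R"
    then obtain y where "y \<in> carrier R" "x \<otimes> y = \<one>"
      using x J.a_Hcarr by (auto simp: nonunits_def)
    then have "\<one> \<in> J" using J.I_r_closed[OF x, of y] by simp
    then show False using J.one_imp_carrier assms(2) by blast
  qed
qed

lemma local_imp: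
  assumes "\<zero> \<noteq> \<one>" "\<And>x y. x \<in> nonunits R \<Longrightarrow> y \<in> nonunits R \<Longrightarrow> x \<oplus> y \<in> nonunits R"
  shows "maximalideal I R \<longleftrightarrow> I = nonunits R"
proof -
  have id: "ideal (nonunits R) R" by (rule nonunits_ideal) (use assms in auto)
  have "\<one> \<notin> nonunits R" using one_closed by (fastforce simp: nonunits_def)
  then have ne: "nonunits R \<noteq> carrier R" by auto
  have "maximalideal (nonunits R) R"
  proof (rule maximalidealI[OF id])
    show "carrier R \<noteq> nonunits R" using ne by simp
    show "J = nonunits R \<or> J = carrier R" if "ideal J R" "nonunits R \<subseteq> J" for J
      using proper_ideal_nonunits[OF that(1)] that(2) by auto
  qed
  moreover have "I = nonunits R" if I: "maximalideal I R"
  proof -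
    interpret I: maximalideal I R by fact
    have "I \<subseteq> nonunits R"
      using proper_ideal_nonunits[OF I.is_ideal] I.I_notcarr by auto
    then show ?thesis using I.I_maximal[OF id] ne by (auto simp: nonunits_def)
  qed
  ultimately show ?thesis by blast
qed

definition comp_series :: "nat \<Rightarrow> (nat \<Rightarrow> 'a set) \<Rightarrow> bool" where
  "comp_series l I \<longleftrightarrow> ideal_chain R l I \<and> I 0 = {\<zero>} \<and> I l = carrier R \<and>
     (\<forall>i < l. \<forall>J. ideal J R \<and> I i \<subseteq> J \<and> J \<subseteq> I (Suc i) \<longrightarrow> J = I i \<or> J = I (Suc i))"

lemma chain_insert:
  assumes "ideal_chain R l I" "ideal J R" "p \<le> Suc l"
    "p > 0 \<Longrightarrow> I (p - 1) \<subset> J" "p \<le> l \<Longrightarrow> J \<subset> I p"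
  shows "ideal_chain R (Suc l) (\<lambda>k. if k < p then I k else if k = p then J else I (k - 1))"
  unfolding ideal_chain_def
proof (intro conjI allI impI)
  fix i
  let ?I = "\<lambda>k. if k < p then I k else if k = p then J else I (k - 1)"
  show "ideal (?I i) R" if "i \<le> Suc l"
    using assms that by (auto simp: ideal_chain_def)
  assume i: "i < Suc l"
  consider "Suc i < p" | "Suc i = p" | "i = p" | "p < i" by linarith
  then show "?I i \<subset> ?I (Suc i)"
  proof cases
    case 4
    then obtain k where k: "i = Suc k" by (cases i) auto
    then have "I k \<subset> I (Suc k)" using i assms(1) by (simp add: ideal_chain_def)
    then show ?thesis using 4 k by simp
  qed (use assms i in \<open>auto simp: ideal_chain_def\<close>)
qed

lemma comp_seriesI:
  assumes I: "ideal_chain R l I" and no: "\<And>I'. \<not> ideal_chain R (Suc l) I'"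
  shows "comp_series l I"
proof -
  have id: "ideal (I i) R" if "i \<le> l" for i using I that by (simp add: ideal_chain_def)
  have 0: "I 0 = {\<zero>}"
  proof (rule ccontr)
    assume *: "I 0 \<noteq> {\<zero>}"
    have "{\<zero>} \<subset> I 0" using id[of 0] * by (auto simp: additive_subgroup.zero_closed ideal.axioms(1))
    then show False using chain_insert[OF I zeroideal, of 0] no by simp
  qed
  have l: "I l = carrier R"
  proof (rule ccontr)
    assume *: "I l \<noteq> carrier R"
    then have "I l \<subset> carrier R" using ideal.Icarr[OF id[of l]] by auto
    then show False using chain_insert[OF I oneideal, of "Suc l"] no by simp
  qed
  have "J = I i \<or> J = I (Suc i)" if "i < l" "ideal J R" "I i \<subseteq> J" "J \<subseteq> I (Suc i)" for i J
  proof (rule ccontr)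
    assume "\<not> ?thesis"
    then have "I i \<subset> J" "J \<subset> I (Suc i)" using that by auto
    then show False using chain_insert[OF I that(2), of "Suc i"] no that(1) by simp
  qed
  then show ?thesis using I 0 l by (auto simp: comp_series_def)
qed

lemma chain_exists: "\<exists>I. ideal_chain R 0 I"
  by (rule exI[of _ "\<lambda>_. {\<zero>}"]) (simp add: ideal_chain_def zeroideal)

lemma chain_shorter: "ideal_chain R n I \<Longrightarrow> m \<le> n \<Longrightarrow> ideal_chain R m I"
  by (auto simp: ideal_chain_def)

lemma length_imp_comp_series:
  assumes "ring_length R = enat l"
  shows "\<exists>I. comp_series l I"
proof -
  let ?S = "{n. \<exists>I. ideal_chain R n I}"
  have S: "ring_length R = Sup (enat ` ?S)"
    unfolding ring_length_def by (rule arg_cong[of _ _ Sup]) auto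
  have le: "n \<le> l" if "n \<in> ?S" for n
  proof -
    have "enat n \<le> Sup (enat ` ?S)" by (rule Sup_upper) (use that in blast)
    then show ?thesis using assms S by simp
  qed
  have fin: "finite ?S" by (rule finite_subset[of _ "{..l}"]) (use le in auto)
  have ne: "?S \<noteq> {}" using chain_exists by blast
  have "Sup (enat ` ?S) = Max (enat ` ?S)"
    by (rule Max_Sup[symmetric]) (use fin ne in auto)
  also have "\<dots> \<in> enat ` ?S" by (rule Max_in) (use fin ne in auto)
  finally have "l \<in> ?S" using assms S by auto
  then obtain I where I: "ideal_chain R l I" by blast
  show ?thesis
    using comp_seriesI[OF I] le[of "Suc l"] by fastforce
qed

text \<open>The number of steps of the composition series that \<open>J\<close> meets: the length of \<open>J\<close>.\<close>

definition steps :: "nat \<Rightarrow> (nat \<Rightarrow> 'a set) \<Rightarrow> 'a set \<Rightarrow> nat" where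
  "steps l I J = card {i. i < l \<and> \<not> J \<inter> I (Suc i) \<subseteq> I i}"

lemma steps_le: "steps l I J \<le> l"
proof -
  have "steps l I J \<le> card {..<l}" unfolding steps_def by (rule card_mono) auto
  then show ?thesis by simp
qed

lemma comp_series_ideal: "comp_series l I \<Longrightarrow> i \<le> l \<Longrightarrow> ideal (I i) R"
  by (auto simp: comp_series_def ideal_chain_def)

lemma comp_series_step:
  assumes I: "comp_series l I" and "i < l" "y \<in> I (Suc i)" "y \<notin> I i" "x \<in> I (Suc i)"
  obtains j r where "j \<in> I i" "r \<in> carrier R" "x = j \<oplus> r \<otimes> y"
proof -
  interpret A: ideal "I i" R using comp_series_ideal[OF I] assms by simp
  interpret B: ideal "I (Suc i)" R using comp_series_ideal[OF I] assms by simp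
  have y: "y \<in> carrier R" using assms(3) by (rule B.a_Hcarr)
  let ?J = "I i <+>\<^bsub>R\<^esub> PIdl y"
  have J: "ideal ?J R" by (rule add_ideals[OF A.is_ideal cgenideal_ideal[OF y]])
  have mem: "x \<in> ?J \<longleftrightarrow> (\<exists>j \<in> I i. \<exists>r \<in> carrier R. x = j \<oplus> r \<otimes> y)" for x
    by (auto simp: set_add_def' cgenideal_def)
  have sub: "I i \<subset> I (Suc i)" using I assms(2) by (simp add: comp_series_def ideal_chain_def)
  have "y \<in> ?J" unfolding mem
    by (rule bexI[of _ \<zero>], rule bexI[of _ \<one>]) (use y in auto)
  moreover have "I i \<subseteq> ?J"
  proof
    fix j assume "j \<in> I i"
    then show "j \<in> ?J" unfolding mem
      by (intro bexI[of _ j] bexI[of _ \<zero>]) (use y A.a_Hcarr in auto)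
  qed
  moreover have "?J \<subseteq> I (Suc i)"
  proof
    fix x assume "x \<in> ?J"
    then show "x \<in> I (Suc i)" unfolding mem using sub B.I_l_closed[OF assms(3)] by auto
  qed
  ultimately have "?J = I (Suc i)"
    using I J assms(2,4) unfolding comp_series_def by blast
  then show ?thesis using that mem[of x] assms(5) by blast
qed

lemma steps_mono:
  assumes "J \<subseteq> K" shows "steps l I J \<le> steps l I K"
  unfolding steps_def by (rule card_mono) (use assms in auto)

lemma steps_strict:
  assumes I: "comp_series l I" and J: "ideal J R" and K: "ideal K R"
    and "J \<subseteq> K" "steps l I J = steps l I K"
  shows "J = K"
proof -
  interpret J: ideal J R by fact
  interpret K: ideal K R by fact
  have eq: "{i. i < l \<and> \<not> J \<inter> I (Suc i) \<subseteq> I i} = {i. i < l \<and> \<not> K \<inter> I (Suc i) \<subseteq> I i}"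
    by (rule card_subset_eq) (use assms(4,5) in \<open>auto simp: steps_def\<close>)
  have "K \<inter> I i \<subseteq> J" if "i \<le> l" for i
    using that
  proof (induction i)
    case 0
    have "I 0 = {\<zero>}" using I by (simp add: comp_series_def)
    then show ?case by auto
  next
    case (Suc i)
    interpret A: ideal "I i" R using comp_series_ideal[OF I] Suc by simp
    interpret B: ideal "I (Suc i)" R using comp_series_ideal[OF I] Suc by simp
    show ?case
    proof
      fix x assume x: "x \<in> K \<inter> I (Suc i)"
      show "x \<in> J"
      proof (cases "K \<inter> I (Suc i) \<subseteq> I i")
        case True
        then show ?thesis using x Suc by auto
      next
        case False
        then have "i \<in> {i. i < l \<and> \<not> J \<inter> I (Suc i) \<subseteq> I i}" unfolding eq using Suc.prems by simp
        then obtain y where y: "y \<in> J" "y \<in> I (Suc i)" "y \<notin> I i" by auto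
        obtain j r where jr: "j \<in> I i" "r \<in> carrier R" "x = j \<oplus> r \<otimes> y"
          using comp_series_step[OF I _ y(2,3), of x] x Suc.prems by auto
        have ry: "r \<otimes> y \<in> J" by (rule J.I_l_closed[OF y(1) jr(2)])
        have c: "j \<in> carrier R" "r \<otimes> y \<in> carrier R" "x \<in> carrier R"
          using jr A.a_Hcarr J.a_Hcarr[OF ry] x K.a_Hcarr by auto
        have j: "j = x \<oplus> \<ominus> (r \<otimes> y)" unfolding jr(3) using c by algebra
        have "\<ominus> (r \<otimes> y) \<in> K" using ry assms(4) K.a_inv_closed by blast
        then have "j \<in> K" unfolding j using x K.a_closed by blast
        then have "j \<in> J" using Suc jr(1) by auto
        then show ?thesis unfolding jr(3) using ry J.a_closed by blast
      qed
    qed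
  qed
  from this[of l] have "K \<subseteq> J" using I K.a_subset by (auto simp: comp_series_def)
  then show ?thesis using assms(4) by auto
qed

lemma comp_series_chain_le:
  assumes I: "comp_series l I" and C: "ideal_chain R n C"
  shows "n \<le> l"
proof -
  have "i \<le> steps l I (C i)" if "i \<le> n" for i
    using that
  proof (induction i)
    case (Suc i)
    have 1: "ideal (C i) R" "ideal (C (Suc i)) R" "C i \<subset> C (Suc i)"
      using C Suc.prems by (auto simp: ideal_chain_def)
    have "steps l I (C i) < steps l I (C (Suc i))"
      using steps_mono[of "C i" "C (Suc i)" l I] steps_strict[OF I 1(1,2)] 1(3) by fastforce
    then show ?case using Suc by simp
  qed simp
  from this[of n] steps_le[of l I "C n"] show ?thesis by simp
qed

lemma comp_series_length:
  assumes I: "comp_series l I"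
  shows "ring_length R = enat l"
  unfolding ring_length_def
proof (rule antisym)
  show "Sup {enat n |n. \<exists>I. ideal_chain R n I} \<le> enat l"
    by (rule Sup_least) (use comp_series_chain_le[OF I] in auto)
  show "enat l \<le> Sup {enat n |n. \<exists>I. ideal_chain R n I}"
    by (rule Sup_upper) (use I in \<open>auto simp: comp_series_def\<close>)
qed

lemma comp_series_artinian:
  assumes I: "comp_series l I"
  shows "artinian_ring R"
  unfolding artinian_ring_def
proof (intro conjI allI impI)
  show "cring R" by (rule cring_axioms)
  fix C :: "nat \<Rightarrow> 'a set" assume C: "(\<forall>n. ideal (C n) R) \<and> (\<forall>n. C (Suc n) \<subseteq> C n)"
  then have dec: "C n \<subseteq> C m" if "m \<le> n" for m n
    using lift_Suc_antimono_le[of C, OF _ that] by blast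
  obtain N where N: "\<And>n. steps l I (C N) \<le> steps l I (C n)"
    using ex_has_least_nat[of "\<lambda>_. True" 0 "\<lambda>n. steps l I (C n)"] by auto
  have "C n = C N" if "n \<ge> N" for n
    by (rule steps_strict[OF I]) (use C dec[OF that] N steps_mono[OF dec[OF that]] in \<open>auto intro!: antisym\<close>)
  then show "\<exists>N. \<forall>n \<ge> N. C n = C N" by blast
qed

lemma comp_series_maximal:
  assumes I: "comp_series l I" and J: "ideal J R" "J \<noteq> carrier R"
  obtains K where "maximalideal K R" "J \<subseteq> K"
proof -
  let ?P = "\<lambda>K. ideal K R \<and> K \<noteq> carrier R \<and> J \<subseteq> K"
  obtain K where K: "?P K" "\<And>K'. ?P K' \<Longrightarrow> steps l I K' \<le> steps l I K"
    using ex_has_greatest_nat[of ?P J "steps l I" "Suc l"] J steps_le[of l I]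
    by (metis le_imp_less_Suc order_refl)
  have "maximalideal K R"
  proof (rule maximalidealI)
    show "ideal K R" "carrier R \<noteq> K" using K by auto
    fix L assume L: "ideal L R" "K \<subseteq> L" "L \<subseteq> carrier R"
    show "L = K \<or> L = carrier R"
    proof (rule ccontr)
      assume *: "\<not> ?thesis"
      then have "steps l I L \<le> steps l I K" using K L by blast
      then have "K = L"
        by (intro steps_strict[OF I _ L(1,2)] antisym steps_mono[OF L(2)]) (use K(1) in simp)
      then show False using * by simp
    qed
  qed
  then show ?thesis using that K(1) by blast
qed

lemma local_iff:
  assumes I: "comp_series l I"
  shows "local_ring R \<longleftrightarrow>
    \<zero> \<noteq> \<one> \<and> (\<forall>x \<in> nonunits R. \<forall>y \<in> nonunits R. \<forall>z \<in> carrier R. (x \<oplus> y) \<otimes> z \<noteq> \<one>)"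
    (is "_ \<longleftrightarrow> ?R")
proof
  assume ?R
  then have *: "\<zero> \<noteq> \<one>" "\<And>x y. x \<in> nonunits R \<Longrightarrow> y \<in> nonunits R \<Longrightarrow> x \<oplus> y \<in> nonunits R"
    by (auto simp: nonunits_def)
  show "local_ring R" unfolding local_ring_def using local_imp[OF *] cring_axioms by simp
next
  assume "local_ring R"
  then obtain m where m: "maximalideal m R" "\<And>I. maximalideal I R \<Longrightarrow> I = m"
    unfolding local_ring_def by auto
  interpret m: maximalideal m R by (rule m(1))
  have mN: "m \<subseteq> nonunits R" using proper_ideal_nonunits[OF m.is_ideal] m.I_notcarr by auto
  have "x \<in> m" if x: "x \<in> nonunits R" for x
  proof -
    have xc: "x \<in> carrier R" using x by (simp add: nonunits_def)
    have "\<one> \<notin> PIdl x"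
    proof
      assume "\<one> \<in> PIdl x"
      then obtain r where "r \<in> carrier R" "\<one> = r \<otimes> x" by (auto simp: cgenideal_def)
      then show False using x m_comm[of x r] xc by (auto simp: nonunits_def)
    qed
    then have "PIdl x \<noteq> carrier R" by auto
    then obtain K where "maximalideal K R" "PIdl x \<subseteq> K"
      using comp_series_maximal[OF I cgenideal_ideal[OF xc]] by blast
    then show ?thesis using m(2) cgenideal_self[OF xc] by blast
  qed
  then have mN: "m = nonunits R" using mN by blast
  have "\<zero> \<noteq> \<one>"
  proof
    assume "\<zero> = \<one>"
    then have "\<one> \<in> m" using m.zero_closed by simp
    then show False using m.one_imp_carrier m.I_notcarr by blast
  qed
  moreover have "(x \<oplus> y) \<otimes> z \<noteq> \<one>" if "x \<in> nonunits R" "y \<in> nonunits R" "z \<in> carrier R" for x y z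
    using m.a_closed[of x y] that unfolding mN by (auto simp: nonunits_def)
  ultimately show ?R by blast
qed

lemma spanned_0: "spanned R a 0 = {\<zero>}"
  by (auto simp: spanned_def)

lemma lin_closed: "(\<And>j. j < i \<Longrightarrow> f j \<in> carrier R) \<Longrightarrow> lin R f i \<in> carrier R"
  by (induction i) auto

lemma spanned_Suc:
  assumes "\<And>j. j \<le> i \<Longrightarrow> a j \<in> carrier R"
  shows "spanned R a (Suc i) = spanned R a i <+>\<^bsub>R\<^esub> PIdl (a i)"
proof (intro equalityI subsetI)
  fix x assume "x \<in> spanned R a (Suc i)"
  then obtain r where r: "\<forall>j < Suc i. r j \<in> carrier R" "x = lin R (\<lambda>j. r j \<otimes> a j) (Suc i)"
    by (auto simp: spanned_def)
  then have "lin R (\<lambda>j. r j \<otimes> a j) i \<in> spanned R a i" "r i \<otimes> a i \<in> PIdl (a i)"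
    by (auto simp: spanned_def cgenideal_def)
  then show "x \<in> spanned R a i <+>\<^bsub>R\<^esub> PIdl (a i)"
    using r(2) by (auto simp: set_add_def')
next
  fix x assume "x \<in> spanned R a i <+>\<^bsub>R\<^esub> PIdl (a i)"
  then obtain r c where r: "\<forall>j < i. r j \<in> carrier R" "c \<in> carrier R"
    "x = lin R (\<lambda>j. r j \<otimes> a j) i \<oplus> c \<otimes> a i"
    by (auto simp: set_add_def' spanned_def cgenideal_def)
  have "lin R (\<lambda>j. (r(i := c)) j \<otimes> a j) i = lin R (\<lambda>j. r j \<otimes> a j) i"
    by (rule lin_cong) auto
  then have "x = lin R (\<lambda>j. (r(i := c)) j \<otimes> a j) (Suc i)" using r(3) by simp
  moreover have "\<forall>j < Suc i. (r(i := c)) j \<in> carrier R" using r by (auto simp: less_Suc_eq)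
  ultimately show "x \<in> spanned R a (Suc i)" unfolding spanned_def by blast
qed

lemma spanned_ideal:
  "(\<And>j. j < i \<Longrightarrow> a j \<in> carrier R) \<Longrightarrow> ideal (spanned R a i) R"
proof (induction i)
  case 0
  then show ?case by (simp add: spanned_0 zeroideal)
next
  case (Suc i)
  then show ?case by (simp add: spanned_Suc add_ideals cgenideal_ideal)
qed

lemma length_iff:
  assumes loc: "\<zero> \<noteq> \<one>" "\<And>x y. x \<in> nonunits R \<Longrightarrow> y \<in> nonunits R \<Longrightarrow> x \<oplus> y \<in> nonunits R"
  shows "(\<exists>I. comp_series l I) \<longleftrightarrow> (\<exists>a. (\<forall>i < l. a i \<in> carrier R) \<and>
    (\<forall>i < l. a i \<notin> spanned R a i \<and> (\<forall>x \<in> nonunits R. x \<otimes> a i \<in> spanned R a i)) \<and>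
    carrier R \<subseteq> spanned R a l)" (is "_ \<longleftrightarrow> ?R")
proof
  assume ?R
  then obtain a where a: "\<And>i. i < l \<Longrightarrow> a i \<in> carrier R" "\<And>i. i < l \<Longrightarrow> a i \<notin> spanned R a i"
    "\<And>i x. i < l \<Longrightarrow> x \<in> nonunits R \<Longrightarrow> x \<otimes> a i \<in> spanned R a i" "carrier R \<subseteq> spanned R a l"
    by blast
  have id: "ideal (spanned R a i) R" if "i \<le> l" for i
    by (rule spanned_ideal) (use a that in auto)
  have mem: "x \<in> spanned R a (Suc i) \<longleftrightarrow> (\<exists>s \<in> spanned R a i. \<exists>r \<in> carrier R. x = s \<oplus> r \<otimes> a i)"
    if "i < l" for i x
    using that by (subst spanned_Suc) (auto simp: a set_add_def' cgenideal_def)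
  have "comp_series l (spanned R a)"
    unfolding comp_series_def ideal_chain_def
  proof (intro conjI allI impI)
    show "spanned R a 0 = {\<zero>}" by (rule spanned_0)
    show "spanned R a l = carrier R" using a(4) ideal.Icarr[OF id[of l]] by auto
    show "ideal (spanned R a i) R" if "i \<le> l" for i using id that .
    show "spanned R a i \<subset> spanned R a (Suc i)" if i: "i < l" for i
    proof -
      interpret A: ideal "spanned R a i" R using id i by simp
      have "s \<in> spanned R a (Suc i)" if "s \<in> spanned R a i" for s
        unfolding mem[OF i] by (rule bexI[OF _ that], rule bexI[of _ \<zero>]) (use that a(1)[OF i] in auto)
      moreover have "a i \<in> spanned R a (Suc i)"
        unfolding mem[OF i] by (rule bexI[of _ \<zero>], rule bexI[of _ \<one>]) (use a(1)[OF i] in auto)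
      ultimately show ?thesis using a(2)[OF i] by blast
    qed
    fix i J
    assume i: "i < l" and J: "ideal J R \<and> spanned R a i \<subseteq> J \<and> J \<subseteq> spanned R a (Suc i)"
    interpret A: ideal "spanned R a i" R using id i by simp
    interpret J: ideal J R using J by blast
    show "J = spanned R a i \<or> J = spanned R a (Suc i)"
    proof (cases "J \<subseteq> spanned R a i")
      case False
      then obtain x where x: "x \<in> J" "x \<notin> spanned R a i" by blast
      obtain s r where sr: "s \<in> spanned R a i" "r \<in> carrier R" "x = s \<oplus> r \<otimes> a i"
        using x J mem[OF i, of x] by blast
      have "r \<otimes> a i \<notin> spanned R a i" using x(2) sr A.a_closed by blast
      then have "r \<notin> nonunits R" using a(3)[OF i] by blast
      then obtain u where u: "u \<in> carrier R" "r \<otimes> u = \<one>" using sr(2) by (auto simp: nonunits_def)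
      have c: "s \<in> carrier R" "a i \<in> carrier R" using sr(1) a(1)[OF i] by auto
      have "r \<otimes> a i = x \<oplus> \<ominus> s" unfolding sr(3) using c sr(2) by algebra
      moreover have "s \<in> J" using sr(1) J by blast
      ultimately have "r \<otimes> a i \<in> J" using x(1) J.a_closed J.a_inv_closed by simp
      then have "u \<otimes> (r \<otimes> a i) \<in> J" using J.I_l_closed u(1) by blast
      moreover have "u \<otimes> (r \<otimes> a i) = (r \<otimes> u) \<otimes> a i" using c sr(2) u(1) by algebra
      ultimately have aJ: "a i \<in> J" using u(2) c by simp
      have "spanned R a (Suc i) \<subseteq> J"
      proof
        fix y assume "y \<in> spanned R a (Suc i)"
        then obtain s r where "s \<in> spanned R a i" "r \<in> carrier R" "y = s \<oplus> r \<otimes> a i"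
          using mem[OF i] by blast
        then show "y \<in> J" using J J.I_l_closed[OF aJ] J.a_closed by blast
      qed
      then show ?thesis using J by blast
    qed (use J in blast)
  qed
  then show "\<exists>I. comp_series l I" by blast
next
  assume "\<exists>I. comp_series l I"
  then obtain I where I: "comp_series l I" by blast
  have sub: "I i \<subset> I (Suc i)" if "i < l" for i
    using I that by (simp add: comp_series_def ideal_chain_def)
  then have "\<exists>y. y \<in> I (Suc i) \<and> y \<notin> I i" if "i < l" for i using that by blast
  then obtain a where a: "\<And>i. i < l \<Longrightarrow> a i \<in> I (Suc i)" "\<And>i. i < l \<Longrightarrow> a i \<notin> I i" by metis
  have ac: "a i \<in> carrier R" if "i < l" for i
    using a(1)[OF that] ideal.Icarr[OF comp_series_ideal[OF I, of "Suc i"]] that by auto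
  have sp: "spanned R a i = I i" if "i \<le> l" for i
    using that
  proof (induction i)
    case 0
    then show ?case using I by (simp add: spanned_0 comp_series_def)
  next
    case (Suc i)
    then have i: "i < l" by simp
    interpret B: ideal "I (Suc i)" R using comp_series_ideal[OF I] Suc by simp
    have "spanned R a (Suc i) = I i <+>\<^bsub>R\<^esub> PIdl (a i)"
      using Suc ac by (subst spanned_Suc) auto
    also have "\<dots> = I (Suc i)"
    proof (intro equalityI subsetI)
      fix x assume "x \<in> I i <+>\<^bsub>R\<^esub> PIdl (a i)"
      then obtain s r where "s \<in> I i" "r \<in> carrier R" "x = s \<oplus> r \<otimes> a i"
        by (auto simp: set_add_def' cgenideal_def)
      then show "x \<in> I (Suc i)"
        using sub[OF i] B.I_l_closed[OF a(1)[OF i]] B.a_closed by blast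
    next
      fix x assume "x \<in> I (Suc i)"
      then obtain s r where "s \<in> I i" "r \<in> carrier R" "x = s \<oplus> r \<otimes> a i"
        using comp_series_step[OF I i a(1)[OF i] a(2)[OF i]] by blast
      then show "x \<in> I i <+>\<^bsub>R\<^esub> PIdl (a i)" by (auto simp: set_add_def' cgenideal_def)
    qed
    finally show ?case .
  qed
  have "x \<otimes> a i \<in> I i" if i: "i < l" and x: "x \<in> nonunits R" for i x
  proof (rule ccontr)
    assume *: "x \<otimes> a i \<notin> I i"
    interpret A: ideal "I i" R using comp_series_ideal[OF I] i by simp
    interpret B: ideal "I (Suc i)" R using comp_series_ideal[OF I] i by simp
    have xc: "x \<in> carrier R" using x by (simp add: nonunits_def)
    obtain j r where jr: "j \<in> I i" "r \<in> carrier R" "a i = j \<oplus> r \<otimes> (x \<otimes> a i)"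
      using comp_series_step[OF I i B.I_l_closed[OF a(1)[OF i] xc] * a(1)[OF i]] by blast
    have rx: "r \<otimes> x \<in> nonunits R" using mult_nonunit[OF x jr(2)] .
    have jc: "j \<in> carrier R" using jr(1) by (rule A.a_Hcarr)
    let ?u = "\<one> \<oplus> \<ominus> (r \<otimes> x)"
    have "?u \<notin> nonunits R"
    proof
      assume "?u \<in> nonunits R"
      then have "?u \<oplus> r \<otimes> x \<in> nonunits R" using loc(2) rx by blast
      moreover have "?u \<oplus> r \<otimes> x = \<one>" using xc jr(2) by algebra
      ultimately show False by (auto simp: nonunits_def)
    qed
    then obtain v where v: "v \<in> carrier R" "?u \<otimes> v = \<one>"
      using xc jr(2) by (auto simp: nonunits_def)
    have "j = a i \<oplus> \<ominus> (r \<otimes> (x \<otimes> a i))"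
    proof -
      have "j = (j \<oplus> r \<otimes> (x \<otimes> a i)) \<oplus> \<ominus> (r \<otimes> (x \<otimes> a i))" using jc xc jr(2) ac[OF i] by algebra
      then show ?thesis using jr(3) by simp
    qed
    also have "\<dots> = ?u \<otimes> a i" using xc jr(2) ac[OF i] by algebra
    finally have "v \<otimes> j = v \<otimes> (?u \<otimes> a i)" by simp
    also have "\<dots> = (?u \<otimes> v) \<otimes> a i" using xc jr(2) ac[OF i] v(1) by algebra
    also have "\<dots> = a i" using v(2) ac[OF i] by simp
    finally have "a i \<in> I i" using A.I_l_closed[OF jr(1) v(1)] by simp
    then show False using a(2)[OF i] by simp
  qed
  moreover have "I l = carrier R" using I by (simp add: comp_series_def)
  ultimately show ?R using sp a ac by (intro exI[of _ a]) auto
qed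

lemma socle_ideal:
  assumes "ideal m R" "max_ideal R = m"
  shows "ideal (socle R) R"
proof (rule idealI)
  interpret m: ideal m R by fact
  have S: "socle R = {x \<in> carrier R. \<forall>y \<in> m. y \<otimes> x = \<zero>}" by (simp add: socle_def assms(2))
  show "ring R" by (rule ring_axioms)
  show "subgroup (socle R) (add_monoid R)"
  proof (rule add.subgroupI)
    show "socle R \<subseteq> carrier R" by (auto simp: S)
    have "\<zero> \<in> socle R" by (auto simp: S)
    then show "socle R \<noteq> {}" by blast
    show "\<ominus> x \<in> socle R" if "x \<in> socle R" for x
      using that by (auto simp: S r_minus)
    show "x \<oplus> y \<in> socle R" if "x \<in> socle R" "y \<in> socle R" for x y
      using that by (auto simp: S r_distr)
  qed
  have 1: "x \<otimes> a \<in> socle R" if "a \<in> socle R" "x \<in> carrier R" for a x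
  proof -
    have a: "a \<in> carrier R" "\<And>y. y \<in> m \<Longrightarrow> y \<otimes> a = \<zero>" using that by (auto simp: S)
    have "y \<otimes> (x \<otimes> a) = \<zero>" if "y \<in> m" for y
    proof -
      have "y \<otimes> (x \<otimes> a) = x \<otimes> (y \<otimes> a)" using a(1) \<open>x \<in> carrier R\<close> m.a_Hcarr[OF that] by algebra
      then show ?thesis using a(2)[OF that] \<open>x \<in> carrier R\<close> by simp
    qed
    then show ?thesis using a \<open>x \<in> carrier R\<close> by (auto simp: S)
  qed
  show "x \<otimes> a \<in> socle R" "a \<otimes> x \<in> socle R" if "a \<in> socle R" "x \<in> carrier R" for a x
  proof -
    show "x \<otimes> a \<in> socle R" using 1[OF that] .
    moreover have "a \<in> carrier R" using that by (auto simp: S)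
    ultimately show "a \<otimes> x \<in> socle R" using m_comm[OF _ that(2), of a] by simp
  qed
qed

lemma socle_iff:
  assumes "ideal (nonunits R) R" "max_ideal R = nonunits R"
  shows "principalideal (socle R) R \<longleftrightarrow> (\<exists>s \<in> carrier R. \<forall>x \<in> carrier R.
     (\<forall>y \<in> nonunits R. y \<otimes> x = \<zero>) \<longleftrightarrow> (\<exists>r \<in> carrier R. x = r \<otimes> s))"
proof -
  have id: "ideal (socle R) R" by (rule socle_ideal) (use assms in auto)
  have "principalideal (socle R) R \<longleftrightarrow> (\<exists>s \<in> carrier R. socle R = PIdl s)"
    using id principalideal.generate[of "socle R" R] principalidealI[OF id]
    by (auto simp: cgenideal_eq_genideal)
  also have "\<dots> \<longleftrightarrow> (\<exists>s \<in> carrier R. \<forall>x \<in> carrier R.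
     (\<forall>y \<in> nonunits R. y \<otimes> x = \<zero>) \<longleftrightarrow> (\<exists>r \<in> carrier R. x = r \<otimes> s))"
  proof (rule bex_cong[OF refl])
    fix s assume "s \<in> carrier R"
    then show "socle R = PIdl s \<longleftrightarrow> (\<forall>x \<in> carrier R.
     (\<forall>y \<in> nonunits R. y \<otimes> x = \<zero>) \<longleftrightarrow> (\<exists>r \<in> carrier R. x = r \<otimes> s))"
      unfolding socle_def assms(2) cgenideal_def set_eq_iff by auto
  qed
  finally show ?thesis .
qed

lemma eval_rev_map:
  assumes "\<And>j. j < n \<Longrightarrow> c j \<in> carrier R" "x \<in> carrier R"
  shows "eval (map c (rev [0..<n])) x = lin R (\<lambda>j. c j \<otimes> x [^] j) n"
  using assms(1)
proof (induction n)
  case (Suc n)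
  have "lin R (\<lambda>j. c j \<otimes> x [^] j) n \<in> carrier R"
    by (rule lin_closed) (use Suc assms(2) in auto)
  then show ?case using Suc assms(2) by (simp add: a_comm)
qed simp

lemma eval_map_mult:
  assumes "set q \<subseteq> carrier R" "b \<in> carrier R" "x \<in> carrier R"
  shows "eval (map ((\<otimes>) b) q) x = b \<otimes> eval q x"
  using assms eval_in_carrier by (induct q) (auto simp add: m_assoc r_distr)

lemma monic_roots_iff:
  "(\<forall>n \<ge> (1 :: nat). \<forall>c. (\<forall>i < n. c i \<in> carrier R) \<longrightarrow>
      (\<exists>x \<in> carrier R. \<forall>y \<in> carrier R.
         (x [^] n \<oplus> lin R (\<lambda>j. c j \<otimes> x [^] j) n) \<otimes> y \<noteq> \<one>)) \<longleftrightarrow>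
    (\<forall>r. set r \<subseteq> carrier R \<and> r \<noteq> [] \<longrightarrow>
      (\<exists>x \<in> carrier R. eval (\<one> # r) x \<in> nonunits R))" (is "?R \<longleftrightarrow> ?L")
proof -
  define A where "A r \<longleftrightarrow> (\<exists>x \<in> carrier R. eval (\<one> # r) x \<in> nonunits R)" for r
  have "?R \<longleftrightarrow> (\<forall>r. set r \<subseteq> carrier R \<and> r \<noteq> [] \<longrightarrow> A r)"
  proof -
    have e: "A (map c (rev [0..<n])) \<longleftrightarrow> (\<exists>x \<in> carrier R. \<forall>y \<in> carrier R.
         (x [^] n \<oplus> lin R (\<lambda>j. c j \<otimes> x [^] j) n) \<otimes> y \<noteq> \<one>)"
      if c: "\<forall>i < n. c i \<in> carrier R" for c and n :: nat
      unfolding A_def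
    proof (rule bex_cong[OF refl])
      fix x assume x: "x \<in> carrier R"
      have "lin R (\<lambda>j. c j \<otimes> x [^] j) n \<in> carrier R"
        by (rule lin_closed) (use c x in auto)
      then show "eval (\<one> # map c (rev [0..<n])) x \<in> nonunits R \<longleftrightarrow> (\<forall>y \<in> carrier R.
         (x [^] n \<oplus> lin R (\<lambda>j. c j \<otimes> x [^] j) n) \<otimes> y \<noteq> \<one>)"
        using x c by (simp add: eval_rev_map nonunits_def)
    qed
    show ?thesis
    proof (intro iffI allI impI)
      fix r assume R: ?R and r: "set r \<subseteq> carrier R \<and> r \<noteq> []"
      have "\<forall>i < length r. coeff r i \<in> carrier R" using r by simp
      moreover have "length r \<ge> 1" using r by (cases r) auto
      ultimately have "A (map (coeff r) (rev [0..<length r]))" using R e by blast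
      then show "A r" by (simp only: coeff_list)
    next
      fix n :: nat and c
      assume B: "\<forall>r. set r \<subseteq> carrier R \<and> r \<noteq> [] \<longrightarrow> A r" and n: "1 \<le> n"
        and c: "\<forall>i < n. c i \<in> carrier R"
      have "set (map c (rev [0..<n])) \<subseteq> carrier R \<and> map c (rev [0..<n]) \<noteq> []" using n c by auto
      then have "A (map c (rev [0..<n]))" using B by blast
      then show "\<exists>x \<in> carrier R. \<forall>y \<in> carrier R.
         (x [^] n \<oplus> lin R (\<lambda>j. c j \<otimes> x [^] j) n) \<otimes> y \<noteq> \<one>" using e[OF c] by blast
    qed
  qed
  then show ?thesis unfolding A_def .
qed

lemma alg_closed_hom_iff:
  assumes one: "\<one> \<noteq> \<zero>" and "field K" "ring_hom_ring R K h"
    and hsurj: "\<And>Z. Z \<in> carrier K \<Longrightarrow> \<exists>x \<in> carrier R. h x = Z"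
    and hz: "\<And>x. x \<in> carrier R \<Longrightarrow> h x = \<zero>\<^bsub>K\<^esub> \<longleftrightarrow> x \<in> nonunits R"
  shows "algebraically_closed K \<longleftrightarrow> (\<forall>r. set r \<subseteq> carrier R \<and> r \<noteq> [] \<longrightarrow>
      (\<exists>x \<in> carrier R. eval (\<one> # r) x \<in> nonunits R))"
proof -
  interpret K: field K by fact
  interpret h: ring_hom_ring R K h by fact
  have ev: "K.eval (map h (\<one> # r)) (h x) = h (eval (\<one> # r) x)"
    if "set r \<subseteq> carrier R" "x \<in> carrier R" for r x
  proof -
    have "\<one> # r \<in> carrier (poly_ring R)"
      using that one by (auto simp: univ_poly_carrier[symmetric] polynomial_def)
    from h.eval_hom[OF carrier_is_subring that(2) this] show ?thesis by (rule sym)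
  qed
  define A where "A r \<longleftrightarrow> (\<exists>x \<in> carrier R. eval (\<one> # r) x \<in> nonunits R)" for r
  show ?thesis unfolding A_def[symmetric]
  proof (intro iffI allI impI)
    fix r assume ac: "algebraically_closed K" and r: "set r \<subseteq> carrier R \<and> r \<noteq> []"
    let ?p = "map h (\<one> # r)"
    have p: "?p \<in> carrier (poly_ring K)"
      using r one h.hom_closed by (auto simp: univ_poly_carrier[symmetric] polynomial_def)
    have "K.splitted ?p" using algebraically_closed.roots_over_carrier[OF ac p] .
    moreover have "degree ?p > 0" using r by (cases r) auto
    ultimately have "K.roots ?p \<noteq> {#}" unfolding K.splitted_def by auto
    then obtain Z where "Z \<in># K.roots ?p" by blast
    then have Z: "Z \<in> carrier K" "K.eval ?p Z = \<zero>\<^bsub>K\<^esub>"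
      using K.roots_mem_iff_is_root[OF p] by (auto simp: K.is_root_def)
    obtain x where x: "x \<in> carrier R" "h x = Z" using hsurj[OF Z(1)] by blast
    have "eval (\<one> # r) x \<in> carrier R" by (rule eval_in_carrier) (use r x in auto)
    then show "A r"
      using Z(2) ev[of r x] r x hz unfolding A_def by auto
  next
    assume B: "\<forall>r. set r \<subseteq> carrier R \<and> r \<noteq> [] \<longrightarrow> A r"
    show "algebraically_closed K"
    proof (rule K.algebraically_closedI)
      fix p assume p: "p \<in> carrier (poly_ring K)" and deg: "degree p > 1"
      obtain a q where pq: "p = a # q" using deg by (cases p) auto
      have a: "a \<in> carrier K" "a \<noteq> \<zero>\<^bsub>K\<^esub>" and q: "set q \<subseteq> carrier K" "q \<noteq> []"
        using p deg by (auto simp: univ_poly_carrier[symmetric] polynomial_def pq)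
      let ?b = "inv\<^bsub>K\<^esub> a"
      have b: "?b \<in> carrier K" "a \<otimes>\<^bsub>K\<^esub> ?b = \<one>\<^bsub>K\<^esub>"
        using a K.field_Units by auto
      let ?q = "map ((\<otimes>\<^bsub>K\<^esub>) ?b) q"
      have "set ?q \<subseteq> h ` carrier R"
      proof
        fix Z assume "Z \<in> set ?q"
        then have "Z \<in> carrier K" using q(1) b(1) by auto
        then show "Z \<in> h ` carrier R" using hsurj by blast
      qed
      then have "?q \<in> lists (h ` carrier R)" by (simp add: in_lists_conv_set subset_iff)
      then have "?q \<in> map h ` lists (carrier R)" by (simp add: lists_image)
      then obtain r where r: "?q = map h r" "set r \<subseteq> carrier R" by auto
      then have "r \<noteq> []" using q(2) by auto
      then obtain x where x: "x \<in> carrier R" "eval (\<one> # r) x \<in> nonunits R"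
        using B r(2) by (auto simp: A_def)
      let ?Z = "h x"
      have Z: "?Z \<in> carrier K" using x by simp
      have "K.eval (map h (\<one> # r)) ?Z = \<zero>\<^bsub>K\<^esub>"
        using ev[OF r(2) x(1)] hz x(2) by (auto simp: nonunits_def)
      then have z: "?Z [^]\<^bsub>K\<^esub> length q \<oplus>\<^bsub>K\<^esub> ?b \<otimes>\<^bsub>K\<^esub> K.eval q ?Z = \<zero>\<^bsub>K\<^esub>"
        using K.eval_map_mult[OF q(1) b(1) Z] r(1)[symmetric] Z
        by (simp add: length_map[of h r, symmetric] del: length_map) (simp add: length_map)
      have Y: "K.eval q ?Z \<in> carrier K" by (rule K.eval_in_carrier[OF q(1) Z])
      have "K.eval p ?Z = a \<otimes>\<^bsub>K\<^esub> ?Z [^]\<^bsub>K\<^esub> length q \<oplus>\<^bsub>K\<^esub> (a \<otimes>\<^bsub>K\<^esub> ?b) \<otimes>\<^bsub>K\<^esub> K.eval q ?Z"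
        unfolding pq b(2) using Y by simp
      also have "\<dots> = a \<otimes>\<^bsub>K\<^esub> (?Z [^]\<^bsub>K\<^esub> length q \<oplus>\<^bsub>K\<^esub> ?b \<otimes>\<^bsub>K\<^esub> K.eval q ?Z)"
        using a(1) b(1) Z Y by (simp add: K.r_distr K.m_assoc)
      also have "\<dots> = \<zero>\<^bsub>K\<^esub>" using z a(1) by simp
      finally show "\<exists>Z \<in> carrier K. K.eval p Z = \<zero>\<^bsub>K\<^esub>" using Z by blast
    qed
  qed
qed

lemma alg_closed_iff:
  assumes N: "maximalideal (nonunits R) R"
  shows "algebraically_closed (R Quot nonunits R) \<longleftrightarrow>
    (\<forall>n \<ge> (1 :: nat). \<forall>c. (\<forall>i < n. c i \<in> carrier R) \<longrightarrow>
      (\<exists>x \<in> carrier R. \<forall>y \<in> carrier R.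
         (x [^] n \<oplus> lin R (\<lambda>j. c j \<otimes> x [^] j) n) \<otimes> y \<noteq> \<one>))"
proof -
  interpret N: maximalideal "nonunits R" R by (rule N)
  let ?K = "R Quot nonunits R" and ?h = "(+>) (nonunits R)"
  have hsurj: "\<exists>x \<in> carrier R. ?h x = Z" if "Z \<in> carrier ?K" for Z
  proof -
    have "Z \<in> a_rcosets\<^bsub>R\<^esub> (nonunits R)" using that by (simp only: FactRing_def partial_object.simps)
    then show ?thesis unfolding A_RCOSETS_def'[of R "nonunits R"] by blast
  qed
  have hz: "?h x = \<zero>\<^bsub>?K\<^esub> \<longleftrightarrow> x \<in> nonunits R" if "x \<in> carrier R" for x
  proof -
    have "\<zero>\<^bsub>?K\<^esub> = nonunits R" by (simp only: FactRing_def ring.simps)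
    then show ?thesis
      using N.rcos_const_imp_mem[OF that] a_rcos_zero[OF N.is_ideal, of x] by blast
  qed
  have "\<one> \<notin> nonunits R" using one_closed l_one[OF one_closed] unfolding nonunits_def by blast
  then have one: "\<one> \<noteq> \<zero>" using N.zero_closed by metis
  show ?thesis
    unfolding monic_roots_iff
    by (rule alg_closed_hom_iff[OF one N.quotient_is_field[OF cring_axioms] N.rcos_ring_hom_ring hsurj hz])
qed

end

theorem is_model_Gor_iff:
  "is_model M (Gor l) \<longleftrightarrow>
     is_structure M \<and> gor_class l M \<and> (\<forall>x \<in> carrier M. neg M x = \<ominus>\<^bsub>M\<^esub> x)"
proof (cases "is_structure M \<and> cring M \<and> (\<forall>x \<in> carrier M. neg M x = \<ominus>\<^bsub>M\<^esub> x)")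
  case False
  moreover have "cring M" if "gor_class l M"
    using that by (simp add: gor_class_def gorenstein_ring_def local_ring_def)
  moreover have "is_model M (Gor l) \<Longrightarrow> is_structure M \<and> cring M \<and> (\<forall>x \<in> carrier M. neg M x = \<ominus>\<^bsub>M\<^esub> x)"
    using ring_axs_iff[of M] unfolding is_model_Gor_iff_sat by (auto simp: Gor_def)
  ultimately show ?thesis by blast
next
  case True
  then have st: "is_structure M" and neg: "\<forall>x \<in> carrier M. neg M x = \<ominus>\<^bsub>M\<^esub> x" by auto
  interpret cring M using True by blast
  have ne: "carrier M \<noteq> {}" using zero_closed by blast
  define loc where "loc \<longleftrightarrow> \<zero>\<^bsub>M\<^esub> \<noteq> \<one>\<^bsub>M\<^esub> \<and>
    (\<forall>x \<in> nonunits M. \<forall>y \<in> nonunits M. \<forall>z \<in> carrier M. (x \<oplus>\<^bsub>M\<^esub> y) \<otimes>\<^bsub>M\<^esub> z \<noteq> \<one>\<^bsub>M\<^esub>)"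
  have loc: "\<zero>\<^bsub>M\<^esub> \<noteq> \<one>\<^bsub>M\<^esub>"
      "\<And>x y. x \<in> nonunits M \<Longrightarrow> y \<in> nonunits M \<Longrightarrow> x \<oplus>\<^bsub>M\<^esub> y \<in> nonunits M" if loc
    using that by (auto simp: loc_def nonunits_def)
  have mx: "maximalideal (nonunits M) M" "max_ideal M = nonunits M" if loc
    using local_imp[OF loc[OF that]] by (auto simp: max_ideal_def)
  have "is_model M (Gor l) \<longleftrightarrow> (\<forall>p \<in> Gor l. \<forall>s. sat M s p)"
    using st by (simp add: is_model_Gor_iff_sat)
  also have "\<dots> \<longleftrightarrow> (\<forall>p \<in> ring_axs. \<forall>s. sat M s p) \<and> (\<forall>s. sat M s local_ax) \<and>
      (\<forall>s. sat M s (length_ax l)) \<and> (\<forall>s. sat M s gorenstein_ax) \<and>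
      (\<forall>n \<ge> 1. \<forall>s. sat M s (alg_closed_ax n))"
    unfolding Gor_def by blast
  also have "\<dots> \<longleftrightarrow> loc \<and> (\<forall>s. sat M s (length_ax l)) \<and>
      (\<forall>s. sat M s gorenstein_ax) \<and> (\<forall>n \<ge> 1. \<forall>s. sat M s (alg_closed_ax n))"
    using neg ring_axs_iff[OF st] cring_axioms local_ax_iff[of M] unfolding loc_def by blast
  finally have m: "is_model M (Gor l) \<longleftrightarrow> loc \<and> (\<forall>s. sat M s (length_ax l)) \<and>
      (\<forall>s. sat M s gorenstein_ax) \<and> (\<forall>n \<ge> 1. \<forall>s. sat M s (alg_closed_ax n))" .
  have "is_model M (Gor l) \<longleftrightarrow> loc \<and> (\<exists>I. comp_series l I) \<and> principalideal (socle M) M \<and>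
    algebraically_closed (M Quot max_ideal M)"
  proof (cases loc)
    case True
    note m
    moreover have "(\<forall>n \<ge> 1. \<forall>s. sat M s (alg_closed_ax n)) \<longleftrightarrow> algebraically_closed (M Quot max_ideal M)"
      unfolding mx(2)[OF True] alg_closed_iff[OF mx(1)[OF True]] alg_closed_ax_iff[OF st] ..
    moreover have "(\<forall>s. sat M s gorenstein_ax) \<longleftrightarrow> principalideal (socle M) M"
      unfolding gorenstein_ax_iff
        socle_iff[OF maximalideal.axioms(1)[OF mx(1)[OF True]] mx(2)[OF True]] ..
    moreover have "(\<forall>s. sat M s (length_ax l)) \<longleftrightarrow> (\<exists>I. comp_series l I)"
      using length_ax_iff[OF ne, of l] length_iff[OF loc[OF True], of l] by blast
    ultimately show ?thesis by blast
  next
    case False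
    then show ?thesis using m by blast
  qed
  also have "\<dots> \<longleftrightarrow> gor_class l M"
    unfolding gor_class_def gorenstein_ring_def
    using local_iff[folded loc_def] comp_series_length comp_series_artinian length_imp_comp_series
    by blast
  finally show ?thesis using st neg by blast
qed

end

theory Submission
  imports Defs "HOL-Library.Countable_Set" "HOL-Computational_Algebra.Primes"
    "HOL-Algebra.Chinese_Remainder"
begin

text \<open>Let \<open>f : M \<rightarrow> N\<close> be an embedding of models and \<open>a\<^sub>0, \<dots>, a\<^bsub>l-1\<^esub>\<close> generators of a
  composition series of \<open>M\<close>.  Since \<open>M\<close> is Gorenstein, each \<open>a\<^sub>i\<close> is separated from its
  predecessors by an annihilator, which persists in \<open>N\<close>; so the \<open>f a\<^sub>i\<close> generate a
  composition series of \<open>N\<close>, and \<open>N\<close> arises from \<open>M\<close> by enlarging the residue field only.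
  Choose multiplicative representatives of the residue fields, compatible with \<open>f\<close>: the
  Teichmueller representatives (the \<open>p\<^sup>l\<close>-th powers) in residue characteristic \<open>p\<close>, and a
  coefficient field in characteristic \<open>0\<close>.  Then every element has a unique normal form
  \<open>\<Sum> t\<^sub>i a\<^sub>i\<close> with representatives \<open>t\<^sub>i\<close>, and the rewriting of sums and products into normal
  form is so uniform that an isomorphism between sufficiently large perfect subrings of the residue
  fields induces one between the subrings of \<open>M\<close> and \<open>N\<close> with normal forms over them.  After
  passing to ultrapowers, the residue fields are uncountable, and then the isomorphisms between
  countable subrings of algebraically closed fields have the back-and-forth property.\<close>

section \<open>Polynomials over subrings\<close>

text \<open>Neither quotients nor partial maps are formed. All happens in the product ring
  \<open>P = M \<times> N\<close> with two primes \<open>Q1\<close>, \<open>Q2\<close>, the pairs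
  with a nonunit in the first or second place. An isomorphism between residue subrings is a subring
  \<open>S\<close> of \<open>P\<close> that contains \<open>Q1 \<inter> Q2\<close> and on which the
  primes agree; an isomorphism between subrings of \<open>M\<close> and \<open>N\<close> is a
  subring of \<open>P\<close> in which one component vanishes iff the other does. Extending means
  adjoining an element of \<open>P\<close>, and exchanging the primes turns forth into back. The
  obstacle is addition: if \<open>p\<close> is nonzero in the ring, no system of representatives
  that includes zero is closed under it. The error in adding Teichmueller representatives is
  \<open>p\<close> times monomials in their roots, and \<open>p\<close> moves
  \<open>a\<^sub>i\<close> into the span of earlier generators; induction on \<open>i\<close>
  replaces Witt vector arithmetic. The roots must be at hand, hence perfect subrings. "Sufficiently
  large" means containing the representatives in the normal forms of \<open>p a\<^sub>i\<close>,
  \<open>a\<^sub>i a\<^sub>j\<close>, 1 and the parameters. Ultrapowers are taken because a residue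
  field algebraic over its prime field offers no partner to a transcendental element.\<close>

context cring begin

section \<open>Coefficient lists and pseudo-division\<close>

lemma eval_Cons [simp]: "eval (c # p) x = c \<otimes> x [^] length p \<oplus> eval p x"
  by simp

declare eval.simps(2) [simp del]

text \<open>Lists stay unnormalised, possibly with leading zeros, so that the length of a sum is
  known and the head survives when the second summand is shorter. Pseudo-division relies on
  both.\<close>

lemma eval_add_exists:
  assumes "set p \<subseteq> S" "set q \<subseteq> S" "subring S R" "length q \<le> length p"
  shows "\<exists>r. set r \<subseteq> S \<and> length r = length p \<and> (length q < length p \<longrightarrow> hd r = hd p) \<and>
    (\<forall>x \<in> carrier R. eval r x = eval p x \<oplus> eval q x)"
  using assms(1,2,4)
proof (induction p arbitrary: q)
  case (Cons c p)
  interpret S: subring S R by fact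
  have sub: "S \<subseteq> carrier R" by (rule subringE(1)[OF assms(3)])
  show ?case
  proof (cases "length q \<le> length p")
    case True
    then obtain r where r: "set r \<subseteq> S" "length r = length p"
      "\<And>x. x \<in> carrier R \<Longrightarrow> eval r x = eval p x \<oplus> eval q x"
      using Cons.IH[OF _ Cons.prems(2) True] Cons.prems(1) by (auto simp del: eval_Cons)
    have "eval (c # r) x = eval (c # p) x \<oplus> eval q x" if x: "x \<in> carrier R" for x
    proof -
      have "eval p x \<in> carrier R" "eval q x \<in> carrier R" "c \<in> carrier R" "x [^] length p \<in> carrier R"
        using eval_in_carrier[of p x] eval_in_carrier[of q x] Cons.prems sub x by auto
      then show ?thesis using r x by (simp add: a_assoc)
    qed
    then show ?thesis using r Cons.prems by (intro exI[of _ "c # r"]) auto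
  next
    case False
    then obtain d q' where q: "q = d # q'" "length q' = length p"
      using Cons.prems by (cases q) auto
    then obtain r where r: "set r \<subseteq> S" "length r = length p"
      "\<And>x. x \<in> carrier R \<Longrightarrow> eval r x = eval p x \<oplus> eval q' x"
      using Cons.IH[of q'] Cons.prems by auto
    have "eval ((c \<oplus> d) # r) x = eval (c # p) x \<oplus> eval q x" if x: "x \<in> carrier R" for x
    proof -
      have "eval p x \<in> carrier R" "eval q' x \<in> carrier R" "c \<in> carrier R" "d \<in> carrier R"
        "x [^] length p \<in> carrier R"
        using eval_in_carrier[of p x] eval_in_carrier[of q' x] Cons.prems sub x q by auto
      then show ?thesis using r x q by (simp add: l_distr a_ac)
    qed
    then show ?thesis using r Cons.prems q subringE(7)[OF assms(3)]
      by (intro exI[of _ "(c \<oplus> d) # r"]) auto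
  qed
qed auto

lemma eval_append_zeros:
  assumes "set p \<subseteq> carrier R" "x \<in> carrier R"
  shows "eval (p @ replicate n \<zero>) x = eval p x \<otimes> x [^] n"
proof -
  have "eval (replicate n \<zero>) x = \<zero>" using eval_replicate[of "[]" x n] assms(2) by simp
  then show ?thesis using eval_append[of p "replicate n \<zero>" x] assms eval_in_carrier[of p x]
    by (simp add: set_replicate_conv_if)
qed

lemma subring_pow: "subring S R \<Longrightarrow> r \<in> S \<Longrightarrow> r [^] (k :: nat) \<in> S"
  by (induction k) (auto simp: subringE(3,6))

text \<open>The leading coefficient \<open>r\<close> need not be invertible, so each cancellation of
  a leading term costs one factor \<open>r\<close>. The bound on \<open>b\<close> says that the
  remainder has smaller degree than \<open>r # g\<close>. Length and head of the quotient are
  recorded because it must later be compared with a polynomial of least length.\<close>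

lemma pseudo_division:
  assumes S: "subring S R" and g: "set (r # g) \<subseteq> S" and p: "set p \<subseteq> S"
  shows "\<exists>k a b. set a \<subseteq> S \<and> set b \<subseteq> S \<and> length b \<le> length g \<and>
    (\<forall>x \<in> carrier R. r [^] (k :: nat) \<otimes> eval p x = eval a x \<otimes> eval (r # g) x \<oplus> eval b x) \<and>
    length a = length p - length g \<and> (length g < length p \<longrightarrow> (\<exists>j :: nat. hd a = r [^] j \<otimes> hd p))"
  using p
proof (induction "length p" arbitrary: p)
  case 0
  have "eval (r # g) x \<in> carrier R" if "x \<in> carrier R" for x
    using eval_in_carrier[of "r # g" x] g subringE(1)[OF S] that by auto
  then have "r [^] (0::nat) \<otimes> eval p x = eval [] x \<otimes> eval (r # g) x \<oplus> eval [] x"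
    if "x \<in> carrier R" for x
    using 0 that by (simp del: eval_Cons)
  then show ?case using 0 by (intro exI[of _ "0 :: nat"] exI[of _ "[]"]) auto
next
  case (Suc n p)
  have sub: "S \<subseteq> carrier R" by (rule subringE(1)[OF S])
  note cl = subringE(2,3,5,6,7)[OF S]
  have ev: "eval q x \<in> carrier R" if "set q \<subseteq> S" "x \<in> carrier R" for q x
    using eval_in_carrier that sub by blast
  show ?case
  proof (cases "length g < length p")
    case False
    have "r [^] (0::nat) \<otimes> eval p x = eval [] x \<otimes> eval (r # g) x \<oplus> eval p x"
      if x: "x \<in> carrier R" for x
      using ev[OF Suc.prems x] ev[OF g x] by simp
    then show ?thesis using False Suc.prems
      by (intro exI[of _ "0 :: nat"] exI[of _ "[]"] exI[of _ p]) auto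
  next
    case True
    obtain c p' where pc: "p = c # p'" using Suc by (cases p) auto
    define e where "e = length p' - length g"
    have le: "length p' = length g + e" using True pc by (simp add: e_def)
    have c: "c \<in> S" "r \<in> S" "set p' \<subseteq> S" "set g \<subseteq> S" using Suc.prems g pc by auto
    \<comment> \<open>The sum of \<open>?u\<close> and \<open>?v\<close> is
      \<open>r p' - c x^e g\<close>: what is left of \<open>r p\<close> after subtracting
      \<open>c x^e\<close> times the divisor.\<close>
    let ?u = "map ((\<otimes>) r) p'"
    let ?v = "map ((\<otimes>) (\<ominus> c)) g @ replicate e \<zero>"
    have uv: "set ?u \<subseteq> S" "set ?v \<subseteq> S" "length ?v \<le> length ?u" using c cl le by auto
    obtain p1 where p1: "set p1 \<subseteq> S" "length p1 = length p'"
      "\<And>x. x \<in> carrier R \<Longrightarrow> eval p1 x = eval ?u x \<oplus> eval ?v x"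
      using eval_add_exists[OF uv(1,2) S uv(3)] by auto
    obtain k a' b where ab: "set a' \<subseteq> S" "set b \<subseteq> S" "length b \<le> length g"
      "\<And>x. x \<in> carrier R \<Longrightarrow> r [^] (k::nat) \<otimes> eval p1 x = eval a' x \<otimes> eval (r # g) x \<oplus> eval b x"
      "length a' = e"
    proof -
      have "n = length p1" using p1(2) Suc(2) pc by simp
      then show ?thesis using Suc(1)[OF _ p1(1)] that p1(2) e_def by metis
    qed
    \<comment> \<open>The new leading term \<open>r^k c x^e\<close> of the quotient. It has one
      entry more than \<open>a'\<close>, so it determines the head of the sum.\<close>
    let ?w = "(r [^] k \<otimes> c) # replicate e \<zero>"
    have w: "set ?w \<subseteq> S" using c cl subring_pow[OF S] by auto
    obtain a where a: "set a \<subseteq> S" "length a = Suc e" "hd a = r [^] k \<otimes> c"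
      "\<And>x. x \<in> carrier R \<Longrightarrow> eval a x = eval ?w x \<oplus> eval a' x"
      using eval_add_exists[OF w ab(1) S] ab(5) by auto
    have "r [^] Suc k \<otimes> eval p x = eval a x \<otimes> eval (r # g) x \<oplus> eval b x" if x: "x \<in> carrier R" for x
    proof -
      have cc: "c \<in> carrier R" "r \<in> carrier R" "set p' \<subseteq> carrier R" "set g \<subseteq> carrier R" using c sub by auto
      define G P B A' where "G = eval g x" and "P = eval p' x" and "B = eval b x" and "A' = eval a' x"
      define U V where "U = x [^] length g" and "V = x [^] e"
      define K where "K = r [^] k"
      have car: "G \<in> carrier R" "P \<in> carrier R" "B \<in> carrier R" "A' \<in> carrier R"
          "U \<in> carrier R" "V \<in> carrier R" "K \<in> carrier R"
        unfolding G_def P_def B_def A'_def U_def V_def K_def using ev x c ab cc by auto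
      have UV: "x [^] length p' = U \<otimes> V" using x by (simp add: U_def V_def le nat_pow_mult)
      have ep: "eval p x = c \<otimes> (U \<otimes> V) \<oplus> P" using UV by (simp add: pc P_def)
      have eu: "eval ?u x = r \<otimes> P" unfolding P_def by (rule eval_map_mult) (use cc x in auto)
      have ev': "eval ?v x = (\<ominus> c \<otimes> G) \<otimes> V"
      proof -
        have "set (map ((\<otimes>) (\<ominus> c)) g) \<subseteq> carrier R" using cc by auto
        then show ?thesis using eval_append_zeros x eval_map_mult[of g "\<ominus> c" x] cc by (simp add: G_def V_def)
      qed
      have ew: "eval ?w x = K \<otimes> c \<otimes> V"
        using eval_replicate[of "[]" x e] x cc by (simp add: V_def K_def)
      have eg: "eval (r # g) x = r \<otimes> U \<oplus> G" by (simp add: U_def G_def)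
      have e1: "K \<otimes> (r \<otimes> P \<oplus> (\<ominus> c \<otimes> G) \<otimes> V) = A' \<otimes> (r \<otimes> U \<oplus> G) \<oplus> B"
        using ab(4)[OF x] p1(3)[OF x] unfolding eu ev' eg A'_def B_def K_def by simp
      have "r [^] Suc k \<otimes> eval p x = K \<otimes> r \<otimes> (c \<otimes> (U \<otimes> V) \<oplus> P)"
        by (simp add: ep K_def)
      also have "\<dots> = K \<otimes> c \<otimes> V \<otimes> (r \<otimes> U \<oplus> G) \<oplus> K \<otimes> (r \<otimes> P \<oplus> (\<ominus> c \<otimes> G) \<otimes> V)"
        using car cc by algebra
      also have "\<dots> = (K \<otimes> c \<otimes> V \<oplus> A') \<otimes> (r \<otimes> U \<oplus> G) \<oplus> B"
        unfolding e1 using car cc by algebra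
      finally show ?thesis unfolding a(4)[OF x] ew eg A'_def B_def .
    qed
    moreover have "length a = length p - length g" using a(2) le pc by simp
    moreover have "hd a = r [^] k \<otimes> hd p" using a(3) pc by simp
    ultimately show ?thesis using a(1) ab(2,3) by blast
  qed
qed

section \<open>Congruences, and polynomials that vanish modulo a prime\<close>

lemma ideal_diff:
  assumes "ideal Q R" "x \<in> Q" "y \<in> Q"
  shows "x \<ominus> y \<in> Q"
proof -
  interpret Q: ideal Q R by fact
  show ?thesis using assms(2,3) Q.a_closed Q.a_inv_closed by (simp add: minus_eq)
qed

lemma ideal_cancel:
  assumes "ideal Q R" "x = y \<oplus> b" "x \<in> Q" "y \<in> Q" "b \<in> carrier R"
  shows "b \<in> Q"
proof -
  have "y \<in> carrier R" using assms(1,4) ideal.Icarr by metis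
  then have "b = (y \<oplus> b) \<ominus> y" using assms(5) by algebra
  then show ?thesis using ideal_diff[OF assms(1,3,4)] assms(2) by simp
qed

text \<open>A leading coefficient in \<open>Q\<close> does not affect whether the value lies in
  \<open>Q\<close>, so it can be stripped off. Either nothing remains, or a suffix that is a nonzero
  polynomial modulo \<open>Q\<close>.\<close>

lemma eval_ideal_suffix:
  assumes "ideal Q R" "set p \<subseteq> carrier R" "z \<in> carrier R" "eval p z \<in> Q"
  shows "set p \<subseteq> Q \<or> (\<exists>q. q \<noteq> [] \<and> set q \<subseteq> set p \<and> length q \<le> length p \<and> hd q \<notin> Q \<and> eval q z \<in> Q)"
  using assms(2,4)
proof (induction p)
  case (Cons c p)
  interpret Q: ideal Q R by fact
  show ?case
  proof (cases "c \<in> Q")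
    case True
    have cc: "c \<in> carrier R" "z [^] length p \<in> carrier R" "eval p z \<in> carrier R"
      using Cons.prems assms(3) eval_in_carrier by auto
    have "c \<otimes> z [^] length p \<in> Q" using True cc Q.I_r_closed by blast
    then have "eval p z \<in> Q" using ideal_cancel[OF assms(1) eval_Cons Cons.prems(2)] cc(3) by blast
    then show ?thesis using Cons True by fastforce
  next
    case False
    then show ?thesis using Cons.prems by (intro disjI2 exI[of _ "c # p"]) auto
  qed
qed simp

lemma eval_in_ideal:
  assumes "ideal Q R" "set p \<subseteq> Q" "z \<in> carrier R"
  shows "eval p z \<in> Q"
  using assms(2)
proof (induction p)
  case Nil
  interpret Q: ideal Q R by fact
  show ?case by simp
next
  case (Cons c p)
  interpret Q: ideal Q R by fact
  show ?case using Cons assms(3) Q.I_r_closed Q.a_closed by auto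
qed

definition mod_eq :: "'a set \<Rightarrow> 'a \<Rightarrow> 'a \<Rightarrow> bool" where
  "mod_eq Q x y \<longleftrightarrow> x \<ominus> y \<in> Q"

lemma mod_eq_refl: "ideal Q R \<Longrightarrow> x \<in> carrier R \<Longrightarrow> mod_eq Q x x"
  by (simp add: mod_eq_def additive_subgroup.zero_closed ideal.axioms(1) r_neg minus_eq)

lemma mod_eq_sym:
  assumes "ideal Q R" "mod_eq Q x y" "x \<in> carrier R" "y \<in> carrier R"
  shows "mod_eq Q y x"
proof -
  interpret Q: ideal Q R by fact
  have "y \<ominus> x = \<ominus> (x \<ominus> y)" using assms(3,4) by algebra
  then show ?thesis using Q.a_inv_closed assms(2) by (simp add: mod_eq_def)
qed

lemma mod_eq_trans:
  assumes "ideal Q R" "mod_eq Q x y" "mod_eq Q y z" "x \<in> carrier R" "y \<in> carrier R" "z \<in> carrier R"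
  shows "mod_eq Q x z"
proof -
  interpret Q: ideal Q R by fact
  have "x \<ominus> z = (x \<ominus> y) \<oplus> (y \<ominus> z)" using assms(4-6) by algebra
  then show ?thesis using Q.a_closed assms(2,3) by (simp add: mod_eq_def)
qed

lemma mod_eq_add:
  assumes "ideal Q R" "mod_eq Q x y" "mod_eq Q x' y'"
    "x \<in> carrier R" "y \<in> carrier R" "x' \<in> carrier R" "y' \<in> carrier R"
  shows "mod_eq Q (x \<oplus> x') (y \<oplus> y')"
proof -
  interpret Q: ideal Q R by fact
  have "(x \<oplus> x') \<ominus> (y \<oplus> y') = (x \<ominus> y) \<oplus> (x' \<ominus> y')" using assms(4-7) by algebra
  then show ?thesis using Q.a_closed assms(2,3) by (simp add: mod_eq_def)
qed

lemma mod_eq_mult: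
  assumes "ideal Q R" "mod_eq Q x y" "mod_eq Q x' y'"
    "x \<in> carrier R" "y \<in> carrier R" "x' \<in> carrier R" "y' \<in> carrier R"
  shows "mod_eq Q (x \<otimes> x') (y \<otimes> y')"
proof -
  interpret Q: ideal Q R by fact
  have "(x \<otimes> x') \<ominus> (y \<otimes> y') = (x \<ominus> y) \<otimes> x' \<oplus> y \<otimes> (x' \<ominus> y')" using assms(4-7) by algebra
  then show ?thesis using Q.a_closed assms(2-7) Q.I_l_closed Q.I_r_closed by (simp add: mod_eq_def)
qed

lemma mod_eq_minus:
  assumes "ideal Q R" "mod_eq Q x y" "x \<in> carrier R" "y \<in> carrier R"
  shows "mod_eq Q (\<ominus> x) (\<ominus> y)"
proof -
  interpret Q: ideal Q R by fact
  have "(\<ominus> x) \<ominus> (\<ominus> y) = \<ominus> (x \<ominus> y)" using assms(3-4) by algebra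
  then show ?thesis using Q.a_inv_closed assms(2) by (simp add: mod_eq_def)
qed

lemma mod_eq_pow:
  assumes "ideal Q R" "mod_eq Q x y" "x \<in> carrier R" "y \<in> carrier R"
  shows "mod_eq Q (x [^] (n :: nat)) (y [^] n)"
  by (induction n) (use assms mod_eq_refl mod_eq_mult in auto)

lemma mod_eq_mem:
  assumes "ideal Q R" "mod_eq Q x y" "x \<in> carrier R" "y \<in> carrier R"
  shows "x \<in> Q \<longleftrightarrow> y \<in> Q"
proof -
  interpret Q: ideal Q R by fact
  have "x = (x \<ominus> y) \<oplus> y" "y = x \<ominus> (x \<ominus> y)" using assms(3,4) by algebra+
  then show ?thesis using Q.a_closed Q.a_inv_closed assms(2) minus_eq mod_eq_def by metis
qed

lemma mod_eq_eval:
  assumes "ideal Q R" "list_all2 (mod_eq Q) p q" "set p \<subseteq> carrier R" "set q \<subseteq> carrier R"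
    "mod_eq Q x y" "x \<in> carrier R" "y \<in> carrier R"
  shows "mod_eq Q (eval p x) (eval q y)"
  using assms(2-4)
proof (induction rule: list_all2_induct)
  case Nil
  show ?case using mod_eq_refl[OF assms(1)] by simp
next
  case (Cons c p d q)
  have "length p = length q" using Cons(2) by (rule list_all2_lengthD)
  moreover have "mod_eq Q (c \<otimes> x [^] length p \<oplus> eval p x) (d \<otimes> y [^] length p \<oplus> eval q y)"
    using Cons assms(5-7) eval_in_carrier
    by (intro mod_eq_add[OF assms(1)] mod_eq_mult[OF assms(1)] mod_eq_pow[OF assms(1)]) auto
  ultimately show ?case by simp
qed

lemma prime_pow:
  assumes "primeideal Q R" "x \<in> carrier R" "x [^] (n :: nat) \<in> Q"
  shows "x \<in> Q"
proof -
  interpret Q: primeideal Q R by fact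
  show ?thesis using assms(3)
  proof (induction n)
    case 0
    then show ?case using Q.one_imp_carrier Q.I_notcarr by simp
  next
    case (Suc n)
    then show ?case using Q.I_prime[of "x [^] n" x] assms(2) by auto
  qed
qed

text \<open>Here \<open>p\<close> acts as a minimal polynomial of \<open>z\<close> over
  \<open>S\<close> modulo \<open>Q1\<close>. The remainder of \<open>q\<close> on division by
  \<open>p\<close> is too short to vanish at \<open>z\<close> modulo \<open>Q1\<close> unless all
  its coefficients lie in \<open>Q1\<close>, hence in \<open>Q2\<close>. As \<open>r\<close> lies
  outside the prime \<open>Q2\<close>, the factor \<open>r^k\<close> can be cancelled.\<close>

lemma eval_transfer:
  assumes Q1: "primeideal Q1 R" and Q2: "primeideal Q2 R" and S: "subring S R"
    and eq: "\<And>s. s \<in> S \<Longrightarrow> s \<in> Q1 \<longleftrightarrow> s \<in> Q2" and z: "z \<in> carrier R"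
    and p: "set p \<subseteq> S" "p \<noteq> []" "hd p \<notin> Q1" "eval p z \<in> Q1" "eval p z \<in> Q2"
    and min: "\<And>q. set q \<subseteq> S \<Longrightarrow> q \<noteq> [] \<Longrightarrow> hd q \<notin> Q1 \<Longrightarrow> eval q z \<in> Q1 \<Longrightarrow> length p \<le> length q"
    and q: "set q \<subseteq> S" "eval q z \<in> Q1"
  shows "eval q z \<in> Q2"
proof -
  interpret Q1: primeideal Q1 R by fact
  interpret Q2: primeideal Q2 R by fact
  have sub: "S \<subseteq> carrier R" by (rule subringE(1)[OF S])
  have ev: "eval q z \<in> carrier R" if "set q \<subseteq> S" for q
    using eval_in_carrier that sub z by blast
  obtain r g where pr: "p = r # g" using p(2) by (cases p) auto
  obtain k a b where ab: "set a \<subseteq> S" "set b \<subseteq> S" "length b \<le> length g"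
    "r [^] (k::nat) \<otimes> eval q z = eval a z \<otimes> eval p z \<oplus> eval b z"
    using pseudo_division[OF S _ q(1), of r g] p(1) z unfolding pr by blast
  have r: "r \<in> carrier R" "r \<in> S" using p(1) pr sub by auto
  have "r [^] k \<otimes> eval q z \<in> Q1" "eval a z \<otimes> eval p z \<in> Q1"
    using Q1.I_l_closed q(2) p(4) r ev[OF ab(1)] by auto
  then have "eval b z \<in> Q1" using ideal_cancel[OF Q1.is_ideal ab(4)] ev[OF ab(2)] by blast
  then have "set b \<subseteq> Q1 \<or> (\<exists>q. q \<noteq> [] \<and> set q \<subseteq> set b \<and> length q \<le> length b \<and> hd q \<notin> Q1 \<and> eval q z \<in> Q1)"
    using eval_ideal_suffix[OF Q1.is_ideal _ z, of b] ab(2) sub by blast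
  moreover have False if "q' \<noteq> []" "set q' \<subseteq> set b" "length q' \<le> length b" "hd q' \<notin> Q1" "eval q' z \<in> Q1" for q'
    using min[of q'] that ab(2,3) pr by auto
  ultimately have "set b \<subseteq> Q1" by blast
  then have "set b \<subseteq> Q2" using eq ab(2) by auto
  then have "eval b z \<in> Q2" using eval_in_ideal[OF Q2.is_ideal] z by blast
  moreover have "eval a z \<otimes> eval p z \<in> Q2" using Q2.I_l_closed p(5) ev[OF ab(1)] by auto
  ultimately have "r [^] k \<otimes> eval q z \<in> Q2" unfolding ab(4) using Q2.a_closed by blast
  then have "r [^] k \<in> Q2 \<or> eval q z \<in> Q2" using Q2.I_prime ev[OF q(1)] r by auto
  moreover have "r \<notin> Q2" using p(3) eq[OF r(2)] pr by simp
  ultimately show ?thesis using prime_pow[OF Q2 r(1)] by blast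
qed

text \<open>A polynomial of least degree for \<open>z\<close> modulo \<open>Q1\<close> is also one modulo \<open>Q2\<close>: otherwise
  pseudo-division by one of smaller degree would split it modulo \<open>Q1\<close>.\<close>

lemma eval_transfer_iff:
  assumes Q1: "primeideal Q1 R" and Q2: "primeideal Q2 R" and S: "subring S R"
    and eq: "\<And>s. s \<in> S \<Longrightarrow> s \<in> Q1 \<longleftrightarrow> s \<in> Q2" and z: "z \<in> carrier R"
    and p: "set p \<subseteq> S" "p \<noteq> []" "hd p \<notin> Q1" "eval p z \<in> Q1" "eval p z \<in> Q2"
    and min: "\<And>q. set q \<subseteq> S \<Longrightarrow> q \<noteq> [] \<Longrightarrow> hd q \<notin> Q1 \<Longrightarrow> eval q z \<in> Q1 \<Longrightarrow> length p \<le> length q"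
    and q: "set q \<subseteq> S"
  shows "eval q z \<in> Q1 \<longleftrightarrow> eval q z \<in> Q2"
proof
  show "eval q z \<in> Q1 \<Longrightarrow> eval q z \<in> Q2" using eval_transfer[OF Q1 Q2 S eq z p min q] by blast
  interpret Q1: primeideal Q1 R by fact
  interpret Q2: primeideal Q2 R by fact
  have sub: "S \<subseteq> carrier R" by (rule subringE(1)[OF S])
  have ev: "eval q z \<in> carrier R" if "set q \<subseteq> S" for q
    using eval_in_carrier that sub z by blast
  have hdS: "hd q \<in> S" if "q \<noteq> []" "set q \<subseteq> S" for q using that by (cases q) auto
  let ?P = "\<lambda>g. set g \<subseteq> S \<and> g \<noteq> [] \<and> hd g \<notin> Q2 \<and> eval g z \<in> Q2"
  have "?P p" using p eq[OF hdS] by blast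
  then obtain g where g: "?P g" "\<And>g'. ?P g' \<Longrightarrow> length g \<le> length g'"
    using ex_has_least_nat[of ?P p length] by blast
  have "\<not> length g < length p"
  proof
    assume lt: "length g < length p"
    obtain r g' where gr: "g = r # g'" using g(1) by (cases g) auto
    have r: "r \<in> S" "r \<notin> Q2" using g(1) gr by auto
    then have r1: "r \<notin> Q1" "r \<in> carrier R" using eq sub by auto
    have "g' \<noteq> []"
    proof
      assume "g' = []"
      then have "eval g z = r" using r1(2) gr z by simp
      then show False using g(1) r by simp
    qed
    obtain k a b j where ab: "set a \<subseteq> S" "set b \<subseteq> S" "length b \<le> length g'"
      "r [^] (k::nat) \<otimes> eval p z = eval a z \<otimes> eval g z \<oplus> eval b z"
      "length a = length p - length g'" "hd a = r [^] (j::nat) \<otimes> hd p"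
      using pseudo_division[OF S _ p(1), of r g'] g(1) z lt unfolding gr by fastforce
    have "r [^] k \<otimes> eval p z \<in> Q2" "eval a z \<otimes> eval g z \<in> Q2"
      using Q2.I_l_closed g(1) p(5) r1 ev[OF ab(1)] by auto
    then have "eval b z \<in> Q2" using ideal_cancel[OF Q2.is_ideal ab(4)] ev[OF ab(2)] by blast
    then have "set b \<subseteq> Q2 \<or> (\<exists>q. q \<noteq> [] \<and> set q \<subseteq> set b \<and> length q \<le> length b \<and> hd q \<notin> Q2 \<and> eval q z \<in> Q2)"
      using eval_ideal_suffix[OF Q2.is_ideal _ z, of b] ab(2) sub by blast
    moreover have False if "q' \<noteq> []" "set q' \<subseteq> set b" "length q' \<le> length b" "hd q' \<notin> Q2" "eval q' z \<in> Q2" for q'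
      using g(2)[of q'] that ab(2,3) gr by auto
    ultimately have "set b \<subseteq> Q2" by blast
    then have "set b \<subseteq> Q1" using eq ab(2) by auto
    then have b1: "eval b z \<in> Q1" using eval_in_ideal[OF Q1.is_ideal] z by blast
    have ag: "eval a z \<otimes> eval g z \<in> carrier R" using ev ab(1) g(1) by blast
    have "r [^] k \<otimes> eval p z \<in> Q1" using Q1.I_l_closed p(4) r1 by auto
    then have "eval a z \<otimes> eval g z \<in> Q1"
      using ideal_cancel[OF Q1.is_ideal _ _ b1 ag] ab(4) a_comm[OF ag ev[OF ab(2)]] by metis
    then have "eval a z \<in> Q1 \<or> eval g z \<in> Q1" using Q1.I_prime ev ab(1) g(1) by auto
    moreover have "eval g z \<notin> Q1" using min[of g] g(1) lt eq[OF hdS] by fastforce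
    \<comment> \<open>The quotient is shorter than \<open>p\<close> since \<open>g'\<close> is
      nonempty, and nonempty since \<open>g\<close> is shorter than \<open>p\<close>; its head, a
      power of \<open>r\<close> times \<open>hd p\<close>, is outside \<open>Q1\<close>. So the
      minimality of \<open>p\<close> applies to it.\<close>
    moreover have "eval a z \<notin> Q1"
    proof
      assume *: "eval a z \<in> Q1"
      have "hd p \<in> carrier R" using hdS p sub by auto
      then have "hd a \<notin> Q1" unfolding ab(6)
        using Q1.I_prime[of "r [^] j" "hd p"] r1 p(3) prime_pow[OF Q1 r1(2)] by auto
      moreover have "a \<noteq> []" "length a < length p" using ab(5) lt gr \<open>g' \<noteq> []\<close> by (cases g'; auto)+
      ultimately show False using min[of a] ab(1) * by simp
    qed
    ultimately show False by blast
  qed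
  then have "length p \<le> length g" by simp
  then have min2: "length p \<le> length g'" if "set g' \<subseteq> S" "g' \<noteq> []" "hd g' \<notin> Q2" "eval g' z \<in> Q2" for g'
    using g(2)[of g'] that by simp
  have "hd p \<notin> Q2" using p eq[OF hdS] by blast
  then show "eval q z \<in> Q2 \<Longrightarrow> eval q z \<in> Q1"
    using eval_transfer[OF Q2 Q1 S _ z p(1,2) _ p(5,4) min2 q] eq by blast
qed

text \<open>A root \<open>y0\<close> splits off the monic factor \<open>x - y0\<close>. As
  \<open>Q\<close> is prime, any root is congruent to \<open>y0\<close> or is a root of the
  quotient, which has the same head and is shorter.\<close>

lemma finite_roots:
  assumes Q: "primeideal Q R" and p: "set p \<subseteq> carrier R" "p \<noteq> []" "hd p \<notin> Q"
  shows "\<exists>F. finite F \<and> F \<subseteq> carrier R \<and> (\<forall>y \<in> carrier R. eval p y \<in> Q \<longrightarrow> (\<exists>c \<in> F. mod_eq Q y c))"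
  using p
proof (induction "length p" arbitrary: p)
  case 0
  from 0(1,3) show ?case by simp
next
  case (Suc n p)
  interpret Q: primeideal Q R by fact
  show ?case
  proof (cases "\<exists>y \<in> carrier R. eval p y \<in> Q")
    case False
    then show ?thesis by (intro exI[of _ "{}"]) auto
  next
    case True
    then obtain y0 where y0: "y0 \<in> carrier R" "eval p y0 \<in> Q" by blast
    obtain c p' where pc: "p = c # p'" using Suc by (cases p) auto
    have "p' \<noteq> []"
    proof
      assume "p' = []"
      then have "eval p y0 = c" using pc Suc.prems y0 by simp
      then show False using y0 Suc.prems pc by simp
    qed
    have "set [\<one>, \<ominus> y0] \<subseteq> carrier R" using y0 by simp
    then obtain k a b where ab: "set a \<subseteq> carrier R" "set b \<subseteq> carrier R" "length b \<le> 1"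
      "\<And>x. x \<in> carrier R \<Longrightarrow> \<one> [^] (k::nat) \<otimes> eval p x = eval a x \<otimes> eval [\<one>, \<ominus> y0] x \<oplus> eval b x"
      "length a = length p - 1" "1 < length p \<longrightarrow> (\<exists>j :: nat. hd a = \<one> [^] j \<otimes> hd p)"
      using pseudo_division[OF carrier_is_subring _ Suc.prems(1), of \<one> "[\<ominus> y0]"]
      unfolding list.size(3,4) add_0 One_nat_def[symmetric] by (smt (verit, ccfv_threshold) add.commute)
    have "1 < length p" using pc \<open>p' \<noteq> []\<close> by (cases p') auto
    then obtain j :: nat where "hd a = \<one> [^] j \<otimes> hd p" using ab(6) by blast
    moreover have "hd p \<in> carrier R" using Suc.prems pc by simp
    ultimately have hda: "hd a = hd p" by simp
    have ev: "eval q x \<in> carrier R" if "set q \<subseteq> carrier R" "x \<in> carrier R" for q x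
      using eval_in_carrier that by blast
    obtain b0 where b0: "b0 \<in> carrier R" "\<And>x. x \<in> carrier R \<Longrightarrow> eval b x = b0"
    proof (cases b)
      case Nil
      then show ?thesis using that[of \<zero>] by simp
    next
      case (Cons d b')
      then show ?thesis using that[of d] ab(2,3) by simp
    qed
    have e: "eval p x = eval a x \<otimes> (x \<ominus> y0) \<oplus> b0" if "x \<in> carrier R" for x
      using ab(4)[OF that] b0(2)[OF that] that y0(1) ev[OF Suc.prems(1) that] ev[OF ab(1) that]
      by (simp add: minus_eq)
    have "b0 \<in> Q" using e[OF y0(1)] y0 ev[OF ab(1) y0(1)] b0(1) by (simp add: minus_eq r_neg)
    have "a \<noteq> []" using ab(5) pc \<open>p' \<noteq> []\<close> by auto
    moreover have "n = length a" using ab(5) Suc(2) by simp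
    moreover have "hd a \<notin> Q" using hda Suc.prems by simp
    ultimately obtain F where F: "finite F" "F \<subseteq> carrier R"
      "\<And>y. y \<in> carrier R \<Longrightarrow> eval a y \<in> Q \<Longrightarrow> \<exists>c \<in> F. mod_eq Q y c"
      using Suc(1)[OF _ ab(1)] by blast
    have "\<exists>c \<in> insert y0 F. mod_eq Q y c" if y: "y \<in> carrier R" "eval p y \<in> Q" for y
    proof -
      have ay: "eval a y \<otimes> (y \<ominus> y0) \<in> carrier R" using ev[OF ab(1) y(1)] y0 y by auto
      then have "eval a y \<otimes> (y \<ominus> y0) \<in> Q"
        using ideal_cancel[OF Q.is_ideal _ y(2) \<open>b0 \<in> Q\<close> ay] e[OF y(1)] a_comm[OF ay b0(1)] by metis
      then have "eval a y \<in> Q \<or> y \<ominus> y0 \<in> Q" using Q.I_prime ev[OF ab(1) y(1)] y0 y by auto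
      then show ?thesis using F(3) y by (auto simp: mod_eq_def)
    qed
    then show ?thesis using F y0 by (intro exI[of _ "insert y0 F"]) auto
  qed
qed

end

section \<open>Extending isomorphisms of residue rings\<close>

context cring begin

section \<open>Adjoining an element, and countability modulo an ideal\<close>

definition adjoin :: "'a set \<Rightarrow> 'a \<Rightarrow> 'a set" where
  "adjoin S z = {eval p z | p. set p \<subseteq> S}"

lemma adjoin_props:
  assumes S: "subring S R" and z: "z \<in> carrier R"
  shows "subring (adjoin S z) R" "S \<subseteq> adjoin S z" "z \<in> adjoin S z"
proof -
  note cl = subringE(2,3,5,6,7)[OF S]
  have sub: "S \<subseteq> carrier R" by (rule subringE(1)[OF S])
  have ev: "eval p z \<in> carrier R" if "set p \<subseteq> S" for p
    using eval_in_carrier[of p z] that sub z by blast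
  have c: "x \<in> carrier R" if "x \<in> adjoin S z" for x using that ev by (auto simp: adjoin_def)
  have add: "x \<oplus> y \<in> adjoin S z" if "x \<in> adjoin S z" "y \<in> adjoin S z" for x y
  proof -
    have *: "eval p z \<oplus> eval q z \<in> adjoin S z" if pq: "set p \<subseteq> S" "set q \<subseteq> S" "length q \<le> length p" for p q
    proof -
      obtain r where "set r \<subseteq> S" "eval r z = eval p z \<oplus> eval q z"
        using eval_add_exists[OF pq(1,2) S pq(3)] z by blast
      then show ?thesis unfolding adjoin_def by (metis (mono_tags, lifting) mem_Collect_eq)
    qed
    obtain p q where pq: "set p \<subseteq> S" "set q \<subseteq> S" "x = eval p z" "y = eval q z"
      using \<open>x \<in> adjoin S z\<close> \<open>y \<in> adjoin S z\<close> unfolding adjoin_def by blast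
    show ?thesis
    proof (cases "length q \<le> length p")
      case True
      then show ?thesis using * pq by blast
    next
      case False
      then have "eval q z \<oplus> eval p z \<in> adjoin S z" using *[of q p] pq by simp
      then show ?thesis using pq a_comm[OF ev ev] by metis
    qed
  qed
  have smult: "s \<otimes> x \<in> adjoin S z" if "s \<in> S" "x \<in> adjoin S z" for s x
  proof -
    obtain p where p: "set p \<subseteq> S" "x = eval p z"
      using \<open>x \<in> adjoin S z\<close> unfolding adjoin_def by blast
    have "eval (map ((\<otimes>) s) p) z = s \<otimes> eval p z"
      by (rule eval_map_mult) (use p that sub z in auto)
    moreover have "set (map ((\<otimes>) s) p) \<subseteq> S" using p that cl by auto
    ultimately show ?thesis using p(2) unfolding adjoin_def by (metis (mono_tags, lifting) mem_Collect_eq)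
  qed
  have zmult: "z \<otimes> x \<in> adjoin S z" if "x \<in> adjoin S z" for x
  proof -
    obtain p where p: "set p \<subseteq> S" "x = eval p z"
      using \<open>x \<in> adjoin S z\<close> unfolding adjoin_def by blast
    have "set p \<subseteq> carrier R" using p sub by blast
    then have "eval (p @ [\<zero>]) z = eval p z \<otimes> z \<oplus> \<zero>" by (rule eval_append_aux[OF _ _ z]) simp
    then have "eval (p @ [\<zero>]) z = z \<otimes> x" using p ev[OF p(1)] z m_comm by simp
    moreover have "set (p @ [\<zero>]) \<subseteq> S" using p cl by auto
    ultimately show ?thesis unfolding adjoin_def by (metis (mono_tags, lifting) mem_Collect_eq)
  qed
  have zpmult: "z [^] (n::nat) \<otimes> x \<in> adjoin S z" if "x \<in> adjoin S z" for x n
  proof (induction n)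
    case 0
    then show ?case using that c by simp
  next
    case (Suc n)
    have "z [^] Suc n \<otimes> x = z \<otimes> (z [^] n \<otimes> x)"
      using z c[OF that] nat_pow_closed[OF z, of n] by (simp add: m_ac)
    then show ?case using zmult[OF Suc] by simp
  qed
  have zero: "\<zero> \<in> adjoin S z" unfolding adjoin_def using eval.simps(1) by (auto intro!: exI[of _ "[]"])
  have mult: "x \<otimes> y \<in> adjoin S z" if "x \<in> adjoin S z" "y \<in> adjoin S z" for x y
  proof -
    obtain p where p: "set p \<subseteq> S" "x = eval p z"
      using \<open>x \<in> adjoin S z\<close> unfolding adjoin_def by blast
    have "eval p z \<otimes> y \<in> adjoin S z" using p(1)
    proof (induction p)
      case Nil
      then show ?case using zero c[OF that(2)] by simp
    next
      case (Cons a p)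
      then have aS: "a \<in> S" "set p \<subseteq> S" by auto
      have "a \<in> carrier R" "eval p z \<in> carrier R" "z [^] length p \<in> carrier R" "y \<in> carrier R"
        using aS sub ev z c[OF that(2)] by auto
      then have "eval (a # p) z \<otimes> y = a \<otimes> (z [^] length p \<otimes> y) \<oplus> eval p z \<otimes> y"
        unfolding eval_Cons by algebra
      then show ?case using add[OF smult[OF aS(1) zpmult[OF that(2)]] Cons.IH[OF aS(2)]] by simp
    qed
    then show ?thesis using p by simp
  qed
  show SA: "S \<subseteq> adjoin S z"
  proof
    fix s assume "s \<in> S"
    moreover then have "eval [s] z = s" using sub z by auto
    ultimately show "s \<in> adjoin S z" unfolding adjoin_def by (intro CollectI exI[of _ "[s]"]) auto
  qed
  show "z \<in> adjoin S z" using zmult[of \<one>] SA cl z by auto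
  show "subring (adjoin S z) R"
  proof (rule subringI)
    show "adjoin S z \<subseteq> carrier R" using c by blast
    show "\<one> \<in> adjoin S z" using SA cl by blast
    show "x \<oplus> y \<in> adjoin S z" "x \<otimes> y \<in> adjoin S z" if "x \<in> adjoin S z" "y \<in> adjoin S z" for x y
      using add mult that by auto
    show "\<ominus> x \<in> adjoin S z" if "x \<in> adjoin S z" for x
    proof -
      have "\<ominus> \<one> \<in> S" using cl by blast
      then have "\<ominus> \<one> \<otimes> x \<in> adjoin S z" using smult that by blast
      then show ?thesis using c[OF that] by (simp add: l_minus)
    qed
  qed
qed

text \<open>Countability of the image of \<open>S\<close> in the quotient by \<open>Q\<close>. The
  representatives may lie outside \<open>S\<close>.\<close>

definition countable_mod :: "'a set \<Rightarrow> 'a set \<Rightarrow> bool" where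
  "countable_mod Q S \<longleftrightarrow> (\<exists>C. countable C \<and> C \<subseteq> carrier R \<and> (\<forall>s \<in> S. \<exists>c \<in> C. mod_eq Q s c))"

text \<open>Since \<open>S\<close> contains \<open>Q\<close>, it is a union of residue classes:
  whatever is congruent to an element of \<open>S\<close> lies in \<open>S\<close>.\<close>

lemma countable_mod_within:
  assumes "ideal Q R" "subring S R" "Q \<subseteq> S" "countable_mod Q S"
  obtains C where "countable C" "C \<subseteq> S" "\<And>s. s \<in> S \<Longrightarrow> \<exists>c \<in> C. mod_eq Q s c"
proof -
  note cl = subringE[OF assms(2)]
  obtain C where C: "countable C" "C \<subseteq> carrier R" "\<And>s. s \<in> S \<Longrightarrow> \<exists>c \<in> C. mod_eq Q s c"
    using assms(4) by (auto simp: countable_mod_def)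
  have in_S: "c \<in> S" if "s \<in> S" "c \<in> C" "mod_eq Q s c" for s c
  proof -
    have sc: "s \<in> carrier R" "c \<in> carrier R" using that C(2) cl(1) by auto
    have "c = s \<ominus> (s \<ominus> c)" using sc by algebra
    moreover have "s \<ominus> c \<in> S" using that(3) assms(3) by (auto simp: mod_eq_def)
    ultimately show ?thesis using cl(5,7) that(1) minus_eq by metis
  qed
  show ?thesis
  proof (rule that[of "C \<inter> S"])
    show "\<exists>c \<in> C \<inter> S. mod_eq Q s c" if "s \<in> S" for s using C(3)[OF that] in_S[OF that] by blast
  qed (use C in auto)
qed

text \<open>For the ideals \<open>Q1\<close> and \<open>Q2\<close> of elements of \<open>M \<times> N\<close> whose first or second component
  is a nonunit, \<open>S\<close> is the preimage of the graph of an isomorphism between countable subrings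
  of the two residue fields.\<close>

definition residue_graph :: "'a set \<Rightarrow> 'a set \<Rightarrow> 'a set \<Rightarrow> bool" where
  "residue_graph Q1 Q2 S \<longleftrightarrow> subring S R \<and> Q1 \<inter> Q2 \<subseteq> S \<and> (\<forall>s \<in> S. s \<in> Q1 \<longleftrightarrow> s \<in> Q2) \<and>
     countable_mod (Q1 \<inter> Q2) S"

section \<open>Closure under roots of order p\<close>

text \<open>Closure under \<open>p\<close>-th roots makes the subrings of the residue fields
  perfect. The choice \<open>p = 1\<close> serves residue characteristic 0.\<close>

definition perfect_graph :: "'a set \<Rightarrow> 'a set \<Rightarrow> nat \<Rightarrow> 'a set \<Rightarrow> bool" where
  "perfect_graph Q1 Q2 p S \<longleftrightarrow> residue_graph Q1 Q2 S \<and> (\<forall>x \<in> carrier R. x [^] p \<in> S \<longrightarrow> x \<in> S)"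

definition perfect_closure :: "nat \<Rightarrow> 'a set \<Rightarrow> 'a set" where
  "perfect_closure p S = {x \<in> carrier R. \<exists>n. x [^] (p ^ n) \<in> S}"

definition frobenius_additive :: "'a set \<Rightarrow> nat \<Rightarrow> bool" where
  "frobenius_additive Q p \<longleftrightarrow>
     (\<forall>x \<in> carrier R. \<forall>y \<in> carrier R. mod_eq Q ((x \<oplus> y) [^] p) (x [^] p \<oplus> y [^] p))"

lemma frobenius_additive_power:
  assumes Q: "ideal Q R" and F: "frobenius_additive Q p" and x: "x \<in> carrier R" and y: "y \<in> carrier R"
  shows "mod_eq Q ((x \<oplus> y) [^] (p ^ n)) (x [^] (p ^ n) \<oplus> y [^] (p ^ n))"
proof (induction n)
  case 0
  then show ?case using mod_eq_refl[OF Q] x y by simp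
next
  case (Suc n)
  have e: "w [^] (p ^ Suc n) = (w [^] (p ^ n)) [^] p" if "w \<in> carrier R" for w
    using that by (simp add: nat_pow_pow mult.commute)
  have "mod_eq Q (((x \<oplus> y) [^] (p ^ n)) [^] p) ((x [^] (p ^ n) \<oplus> y [^] (p ^ n)) [^] p)"
    using Suc x y by (intro mod_eq_pow[OF Q]) auto
  moreover have "mod_eq Q ((x [^] (p ^ n) \<oplus> y [^] (p ^ n)) [^] p) ((x [^] (p ^ n)) [^] p \<oplus> (y [^] (p ^ n)) [^] p)"
    using F x y by (auto simp: frobenius_additive_def)
  ultimately have "mod_eq Q (((x \<oplus> y) [^] (p ^ n)) [^] p) ((x [^] (p ^ n)) [^] p \<oplus> (y [^] (p ^ n)) [^] p)"
    by (rule mod_eq_trans[OF Q]) (use x y in auto)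
  then show ?case using x y by (simp only: e a_closed)
qed

text \<open>Modulo \<open>Q1 \<inter> Q2\<close>, raising to the power \<open>p^n\<close> is
  additive, and it is injective because both ideals are prime. Additivity gives closure under sums,
  primality carries the agreement of \<open>Q1\<close> and \<open>Q2\<close> from powers to roots,
  and injectivity keeps the closure countable modulo \<open>Q1 \<inter> Q2\<close>.\<close>

lemma perfect_graph_perfect_closure:
  assumes Q1: "primeideal Q1 R" and Q2: "primeideal Q2 R" and p: "p \<ge> 1"
    and F: "frobenius_additive (Q1 \<inter> Q2) p" and S: "residue_graph Q1 Q2 S"
  shows "perfect_graph Q1 Q2 p (perfect_closure p S)" "S \<subseteq> perfect_closure p S"
proof -
  interpret Q1: primeideal Q1 R by fact
  interpret Q2: primeideal Q2 R by fact
  let ?J = "Q1 \<inter> Q2" and ?P = "perfect_closure p S"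
  have J: "ideal ?J R" by (rule i_intersect[OF Q1.is_ideal Q2.is_ideal])
  have S': "subring S R" "?J \<subseteq> S" "\<And>s. s \<in> S \<Longrightarrow> s \<in> Q1 \<longleftrightarrow> s \<in> Q2" "countable_mod ?J S"
    using S by (auto simp: residue_graph_def)
  note cl = subringE[OF S'(1)]
  have sat: "x \<in> S" if "mod_eq ?J x y" "y \<in> S" "x \<in> carrier R" for x y
  proof -
    have "x \<ominus> y \<in> S" using that S'(2) by (auto simp: mod_eq_def)
    moreover have "x = (x \<ominus> y) \<oplus> y" using that cl(1) by (auto simp: minus_eq a_assoc l_neg subset_iff)
    ultimately show ?thesis using cl(7) that(2) by metis
  qed
  have up: "x [^] (p ^ (n + m)) \<in> S" if "x [^] (p ^ n) \<in> S" "x \<in> carrier R" for x n m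
  proof -
    have "x [^] (p ^ (n + m)) = (x [^] (p ^ n)) [^] (p ^ m)"
      using that by (simp add: nat_pow_pow power_add)
    then show ?thesis using subring_pow[OF S'(1) that(1)] by simp
  qed
  show SP: "S \<subseteq> ?P"
  proof
    fix s assume "s \<in> S"
    then show "s \<in> ?P" using cl(1) by (auto simp: perfect_closure_def intro!: exI[of _ 0])
  qed
  have mult: "x \<otimes> y \<in> ?P" if xy: "x \<in> ?P" "y \<in> ?P" for x y
  proof -
    obtain n m where nm: "x [^] (p ^ n) \<in> S" "y [^] (p ^ m) \<in> S" "x \<in> carrier R" "y \<in> carrier R"
      using xy by (auto simp: perfect_closure_def)
    have "x [^] (p ^ (n + m)) \<otimes> y [^] (p ^ (n + m)) \<in> S"
      using up[OF nm(1,3)] up[OF nm(2,4), of n] cl(6) by (simp add: add.commute)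
    then have "(x \<otimes> y) [^] (p ^ (n + m)) \<in> S" using nm nat_pow_distrib by simp
    then show ?thesis using nm unfolding perfect_closure_def by blast
  qed
  have sub: "subring ?P R"
  proof (rule subringI)
    show "?P \<subseteq> carrier R" by (auto simp: perfect_closure_def)
    show "\<one> \<in> ?P" using SP cl(3) by blast
    show "x \<otimes> y \<in> ?P" if xy: "x \<in> ?P" "y \<in> ?P" for x y using mult that .
    show "\<ominus> x \<in> ?P" if "x \<in> ?P" for x
    proof -
      have "\<ominus> \<one> \<in> ?P" using SP cl(3,5) by blast
      then have "\<ominus> \<one> \<otimes> x \<in> ?P" using mult that by blast
      then show ?thesis using that by (simp add: l_minus perfect_closure_def)
    qed
    show "x \<oplus> y \<in> ?P" if xy: "x \<in> ?P" "y \<in> ?P" for x y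
    proof -
      obtain n m where nm: "x [^] (p ^ n) \<in> S" "y [^] (p ^ m) \<in> S" "x \<in> carrier R" "y \<in> carrier R"
        using xy by (auto simp: perfect_closure_def)
      have "x [^] (p ^ (n + m)) \<oplus> y [^] (p ^ (n + m)) \<in> S"
        using up[OF nm(1,3)] up[OF nm(2,4), of n] cl(7) by (simp add: add.commute)
      then have "(x \<oplus> y) [^] (p ^ (n + m)) \<in> S"
        using sat[OF frobenius_additive_power[OF J F nm(3,4)]] nm by blast
      then show ?thesis using nm unfolding perfect_closure_def by blast
    qed
  qed
  have prime: "x \<in> Q1 \<longleftrightarrow> x \<in> Q2" if "x \<in> ?P" for x
  proof -
    obtain n where n: "x [^] (p ^ n) \<in> S" "x \<in> carrier R"
      using \<open>x \<in> ?P\<close> unfolding perfect_closure_def by blast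
    have "p ^ n \<noteq> 0" using p by simp
    then obtain k where k: "p ^ n = Suc k" using not0_implies_Suc by blast
    have "x \<in> Q \<longleftrightarrow> x [^] (p ^ n) \<in> Q" if Q: "primeideal Q R" for Q
    proof
      show "x [^] (p ^ n) \<in> Q \<Longrightarrow> x \<in> Q" by (rule prime_pow[OF Q n(2)])
      show "x \<in> Q \<Longrightarrow> x [^] (p ^ n) \<in> Q"
        using ideal.I_l_closed[OF primeideal.axioms(1)[OF Q]] n(2) unfolding k by simp
    qed
    from this[OF Q1] this[OF Q2] show ?thesis using S'(3)[OF n(1)] by blast
  qed
  have "countable_mod ?J ?P"
  proof -
    obtain C where C: "countable C" "C \<subseteq> S" "\<And>s. s \<in> S \<Longrightarrow> \<exists>c \<in> C. mod_eq ?J s c"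
      using countable_mod_within[OF J S'(1,2,4)] by blast
    \<comment> \<open>One root for each \<open>n\<close> and \<open>c\<close>, unique up to
      congruence. Where none exists the choice is arbitrary, whence the intersection with the
      carrier in \<open>?W\<close>.\<close>
    define w where "w n c = (SOME x. x \<in> carrier R \<and> mod_eq ?J (x [^] (p ^ n)) c)" for n c
    let ?W = "(\<lambda>(n, c). w n c) ` (UNIV \<times> C) \<inter> carrier R"
    have "\<exists>c \<in> ?W. mod_eq ?J x c" if "x \<in> ?P" for x
    proof -
      obtain n where n: "x [^] (p ^ n) \<in> S" "x \<in> carrier R"
        using \<open>x \<in> ?P\<close> unfolding perfect_closure_def by blast
      obtain c where c: "c \<in> C" "mod_eq ?J (x [^] (p ^ n)) c" using C(3)[OF n(1)] by blast
      have cc: "c \<in> carrier R" using c(1) C(2) cl(1) by blast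
      have w: "w n c \<in> carrier R" "mod_eq ?J (w n c [^] (p ^ n)) c"
        unfolding w_def using someI[of "\<lambda>x. x \<in> carrier R \<and> mod_eq ?J (x [^] (p ^ n)) c" x] n(2) c(2) by auto
      let ?d = "x \<ominus> w n c"
      have d: "?d \<in> carrier R" using n w by simp
      have dw: "?d \<oplus> w n c = x" using n(2) w(1) by (simp add: minus_eq a_assoc l_neg)
      have 1: "mod_eq ?J (x [^] (p ^ n)) (?d [^] (p ^ n) \<oplus> w n c [^] (p ^ n))"
        using frobenius_additive_power[OF J F d w(1), of n] unfolding dw .
      have 2: "mod_eq ?J (x [^] (p ^ n)) (w n c [^] (p ^ n))"
        using mod_eq_trans[OF J c(2) mod_eq_sym[OF J w(2)]] n w cc by simp
      have "mod_eq ?J (?d [^] (p ^ n) \<oplus> w n c [^] (p ^ n)) (w n c [^] (p ^ n))"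
        using mod_eq_trans[OF J mod_eq_sym[OF J 1] 2] n w d by simp
      moreover have "(?d [^] (p ^ n) \<oplus> w n c [^] (p ^ n)) \<ominus> (w n c [^] (p ^ n)) = ?d [^] (p ^ n)"
        using nat_pow_closed[OF d] nat_pow_closed[OF w(1)] by (simp add: minus_eq a_assoc r_neg)
      ultimately have "?d [^] (p ^ n) \<in> ?J" by (simp add: mod_eq_def)
      then have "?d \<in> ?J" using prime_pow[OF Q1 d] prime_pow[OF Q2 d] by blast
      then have "mod_eq ?J x (w n c)" by (simp add: mod_eq_def)
      then show ?thesis using w(1) c(1) by (intro bexI[of _ "w n c"]) auto
    qed
    moreover have "countable ?W" using C(1) by (intro countable_Int1 countable_image) auto
    ultimately show ?thesis unfolding countable_mod_def by blast
  qed
  moreover have "x \<in> ?P" if "x \<in> carrier R" "x [^] p \<in> ?P" for x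
  proof -
    obtain n where "(x [^] p) [^] (p ^ n) \<in> S"
      using \<open>x [^] p \<in> ?P\<close> unfolding perfect_closure_def by blast
    then have "x [^] (p ^ Suc n) \<in> S" using that by (simp add: nat_pow_pow)
    then show ?thesis using that unfolding perfect_closure_def by blast
  qed
  ultimately show "perfect_graph Q1 Q2 p ?P"
    using sub prime S'(2) SP unfolding perfect_graph_def residue_graph_def by blast
qed

lemma list_approx:
  assumes "\<And>s. s \<in> S \<Longrightarrow> \<exists>c \<in> C. mod_eq Q s c" "set q \<subseteq> S"
  shows "\<exists>q'. set q' \<subseteq> C \<and> list_all2 (mod_eq Q) q q'"
  using assms(2)
proof (induction q)
  case (Cons a q)
  then obtain q' c where "set q' \<subseteq> C" "list_all2 (mod_eq Q) q q'" "c \<in> C" "mod_eq Q a c"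
    using assms(1)[of a] by auto
  then show ?case by (intro exI[of _ "c # q'"]) auto
qed auto

text \<open>By \<open>tr\<close>, \<open>z\<close> satisfies the same relations over
  \<open>S\<close> modulo both primes. Countability survives because a list over \<open>S\<close>
  can be replaced, entry by entry, by one over countably many representatives without changing its
  value at \<open>z\<close> modulo \<open>Q1 \<inter> Q2\<close>.\<close>

lemma residue_graph_adjoin:
  assumes Q1: "primeideal Q1 R" and Q2: "primeideal Q2 R" and S: "residue_graph Q1 Q2 S"
    and z: "z \<in> carrier R"
    and tr: "\<And>q. set q \<subseteq> S \<Longrightarrow> eval q z \<in> Q1 \<longleftrightarrow> eval q z \<in> Q2"
  shows "residue_graph Q1 Q2 (adjoin S z)"
proof -
  interpret Q1: primeideal Q1 R by fact
  interpret Q2: primeideal Q2 R by fact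
  let ?J = "Q1 \<inter> Q2"
  have J: "ideal ?J R" by (rule i_intersect[OF Q1.is_ideal Q2.is_ideal])
  have S': "subring S R" "?J \<subseteq> S" "countable_mod ?J S" using S by (auto simp: residue_graph_def)
  have sub: "S \<subseteq> carrier R" using S'(1) by (rule subringE(1))
  obtain C where C: "countable C" "C \<subseteq> S" "\<And>s. s \<in> S \<Longrightarrow> \<exists>c \<in> C. mod_eq ?J s c"
    using countable_mod_within[OF J S'] by blast
  have "\<exists>c \<in> (\<lambda>q. eval q z) ` lists C. mod_eq ?J s c" if s: "s \<in> adjoin S z" for s
  proof -
    obtain q where q: "set q \<subseteq> S" "s = eval q z" using s by (auto simp: adjoin_def)
    obtain q' where q': "set q' \<subseteq> C" "list_all2 (mod_eq ?J) q q'" using list_approx[OF C(3) q(1)] by blast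
    have "mod_eq ?J (eval q z) (eval q' z)"
      using mod_eq_eval[OF J q'(2)] q(1) q'(1) C(2) sub mod_eq_refl[OF J z] z by blast
    then show ?thesis using q' q(2) by auto
  qed
  moreover have "countable ((\<lambda>q. eval q z) ` lists C)" using C(1) by simp
  moreover have "(\<lambda>q. eval q z) ` lists C \<subseteq> carrier R"
  proof
    fix y assume "y \<in> (\<lambda>q. eval q z) ` lists C"
    then obtain q where q: "set q \<subseteq> C" "y = eval q z" by auto
    then have "set q \<subseteq> carrier R" using C(2) sub by blast
    then show "y \<in> carrier R" using q(2) eval_in_carrier z by blast
  qed
  ultimately have "countable_mod ?J (adjoin S z)" unfolding countable_mod_def by blast
  then show ?thesis
    using adjoin_props[OF S'(1) z] S'(2) tr unfolding residue_graph_def adjoin_def by blast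
qed

section \<open>Uncountable algebraically closed quotients and the extension step\<close>

text \<open>The quotient by \<open>Q\<close> is an uncountable algebraically closed field: length at
  least 2 with head outside \<open>Q\<close> encodes a nonconstant polynomial, and the linear ones
  provide inverses.\<close>

definition uncountable_acf_mod :: "'a set \<Rightarrow> bool" where
  "uncountable_acf_mod Q \<longleftrightarrow> primeideal Q R \<and> \<not> countable_mod Q (carrier R) \<and>
     (\<forall>p. set p \<subseteq> carrier R \<and> length p \<ge> 2 \<and> hd p \<notin> Q \<longrightarrow> (\<exists>y \<in> carrier R. eval p y \<in> Q))"

text \<open>Only countably many polynomials have coefficients in \<open>C\<close>, and each has
  finitely many roots modulo \<open>Q\<close>; together these do not exhaust an uncountable
  quotient.\<close>

lemma exists_transcendental:
  assumes Q: "uncountable_acf_mod Q" and C: "countable C" "C \<subseteq> carrier R"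
  obtains y where "y \<in> carrier R"
    "\<And>p. set p \<subseteq> C \<Longrightarrow> p \<noteq> [] \<Longrightarrow> hd p \<notin> Q \<Longrightarrow> eval p y \<notin> Q"
proof -
  have Q': "primeideal Q R" using Q by (simp add: uncountable_acf_mod_def)
  let ?B = "{p \<in> lists C. p \<noteq> [] \<and> hd p \<notin> Q}"
  have "\<forall>p \<in> ?B. \<exists>F. finite F \<and> F \<subseteq> carrier R \<and>
      (\<forall>y \<in> carrier R. eval p y \<in> Q \<longrightarrow> (\<exists>c \<in> F. mod_eq Q y c))"
    by (intro ballI finite_roots[OF Q']) (use C in auto)
  from bchoice[OF this] obtain F where "\<forall>p \<in> ?B. finite (F p) \<and> F p \<subseteq> carrier R \<and>
      (\<forall>y \<in> carrier R. eval p y \<in> Q \<longrightarrow> (\<exists>c \<in> F p. mod_eq Q y c))" ..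
  then have F: "\<And>p. p \<in> ?B \<Longrightarrow> finite (F p)" "\<And>p. p \<in> ?B \<Longrightarrow> F p \<subseteq> carrier R"
    "\<And>p y. p \<in> ?B \<Longrightarrow> y \<in> carrier R \<Longrightarrow> eval p y \<in> Q \<Longrightarrow> \<exists>c \<in> F p. mod_eq Q y c"
    by auto
  have "countable ?B" by (rule countable_subset[of _ "lists C"]) (use C(1) in auto)
  then have "countable (\<Union>p \<in> ?B. F p)" using F(1) by (intro countable_UN) (auto intro: countable_finite)
  moreover have "(\<Union>p \<in> ?B. F p) \<subseteq> carrier R" using F(2) by blast
  ultimately obtain y where y: "y \<in> carrier R" "\<not> (\<exists>c \<in> (\<Union>p \<in> ?B. F p). mod_eq Q y c)"
    using Q unfolding uncountable_acf_mod_def countable_mod_def by blast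
  have "eval p y \<notin> Q" if "set p \<subseteq> C" "p \<noteq> []" "hd p \<notin> Q" for p
  proof
    assume *: "eval p y \<in> Q"
    have "p \<in> ?B" using that by auto
    then show False using F(3)[OF _ y(1) *] y(2) by blast
  qed
  then show ?thesis using that[OF y(1)] by blast
qed

text \<open>The forth step. The partner \<open>y\<close> of \<open>x\<close> is a root modulo
  \<open>Q2\<close> of the minimal polynomial of \<open>x\<close> over \<open>S\<close> modulo
  \<open>Q1\<close>, or transcendental over \<open>S\<close> if \<open>x\<close> is;
  \<open>crt\<close> merges \<open>x\<close> and \<open>y\<close> into the single element
  \<open>z\<close> to be adjoined. Exchanging \<open>Q1\<close> and \<open>Q2\<close> yields the
  back step.\<close>

lemma perfect_graph_extend:
  assumes Q1: "primeideal Q1 R" and Q2: "uncountable_acf_mod Q2" and p: "p \<ge> 1"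
    and F: "frobenius_additive (Q1 \<inter> Q2) p" and S: "perfect_graph Q1 Q2 p S" and x: "x \<in> carrier R"
    and crt: "\<And>x y. x \<in> carrier R \<Longrightarrow> y \<in> carrier R \<Longrightarrow> \<exists>z \<in> carrier R. mod_eq Q1 z x \<and> mod_eq Q2 z y"
  shows "\<exists>S' z. perfect_graph Q1 Q2 p S' \<and> S \<subseteq> S' \<and> z \<in> S' \<and> mod_eq Q1 z x"
proof -
  have Q2': "primeideal Q2 R" using Q2 by (simp add: uncountable_acf_mod_def)
  interpret Q1: primeideal Q1 R by fact
  interpret Q2: primeideal Q2 R by fact
  let ?J = "Q1 \<inter> Q2"
  have J: "ideal ?J R" by (rule i_intersect[OF Q1.is_ideal Q2.is_ideal])
  have S': "residue_graph Q1 Q2 S" "subring S R" "?J \<subseteq> S" "\<And>s. s \<in> S \<Longrightarrow> s \<in> Q1 \<longleftrightarrow> s \<in> Q2" "countable_mod ?J S"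
    using S by (auto simp: perfect_graph_def residue_graph_def)
  have sub: "S \<subseteq> carrier R" using S'(2) by (rule subringE(1))
  have hdS: "hd q \<in> S" if "q \<noteq> []" "set q \<subseteq> S" for q using that by (cases q) auto
  have ev: "eval q y \<in> carrier R" if "set q \<subseteq> S" "y \<in> carrier R" for q y
    using eval_in_carrier[of q y] that sub by blast
  have evc: "eval q z \<in> Q \<longleftrightarrow> eval q y \<in> Q"
    if "ideal Q R" "mod_eq Q z y" "set q \<subseteq> S" "z \<in> carrier R" "y \<in> carrier R" for q z y Q
  proof -
    have "list_all2 (mod_eq Q) q q" using that(3) sub mod_eq_refl[OF that(1)] by (auto simp: list.rel_refl_strong list_all2_same)
    then show ?thesis using mod_eq_mem[OF that(1) mod_eq_eval[OF that(1)]] that sub ev by (meson dual_order.trans)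
  qed
  have "\<exists>z \<in> carrier R. mod_eq Q1 z x \<and> (\<forall>q. set q \<subseteq> S \<longrightarrow> (eval q z \<in> Q1 \<longleftrightarrow> eval q z \<in> Q2))"
  proof (cases "\<exists>q. set q \<subseteq> S \<and> q \<noteq> [] \<and> hd q \<notin> Q1 \<and> eval q x \<in> Q1")
    case True
    \<comment> \<open>\<open>g\<close> becomes a minimal polynomial of \<open>x\<close> modulo
      \<open>Q1\<close>. Its head lies in \<open>S\<close>, so it is outside \<open>Q2\<close> as
      well, and \<open>g\<close> has a root \<open>y\<close> modulo \<open>Q2\<close>.\<close>
    let ?P = "\<lambda>q. set q \<subseteq> S \<and> q \<noteq> [] \<and> hd q \<notin> Q1 \<and> eval q x \<in> Q1"
    obtain g where g: "?P g" "\<And>q. ?P q \<Longrightarrow> length g \<le> length q"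
      using True ex_has_least_nat[of ?P _ length] by blast
    have "length g \<ge> 2"
    proof (rule ccontr)
      assume "\<not> 2 \<le> length g"
      then obtain c where "g = [c]" using g(1) by (cases g rule: list.exhaust; cases "tl g") auto
      moreover then have "eval g x = c" using g(1) sub x by auto
      ultimately show False using g(1) by simp
    qed
    moreover have "hd g \<notin> Q2" using g(1) S'(4) hdS by blast
    moreover have "set g \<subseteq> carrier R" using g(1) sub by blast
    ultimately obtain y where y: "y \<in> carrier R" "eval g y \<in> Q2"
      using Q2 unfolding uncountable_acf_mod_def by blast
    obtain z where z: "z \<in> carrier R" "mod_eq Q1 z x" "mod_eq Q2 z y" using crt[OF x y(1)] by blast
    have e1: "eval q z \<in> Q1 \<longleftrightarrow> eval q x \<in> Q1" if "set q \<subseteq> S" for q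
      by (rule evc) (use z x that Q1.is_ideal in auto)
    have e2: "eval q z \<in> Q2 \<longleftrightarrow> eval q y \<in> Q2" if "set q \<subseteq> S" for q
      by (rule evc) (use z y that Q2.is_ideal in auto)
    have "eval q z \<in> Q1 \<longleftrightarrow> eval q z \<in> Q2" if "set q \<subseteq> S" for q
      by (rule eval_transfer_iff[OF Q1 Q2' S'(2,4) z(1), of g])
        (use g e1 e2 y(2) that in auto)
    then show ?thesis using z by blast
  next
    case False
    \<comment> \<open>\<open>S\<close> contains \<open>Q1 \<inter> Q2\<close> and may be
      uncountable. So \<open>y\<close> is chosen transcendental over countably many representatives,
      and \<open>tr2\<close> passes from these to \<open>S\<close>.\<close>
    obtain C where C: "countable C" "C \<subseteq> S" "\<And>s. s \<in> S \<Longrightarrow> \<exists>c \<in> C. mod_eq ?J s c"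
      using countable_mod_within[OF J S'(2,3,5)] by blast
    have "C \<subseteq> carrier R" using C(2) sub by blast
    then obtain y where y: "y \<in> carrier R"
      "\<And>p. set p \<subseteq> C \<Longrightarrow> p \<noteq> [] \<Longrightarrow> hd p \<notin> Q2 \<Longrightarrow> eval p y \<notin> Q2"
      using exists_transcendental[OF Q2 C(1)] by blast
    obtain z where z: "z \<in> carrier R" "mod_eq Q1 z x" "mod_eq Q2 z y" using crt[OF x y(1)] by blast
    have tr1: "eval q z \<notin> Q1" if "set q \<subseteq> S" "q \<noteq> []" "hd q \<notin> Q1" for q
      using False evc[OF Q1.is_ideal z(2) that(1) z(1) x] that by blast
    have tr2: "eval q z \<notin> Q2" if q: "set q \<subseteq> S" "q \<noteq> []" "hd q \<notin> Q2" for q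
    proof -
      obtain q' where q': "set q' \<subseteq> C" "list_all2 (mod_eq ?J) q q'" using list_approx[OF C(3) q(1)] by blast
      have l: "list_all2 (mod_eq Q2) q q'"
        using q'(2) by (rule list_all2_mono) (auto simp: mod_eq_def)
      have "q' \<noteq> []" using q'(2) q(2) by auto
      have "mod_eq Q2 (hd q) (hd q')" using l q(2) by (cases q; cases q') auto
      moreover have "hd q \<in> carrier R" "hd q' \<in> carrier R"
        using hdS[OF q(2,1)] hdS[of q'] q'(1) C(2) \<open>q' \<noteq> []\<close> sub by auto
      ultimately have "hd q' \<notin> Q2" using mod_eq_mem[OF Q2.is_ideal] q(3) by blast
      then have "eval q' y \<notin> Q2" using y(2) q'(1) \<open>q' \<noteq> []\<close> by blast
      moreover have q'S: "set q' \<subseteq> S" using q' C by blast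
      moreover have "mod_eq Q2 (eval q z) (eval q' y)"
        using mod_eq_eval[OF Q2.is_ideal l] q(1) q'S sub z y(1) by (meson dual_order.trans)
      ultimately show ?thesis
        using mod_eq_mem[OF Q2.is_ideal] ev[OF q(1) z(1)] ev[OF q'S y(1)] by blast
    qed
    \<comment> \<open>For a transcendental element the value lies in the ideal only if all
      coefficients do, and on elements of \<open>S\<close> the two primes agree.\<close>
    have *: "eval q z \<in> Q \<longleftrightarrow> set q \<subseteq> Q"
      if Q: "ideal Q R" and tr: "\<And>q. set q \<subseteq> S \<Longrightarrow> q \<noteq> [] \<Longrightarrow> hd q \<notin> Q \<Longrightarrow> eval q z \<notin> Q"
        and q: "set q \<subseteq> S" for q Q
    proof
      show "set q \<subseteq> Q \<Longrightarrow> eval q z \<in> Q" using eval_in_ideal[OF Q _ z(1)] by blast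
      assume "eval q z \<in> Q"
      moreover have "set q \<subseteq> carrier R" using q sub by blast
      ultimately show "set q \<subseteq> Q"
        using eval_ideal_suffix[OF Q _ z(1), of q] tr q by (metis order_trans)
    qed
    have "eval q z \<in> Q1 \<longleftrightarrow> eval q z \<in> Q2" if q: "set q \<subseteq> S" for q
      using *[OF Q1.is_ideal tr1 q] *[OF Q2.is_ideal tr2 q] S'(4) q by blast
    then show ?thesis using z by blast
  qed
  then obtain z where z: "z \<in> carrier R" "mod_eq Q1 z x"
    "\<And>q. set q \<subseteq> S \<Longrightarrow> eval q z \<in> Q1 \<longleftrightarrow> eval q z \<in> Q2" by blast
  have "residue_graph Q1 Q2 (adjoin S z)" by (rule residue_graph_adjoin[OF Q1 Q2' S'(1) z(1) z(3)])
  from perfect_graph_perfect_closure[OF Q1 Q2' p F this]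
  show ?thesis using adjoin_props[OF S'(2) z(1)] z(2) by blast
qed

end

section \<open>Normal forms\<close>

context cring begin

section \<open>Subgroups and subrings of normal forms\<close>

text \<open>The truncation at \<open>i\<close> matters: an error in the coefficient of
  \<open>a i\<close> has to be absorbed by \<open>NF T a i\<close>, that is, by the earlier
  generators.\<close>

primrec NF :: "'a set \<Rightarrow> (nat \<Rightarrow> 'a) \<Rightarrow> nat \<Rightarrow> 'a set" where
  "NF T a 0 = {\<zero>}"
| "NF T a (Suc i) = {n \<oplus> t \<otimes> a i | n t. n \<in> NF T a i \<and> t \<in> T}"

text \<open>The defects form the additive subgroup generated by \<open>\<pi> T\<close>.  In residue characteristic
  \<open>p\<close>, the representatives are additive up to defects for \<open>\<pi> = p\<close>.\<close>

definition defects :: "'a set \<Rightarrow> 'a \<Rightarrow> 'a set" where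
  "defects T \<pi> = \<Inter>{A. additive_subgroup A R \<and> (\<forall>u \<in> T. \<pi> \<otimes> u \<in> A)}"

text \<open>Negatives have their own clause because -1 need not be a representative: in residue
  characteristic 2 it is congruent to 1.\<close>

definition quasi_additive :: "'a set \<Rightarrow> 'a \<Rightarrow> bool" where
  "quasi_additive T \<pi> \<longleftrightarrow>
     (\<forall>t \<in> T. \<forall>t' \<in> T. \<exists>t'' \<in> T. t \<oplus> t' \<ominus> t'' \<in> defects T \<pi>) \<and>
     (\<forall>t \<in> T. \<exists>t' \<in> T. t \<oplus> t' \<in> defects T \<pi>)"

lemma NF_mono: "T \<subseteq> T' \<Longrightarrow> NF T a i \<subseteq> NF T' a i"
  by (induction i) (auto; blast)+

lemma NF_finite_support: "x \<in> NF T a i \<Longrightarrow> \<exists>F. finite F \<and> F \<subseteq> T \<and> x \<in> NF F a i"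
proof (induction i arbitrary: x)
  case 0
  then show ?case by auto
next
  case (Suc i)
  then obtain n t where nt: "n \<in> NF T a i" "t \<in> T" "x = n \<oplus> t \<otimes> a i" by auto
  from Suc.IH[OF nt(1)] obtain F where F: "finite F" "F \<subseteq> T" "n \<in> NF F a i" by blast
  have "n \<in> NF (insert t F) a i" using F(3) NF_mono[of F "insert t F"] by blast
  then have "x \<in> NF (insert t F) a (Suc i)" using nt(3) by auto
  then show ?case using F nt(2) by (intro exI[of _ "insert t F"]) auto
qed

lemma NF_closed:
  "T \<subseteq> carrier R \<Longrightarrow> (\<And>j. j < i \<Longrightarrow> a j \<in> carrier R) \<Longrightarrow> NF T a i \<subseteq> carrier R"
  by (induction i) (auto; blast)+

text \<open>Induction on the level. In a sum, the coefficients of \<open>a i\<close> are replaced by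
  a single element of \<open>T\<close>; the error is a defect times \<open>a i\<close>, and it lies
  in \<open>NF T a i\<close> because \<open>\<pi> a\<^sub>i\<close> does and multiplication by
  \<open>T\<close> preserves that set. So the two claims have to be proved together.\<close>

lemma NF_subgroup:
  assumes T: "T \<subseteq> carrier R" "\<zero> \<in> T" "\<And>t u. t \<in> T \<Longrightarrow> u \<in> T \<Longrightarrow> t \<otimes> u \<in> T"
    and a: "\<And>j. j < l \<Longrightarrow> a j \<in> carrier R" and \<pi>: "\<pi> \<in> carrier R"
    and qa: "quasi_additive T \<pi>"
    and \<pi>a: "\<And>j. j < l \<Longrightarrow> \<pi> \<otimes> a j \<in> NF T a j" and i: "i \<le> l"
  shows "additive_subgroup (NF T a i) R \<and> (\<forall>t \<in> T. \<forall>w \<in> NF T a i. t \<otimes> w \<in> NF T a i)"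
  using i
proof (induction i)
  case 0
  have "additive_subgroup {\<zero>} R"
    by (rule additive_subgroupI, rule add.subgroupI) auto
  then show ?case using T(1) by auto
next
  case (Suc i)
  then have IH: "additive_subgroup (NF T a i) R" "\<And>t w. t \<in> T \<Longrightarrow> w \<in> NF T a i \<Longrightarrow> t \<otimes> w \<in> NF T a i"
    and i: "i < l" by auto
  interpret N: additive_subgroup "NF T a i" R by (rule IH(1))
  \<comment> \<open>The multipliers that take \<open>a i\<close> to the lower level. They form an
    additive subgroup, so once it contains \<open>\<pi> u\<close> for all \<open>u\<close> in
    \<open>T\<close>, it contains all defects.\<close>
  let ?A = "{w \<in> carrier R. w \<otimes> a i \<in> NF T a i}"
  have ai: "a i \<in> carrier R" using a i by blast
  have A: "additive_subgroup ?A R"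
  proof (rule additive_subgroupI, rule add.subgroupI)
    have "\<zero> \<in> ?A" using ai N.zero_closed by simp
    then show "?A \<noteq> {}" by blast
    show "\<ominus> w \<in> ?A" if "w \<in> ?A" for w
      using that ai N.a_inv_closed[of "w \<otimes> a i"] by (simp add: l_minus)
    show "w \<oplus> v \<in> ?A" if "w \<in> ?A" "v \<in> ?A" for w v
      using that ai N.a_closed by (simp add: l_distr)
  qed auto
  have "\<pi> \<otimes> u \<in> ?A" if u: "u \<in> T" for u
  proof -
    have uc: "u \<in> carrier R" using u T by blast
    have "(\<pi> \<otimes> u) \<otimes> a i = u \<otimes> (\<pi> \<otimes> a i)" using uc \<pi> ai by (simp add: m_ac)
    then show ?thesis using IH(2)[OF u \<pi>a[OF i]] uc \<pi> by simp
  qed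
  then have def_A: "defects T \<pi> \<subseteq> ?A" using A unfolding defects_def by blast
  have nc: "n \<in> carrier R" if "n \<in> NF T a i" for n using N.a_subset that by blast
  have tc: "t \<in> carrier R" if "t \<in> T" for t using T that by blast
  have add: "x \<oplus> y \<in> NF T a (Suc i)" if x: "x \<in> NF T a (Suc i)" and y: "y \<in> NF T a (Suc i)" for x y
  proof -
    obtain n t where nt: "n \<in> NF T a i" "t \<in> T" "x = n \<oplus> t \<otimes> a i" using x by auto
    obtain n' t' where nt': "n' \<in> NF T a i" "t' \<in> T" "y = n' \<oplus> t' \<otimes> a i" using y by auto
    obtain t'' where t'': "t'' \<in> T" "t \<oplus> t' \<ominus> t'' \<in> defects T \<pi>"
      using qa nt nt' unfolding quasi_additive_def by blast
    then have "(t \<oplus> t' \<ominus> t'') \<otimes> a i \<in> NF T a i" using def_A by blast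
    then have "n \<oplus> n' \<oplus> (t \<oplus> t' \<ominus> t'') \<otimes> a i \<in> NF T a i" using nt nt' N.a_closed by blast
    moreover have "x \<oplus> y = (n \<oplus> n' \<oplus> (t \<oplus> t' \<ominus> t'') \<otimes> a i) \<oplus> t'' \<otimes> a i"
      unfolding nt(3) nt'(3) using nc[OF nt(1)] nc[OF nt'(1)] tc[OF nt(2)] tc[OF nt'(2)] tc[OF t''(1)] ai
      by algebra
    ultimately show ?thesis using t''(1) by auto
  qed
  have neg: "\<ominus> x \<in> NF T a (Suc i)" if x: "x \<in> NF T a (Suc i)" for x
  proof -
    obtain n t where nt: "n \<in> NF T a i" "t \<in> T" "x = n \<oplus> t \<otimes> a i" using x by auto
    obtain t' where t': "t' \<in> T" "t \<oplus> t' \<in> defects T \<pi>"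
      using qa nt unfolding quasi_additive_def by blast
    then have "(t \<oplus> t') \<otimes> a i \<in> NF T a i" using def_A by blast
    then have "\<ominus> (n \<oplus> (t \<oplus> t') \<otimes> a i) \<in> NF T a i" using nt N.a_closed N.a_inv_closed by blast
    moreover have "\<ominus> x = \<ominus> (n \<oplus> (t \<oplus> t') \<otimes> a i) \<oplus> t' \<otimes> a i"
      unfolding nt(3) using nc[OF nt(1)] tc[OF nt(2)] tc[OF t'(1)] ai by algebra
    ultimately show ?thesis using t'(1) by auto
  qed
  have smult: "u \<otimes> x \<in> NF T a (Suc i)" if u: "u \<in> T" and x: "x \<in> NF T a (Suc i)" for u x
  proof -
    obtain n t where nt: "n \<in> NF T a i" "t \<in> T" "x = n \<oplus> t \<otimes> a i" using x by auto
    have "u \<otimes> x = u \<otimes> n \<oplus> (u \<otimes> t) \<otimes> a i"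
      unfolding nt(3) using nc[OF nt(1)] tc[OF nt(2)] tc[OF u] ai by algebra
    then show ?thesis using IH(2)[OF u nt(1)] T(3)[OF u nt(2)] by auto
  qed
  have "additive_subgroup (NF T a (Suc i)) R"
  proof (rule additive_subgroupI, rule add.subgroupI)
    show "NF T a (Suc i) \<subseteq> carrier R" using NF_closed[OF T(1), of "Suc i" a] a i by simp
    have "\<zero> \<oplus> \<zero> \<otimes> a i \<in> NF T a (Suc i)" unfolding NF.simps using N.zero_closed T(2) by blast
    then show "NF T a (Suc i) \<noteq> {}" by blast
  qed (use add neg in auto)
  then show ?case using smult by blast
qed

text \<open>With sums and multiplication by \<open>T\<close> available, closure under products only
  requires the structure constants: normal forms for the products of two generators.\<close>

lemma NF_subring:
  assumes T: "T \<subseteq> carrier R" "\<zero> \<in> T" "\<And>t u. t \<in> T \<Longrightarrow> u \<in> T \<Longrightarrow> t \<otimes> u \<in> T"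
    and a: "\<And>j. j < l \<Longrightarrow> a j \<in> carrier R" and \<pi>: "\<pi> \<in> carrier R"
    and qa: "quasi_additive T \<pi>"
    and \<pi>a: "\<And>j. j < l \<Longrightarrow> \<pi> \<otimes> a j \<in> NF T a j"
    and one: "\<one> \<in> NF T a l" and aa: "\<And>i j. i < l \<Longrightarrow> j < l \<Longrightarrow> a i \<otimes> a j \<in> NF T a l"
  shows "subring (NF T a l) R"
proof -
  note sg = NF_subgroup[OF T a \<pi> qa \<pi>a, of l]
  interpret N: additive_subgroup "NF T a l" R using sg by simp
  have tm: "t \<otimes> w \<in> NF T a l" if "t \<in> T" "w \<in> NF T a l" for t w using sg that by simp
  have tc: "t \<in> carrier R" if "t \<in> T" for t using T that by blast
  have sub: "NF T a i \<subseteq> carrier R" if "i \<le> l" for i using NF_closed[OF T(1), of i a] a that by simp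
  have am: "a i \<otimes> y \<in> NF T a l" if i: "i < l" and "j \<le> l" "y \<in> NF T a j" for i j y
    using that(2,3)
  proof (induction j arbitrary: y)
    case 0
    then show ?case using a[OF i] N.zero_closed by simp
  next
    case (Suc j)
    then obtain n t where nt: "n \<in> NF T a j" "t \<in> T" "y = n \<oplus> t \<otimes> a j" by auto
    have aj: "j < l" using Suc by simp
    have "n \<in> carrier R" using sub[of j] Suc.prems nt by auto
    then have "a i \<otimes> y = a i \<otimes> n \<oplus> t \<otimes> (a i \<otimes> a j)"
      unfolding nt(3) using tc[OF nt(2)] a[OF aj] a[OF i] by algebra
    then show ?case using N.a_closed[OF Suc.IH[OF _ nt(1)] tm[OF nt(2) aa[OF i aj]]] aj by simp
  qed
  have mult: "x \<otimes> y \<in> NF T a l" if "i \<le> l" "x \<in> NF T a i" and y: "y \<in> NF T a l" for i x y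
    using that(1,2)
  proof (induction i arbitrary: x)
    case 0
    then show ?case using N.zero_closed sub[of l] y by auto
  next
    case (Suc i)
    then obtain n t where nt: "n \<in> NF T a i" "t \<in> T" "x = n \<oplus> t \<otimes> a i" by auto
    have i: "i < l" using Suc by simp
    have "n \<in> carrier R" "y \<in> carrier R" using sub[of i] sub[of l] Suc.prems nt y by auto
    then have "x \<otimes> y = n \<otimes> y \<oplus> t \<otimes> (a i \<otimes> y)"
      unfolding nt(3) using tc[OF nt(2)] a[OF i] by algebra
    then show ?case using N.a_closed[OF Suc.IH[OF _ nt(1)] tm[OF nt(2) am[OF i _ y]]] i by simp
  qed
  show ?thesis
    by (rule subringI) (use sub[of l] one N.a_closed N.a_inv_closed mult[of l] in auto)
qed

section \<open>Powers of sums modulo additive subgroups\<close>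

lemma binomial_expansion:
  assumes x: "x \<in> carrier R" and y: "y \<in> carrier R"
  shows "(x \<oplus> y) [^] (n :: nat) = lin R (\<lambda>j. [(n choose j)] \<cdot> (x [^] j \<otimes> y [^] (n - j))) (Suc n)"
proof (induction n)
  case 0
  show ?case by simp
next
  case (Suc n)
  define F where "F n j = [(n choose j)] \<cdot> (x [^] j \<otimes> y [^] (n - j))" for n j
  have c: "F n j \<in> carrier R" for n j using x y by (simp add: F_def)
  have F0: "F (Suc n) 0 = y \<otimes> F n 0" using x y by (simp add: F_def m_comm)
  have FS: "F (Suc n) (Suc j) = x \<otimes> F n j \<oplus> y \<otimes> F n (Suc j)" for j
  proof -
    have 1: "x \<otimes> F n j = [(n choose j)] \<cdot> (x [^] Suc j \<otimes> y [^] (n - j))"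
    proof -
      have "x \<otimes> F n j = [(n choose j)] \<cdot> (x \<otimes> (x [^] j \<otimes> y [^] (n - j)))"
        unfolding F_def by (rule add_pow_rdistr) (use x y in auto)
      also have "x \<otimes> (x [^] j \<otimes> y [^] (n - j)) = x [^] Suc j \<otimes> y [^] (n - j)"
        using x y by (simp add: m_ac)
      finally show ?thesis .
    qed
    have 2: "y \<otimes> F n (Suc j) = [(n choose Suc j)] \<cdot> (x [^] Suc j \<otimes> y [^] (n - j))"
    proof (cases "Suc j \<le> n")
      case True
      then have nj: "n - j = Suc (n - Suc j)" by simp
      have "y \<otimes> F n (Suc j) = [(n choose Suc j)] \<cdot> (y \<otimes> (x [^] Suc j \<otimes> y [^] (n - Suc j)))"
        unfolding F_def by (rule add_pow_rdistr) (use x y in auto)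
      also have "y \<otimes> (x [^] Suc j \<otimes> y [^] (n - Suc j)) = x [^] Suc j \<otimes> y [^] (n - j)"
        unfolding nj using x y by (simp add: m_ac)
      finally show ?thesis .
    next
      case False
      then show ?thesis using x y by (simp add: F_def binomial_eq_0)
    qed
    show ?thesis unfolding 1 2 unfolding F_def
      using add.nat_pow_mult[of "x [^] Suc j \<otimes> y [^] (n - j)" "n choose j" "n choose Suc j"] x y
      by simp
  qed
  have lc: "lin R (F n) k \<in> carrier R" for n k by (rule lin_closed) (rule c)
  have "lin R (F (Suc n)) (Suc m) = y \<otimes> lin R (F n) (Suc m) \<oplus> x \<otimes> lin R (F n) m" for m
  proof (induction m)
    case 0
    show ?case using c x y F0 by simp
  next
    case (Suc m)
    have "lin R (F (Suc n)) (Suc (Suc m)) =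
      (y \<otimes> lin R (F n) (Suc m) \<oplus> x \<otimes> lin R (F n) m) \<oplus> (x \<otimes> F n m \<oplus> y \<otimes> F n (Suc m))"
      using Suc FS[of m] by simp
    also have "\<dots> = y \<otimes> (lin R (F n) (Suc m) \<oplus> F n (Suc m)) \<oplus> x \<otimes> (lin R (F n) m \<oplus> F n m)"
      using lc[of n "Suc m"] lc[of n m] c[of n m] c[of n "Suc m"] x y by algebra
    finally show ?case by simp
  qed
  from this[of "Suc n"] have "lin R (F (Suc n)) (Suc (Suc n)) =
      y \<otimes> (lin R (F n) (Suc n) \<oplus> F n (Suc n)) \<oplus> x \<otimes> lin R (F n) (Suc n)" by simp
  moreover have "F n (Suc n) = \<zero>" using x y by (simp add: F_def binomial_eq_0)
  moreover have IH: "lin R (F n) (Suc n) = (x \<oplus> y) [^] n" unfolding Suc F_def by simp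
  ultimately have "lin R (F (Suc n)) (Suc (Suc n)) = y \<otimes> (x \<oplus> y) [^] n \<oplus> x \<otimes> (x \<oplus> y) [^] n"
    using x y by simp
  also have "\<dots> = (x \<oplus> y) [^] n \<otimes> (x \<oplus> y)"
  proof -
    have "(x \<oplus> y) [^] n \<in> carrier R" using x y by simp
    then show ?thesis using x y by algebra
  qed
  finally show ?case unfolding F_def by simp
qed

lemma additive_subgroup_add_pow:
  assumes "additive_subgroup A R" "w \<in> A" shows "[(c :: nat)] \<cdot> w \<in> A"
proof -
  interpret A: additive_subgroup A R by fact
  have "w \<in> carrier R" using assms(2) A.a_subset by blast
  then show ?thesis using assms(2) A.zero_closed A.a_closed by (induction c) auto
qed

lemma prime_dvd_binomial_power:
  assumes "prime (p :: nat)" "0 < j" "j < p ^ n"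
  shows "p dvd (p ^ n choose j)"
proof (rule ccontr)
  assume "\<not> p dvd (p ^ n choose j)"
  then have "coprime (p ^ n) (p ^ n choose j)"
    using assms(1) prime_imp_coprime by (metis coprime_power_left_iff)
  moreover have "p ^ n dvd j * (p ^ n choose j)"
    using times_binomial_minus1_eq[OF assms(2), of "p ^ n"] by simp
  ultimately have "p ^ n dvd j" using coprime_dvd_mult_left_iff by blast
  then show False using assms(2,3) by (auto dest: dvd_imp_le)
qed

text \<open>The inner binomial coefficients of \<open>p^n\<close> are divisible by \<open>p\<close>.
  Asking only for an additive subgroup \<open>A\<close> covers ideals and the subgroups in the
  definition of \<open>defects\<close> alike.\<close>

lemma binomial_defect:
  assumes p: "prime (p :: nat)" and x: "x \<in> carrier R" and y: "y \<in> carrier R"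
    and A: "additive_subgroup A R"
    and cross: "\<And>j. 0 < j \<Longrightarrow> j < p ^ n \<Longrightarrow> [p] \<cdot> \<one> \<otimes> (x [^] j \<otimes> y [^] (p ^ n - j)) \<in> A"
  shows "(x \<oplus> y) [^] (p ^ n) \<ominus> (x [^] (p ^ n) \<oplus> y [^] (p ^ n)) \<in> A"
proof -
  interpret A: additive_subgroup A R by fact
  define q where "q = p ^ n"
  have q: "q > 0" using prime_gt_0_nat[OF p] by (simp add: q_def)
  define F where "F j = [(q choose j)] \<cdot> (x [^] j \<otimes> y [^] (q - j))" for j
  have c: "F j \<in> carrier R" for j using x y by (simp add: F_def)
  have FA: "F j \<in> A" if j: "0 < j" "j < q" for j
  proof -
    have "p dvd (q choose j)" using prime_dvd_binomial_power[OF p, of j n] j unfolding q_def by simp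
    then obtain k where k: "q choose j = p * k" unfolding dvd_def by blast
    let ?w = "x [^] j \<otimes> y [^] (q - j)"
    have w: "?w \<in> carrier R" using x y by simp
    have "[p] \<cdot> \<one> \<otimes> ?w = [p] \<cdot> ?w" using add_pow_ldistr[OF one_closed w, of p] w by simp
    moreover have "[p] \<cdot> \<one> \<otimes> ?w \<in> A" using cross[of j] j by (simp add: q_def)
    ultimately have "[k] \<cdot> ([p] \<cdot> ?w) \<in> A" using additive_subgroup_add_pow[OF A] by metis
    then show ?thesis unfolding F_def k using add.nat_pow_pow[OF w, of k p] by (simp add: mult.commute)
  qed
  have "lin R F (Suc m) \<ominus> F 0 \<in> A" if "m < q" for m
    using that
  proof (induction m)
    case 0
    show ?case using c A.zero_closed by (simp add: minus_eq r_neg)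
  next
    case (Suc m)
    have "lin R F (Suc m) \<in> carrier R" by (rule lin_closed) (rule c)
    then have "lin R F (Suc (Suc m)) \<ominus> F 0 = (lin R F (Suc m) \<ominus> F 0) \<oplus> F (Suc m)"
      unfolding lin.simps(2)[of R F "Suc m"] using c[of 0] c[of "Suc m"] by algebra
    then show ?case using Suc FA A.a_closed by auto
  qed
  from this[of "q - 1"] have A1: "lin R F q \<ominus> F 0 \<in> A" using q by simp
  have lq: "lin R F q \<in> carrier R" by (rule lin_closed) (rule c)
  have F0: "F 0 = y [^] q" using x y by (simp add: F_def)
  have Fq: "F q = x [^] q" using x y by (simp add: F_def)
  have "(x \<oplus> y) [^] q = lin R F q \<oplus> x [^] q"
    using binomial_expansion[OF x y, of q] Fq unfolding F_def[symmetric] by simp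
  then have "(x \<oplus> y) [^] q \<ominus> (x [^] q \<oplus> y [^] q) = lin R F q \<ominus> F 0"
    using lq nat_pow_closed[OF x, of q] nat_pow_closed[OF y, of q] unfolding F0 by algebra
  then show ?thesis using A1 unfolding q_def by simp
qed

lemma frobenius_additive_prime:
  assumes "prime (p :: nat)" "ideal Q R" "[p] \<cdot> \<one> \<in> Q"
  shows "frobenius_additive Q p"
  unfolding frobenius_additive_def mod_eq_def
proof (intro ballI)
  fix x y assume xy: "x \<in> carrier R" "y \<in> carrier R"
  have "[p] \<cdot> \<one> \<otimes> (x [^] j \<otimes> y [^] (p ^ 1 - j)) \<in> Q" for j
    using ideal.I_r_closed[OF assms(2,3)] xy by simp
  from binomial_defect[OF assms(1) xy ideal.axioms(1)[OF assms(2)], of 1, OF this]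
  show "(x \<oplus> y) [^] p \<ominus> (x [^] p \<oplus> y [^] p) \<in> Q" by simp
qed

text \<open>With \<open>q = p^n\<close>, write the summands as \<open>u^q\<close> and
  \<open>v^q\<close>. The representative of their sum is \<open>(u + v)^q\<close>, and the error
  consists of \<open>p\<close> times monomials in \<open>u\<close> and \<open>v\<close>, which lie
  in \<open>T\<close>. Hence the need for roots inside \<open>T\<close>.\<close>

lemma quasi_additive_prime:
  assumes p: "prime (p :: nat)" and T: "T \<subseteq> carrier R"
    "\<And>t u. t \<in> T \<Longrightarrow> u \<in> T \<Longrightarrow> t \<otimes> u \<in> T" "\<one> \<in> T"
    and root: "\<And>t. t \<in> T \<Longrightarrow> \<exists>u \<in> T. t = u [^] (p ^ n)"
    and sum: "\<And>t u. t \<in> T \<Longrightarrow> u \<in> T \<Longrightarrow> (t \<oplus> u) [^] (p ^ n) \<in> T"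
    and neg: "\<And>t. t \<in> T \<Longrightarrow> \<exists>u \<in> T. (t \<oplus> u) [^] (p ^ n) = \<zero>"
  shows "quasi_additive T ([p] \<cdot> \<one>)"
proof -
  have pw: "t [^] (k::nat) \<in> T" if "t \<in> T" for t k
    by (induction k) (use T that in auto)
  have key: "(u \<oplus> v) [^] (p ^ n) \<ominus> (u [^] (p ^ n) \<oplus> v [^] (p ^ n)) \<in> A"
    if "u \<in> T" "v \<in> T" "additive_subgroup A R" "\<forall>u \<in> T. [p] \<cdot> \<one> \<otimes> u \<in> A" for u v A
    by (rule binomial_defect[OF p _ _ that(3)]) (use that T pw in auto)
  have key': "u [^] (p ^ n) \<oplus> v [^] (p ^ n) \<ominus> (u \<oplus> v) [^] (p ^ n) \<in> defects T ([p] \<cdot> \<one>)"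
    if uv: "u \<in> T" "v \<in> T" for u v
    unfolding defects_def
  proof (rule InterI, clarify)
    fix A assume A: "additive_subgroup A R" "\<forall>u \<in> T. [p] \<cdot> \<one> \<otimes> u \<in> A"
    interpret A: additive_subgroup A R by fact
    have c: "u [^] (p ^ n) \<in> carrier R" "v [^] (p ^ n) \<in> carrier R" "(u \<oplus> v) [^] (p ^ n) \<in> carrier R"
      using uv T(1) by auto
    then have "u [^] (p ^ n) \<oplus> v [^] (p ^ n) \<ominus> (u \<oplus> v) [^] (p ^ n) =
      \<ominus> ((u \<oplus> v) [^] (p ^ n) \<ominus> (u [^] (p ^ n) \<oplus> v [^] (p ^ n)))" by algebra
    then show "u [^] (p ^ n) \<oplus> v [^] (p ^ n) \<ominus> (u \<oplus> v) [^] (p ^ n) \<in> A"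
      using A.a_inv_closed[OF key[OF uv A]] by simp
  qed
  show ?thesis unfolding quasi_additive_def
  proof (intro conjI ballI)
    fix t t' assume "t \<in> T" "t' \<in> T"
    then obtain u u' where u: "u \<in> T" "t = u [^] (p ^ n)" "u' \<in> T" "t' = u' [^] (p ^ n)" using root by blast
    show "\<exists>t'' \<in> T. t \<oplus> t' \<ominus> t'' \<in> defects T ([p] \<cdot> \<one>)"
      using key'[OF u(1,3)] sum[OF u(1,3)] unfolding u(2,4) by blast
  next
    fix t assume "t \<in> T"
    then obtain u where u: "u \<in> T" "t = u [^] (p ^ n)" using root by blast
    obtain v where v: "v \<in> T" "(u \<oplus> v) [^] (p ^ n) = \<zero>" using neg[OF u(1)] by blast
    have "t \<oplus> v [^] (p ^ n) \<in> carrier R" using u v T(1) by auto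
    then have "t \<oplus> v [^] (p ^ n) \<in> defects T ([p] \<cdot> \<one>)"
      using key'[OF u(1) v(1)] unfolding v(2) u(2) by (simp add: minus_eq)
    then show "\<exists>t' \<in> T. t \<oplus> t' \<in> defects T ([p] \<cdot> \<one>)" using pw[OF v(1)] by blast
  qed
qed

text \<open>For \<open>\<pi> = \<zero>\<close> the only defect is zero; this is the case of
  representatives that form a ring.\<close>

lemma quasi_additive_subring:
  assumes T: "subring T R"
  shows "quasi_additive T \<zero>"
proof -
  note cl = subringE[OF T]
  have z: "\<zero> \<in> defects T \<zero>"
    unfolding defects_def using additive_subgroup.zero_closed by blast
  have 1: "t \<oplus> t' \<ominus> (t \<oplus> t') = \<zero>" "t \<oplus> (\<ominus> t) = \<zero>" if "t \<in> T" "t' \<in> T" for t t'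
    using that cl(1) by (auto simp: minus_eq r_neg subset_iff)
  show ?thesis unfolding quasi_additive_def
    using z 1 cl(5,7) by metis
qed

end

section \<open>Local rings of finite length\<close>

context cring begin

section \<open>Formal derivatives and Taylor expansion to second order\<close>

text \<open>In \<open>c # p\<close> the exponent belonging to \<open>c\<close> is
  \<open>length p\<close>. A constant has the empty list as derivative, so the length of a nonempty
  list drops by exactly one.\<close>

fun poly_deriv :: "'a list \<Rightarrow> 'a list" where
  "poly_deriv [] = []"
| "poly_deriv (c # p) = (if p = [] then [] else ([length p] \<cdot> c) # poly_deriv p)"

lemma length_poly_deriv: "length (poly_deriv p) = length p - 1"
  by (induction p) (auto simp: neq_Nil_conv)

lemma subring_add_pow:
  assumes "subring S R" "x \<in> S"
  shows "[(n :: nat)] \<cdot> x \<in> S"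
proof -
  have "x \<in> carrier R" using subringE(1)[OF assms(1)] assms(2) by blast
  then show ?thesis using assms(2) subringE(2,7)[OF assms(1)] by (induction n) auto
qed

lemma set_poly_deriv: "subring S R \<Longrightarrow> set p \<subseteq> S \<Longrightarrow> set (poly_deriv p) \<subseteq> S"
  by (induction p) (auto simp: subring_add_pow)

lemma power_taylor:
  assumes "x \<in> carrier R" "e \<in> carrier R"
  shows "\<exists>r \<in> carrier R. (x \<oplus> e) [^] (n :: nat) = x [^] n \<oplus> [n] \<cdot> \<one> \<otimes> x [^] (n - 1) \<otimes> e \<oplus> e \<otimes> e \<otimes> r"
proof (induction n)
  case 0
  show ?case using assms by (intro bexI[of _ \<zero>]) auto
next
  case (Suc n)
  then obtain r where r: "r \<in> carrier R"
    "(x \<oplus> e) [^] n = x [^] n \<oplus> [n] \<cdot> \<one> \<otimes> x [^] (n - 1) \<otimes> e \<oplus> e \<otimes> e \<otimes> r" by blast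
  define N U where "N = [n] \<cdot> \<one>" and "U = x [^] (n - 1)"
  have c: "N \<in> carrier R" "U \<in> carrier R" "x [^] n \<in> carrier R" using assms by (auto simp: N_def U_def)
  have nx: "N \<otimes> U \<otimes> x = N \<otimes> x [^] n"
  proof (cases n)
    case 0
    then show ?thesis using c assms by (simp add: N_def)
  next
    case (Suc k)
    then show ?thesis using c assms by (simp add: U_def m_assoc)
  qed
  have "(x \<oplus> e) [^] Suc n = (x [^] n \<oplus> N \<otimes> U \<otimes> e \<oplus> e \<otimes> e \<otimes> r) \<otimes> (x \<oplus> e)"
    using r by (simp add: N_def U_def)
  also have "\<dots> = x [^] n \<otimes> x \<oplus> (x [^] n \<oplus> N \<otimes> U \<otimes> x) \<otimes> e \<oplus> e \<otimes> e \<otimes> (N \<otimes> U \<oplus> r \<otimes> (x \<oplus> e))"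
    using r(1) c assms by algebra
  also have "x [^] n \<oplus> N \<otimes> U \<otimes> x = [Suc n] \<cdot> \<one> \<otimes> x [^] n"
    unfolding nx using c assms by (simp add: N_def l_distr a_comm)
  finally have e: "(x \<oplus> e) [^] Suc n =
     x [^] Suc n \<oplus> [Suc n] \<cdot> \<one> \<otimes> x [^] (Suc n - 1) \<otimes> e \<oplus> e \<otimes> e \<otimes> (N \<otimes> U \<oplus> r \<otimes> (x \<oplus> e))" by simp
  have "N \<otimes> U \<oplus> r \<otimes> (x \<oplus> e) \<in> carrier R" using c r(1) assms by simp
  with e show ?case by blast
qed

lemma eval_taylor:
  assumes "x \<in> carrier R" "e \<in> carrier R" "set p \<subseteq> carrier R"
  shows "\<exists>r \<in> carrier R. eval p (x \<oplus> e) = eval p x \<oplus> eval (poly_deriv p) x \<otimes> e \<oplus> e \<otimes> e \<otimes> r"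
  using assms(3)
proof (induction p)
  case Nil
  show ?case using assms(1,2) by (intro bexI[of _ \<zero>]) auto
next
  case (Cons c p)
  have c: "c \<in> carrier R" "set p \<subseteq> carrier R" using Cons by auto
  obtain r where r: "r \<in> carrier R"
    "eval p (x \<oplus> e) = eval p x \<oplus> eval (poly_deriv p) x \<otimes> e \<oplus> e \<otimes> e \<otimes> r"
    using Cons by auto
  show ?case
  proof (cases "p = []")
    case True
    show ?thesis using True c assms(1,2) by (intro bexI[of _ \<zero>]) auto
  next
    case False
    let ?n = "length p"
    obtain r' where r': "r' \<in> carrier R"
      "(x \<oplus> e) [^] ?n = x [^] ?n \<oplus> [?n] \<cdot> \<one> \<otimes> x [^] (?n - 1) \<otimes> e \<oplus> e \<otimes> e \<otimes> r'"
      using power_taylor[OF assms(1,2)] by blast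
    define N U V where "N = [?n] \<cdot> \<one>" and "U = x [^] (?n - 1)" and "V = x [^] ?n"
    define P P' where "P = eval p x" and "P' = eval (poly_deriv p) x"
    have cc: "N \<in> carrier R" "U \<in> carrier R" "V \<in> carrier R" "P \<in> carrier R" "P' \<in> carrier R"
      using assms c eval_in_carrier set_poly_deriv[OF carrier_is_subring c(2)]
      by (auto simp: N_def U_def V_def P_def P'_def)
    have "[?n] \<cdot> c = N \<otimes> c" unfolding N_def using add_pow_ldistr[OF one_closed c(1), of ?n] c by simp
    then have d: "eval (poly_deriv (c # p)) x = N \<otimes> c \<otimes> U \<oplus> P'"
      using False by (simp add: length_poly_deriv U_def P'_def)
    have "eval (c # p) (x \<oplus> e) = c \<otimes> (V \<oplus> N \<otimes> U \<otimes> e \<oplus> e \<otimes> e \<otimes> r') \<oplus> (P \<oplus> P' \<otimes> e \<oplus> e \<otimes> e \<otimes> r)"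
      using r r' by (simp add: N_def U_def V_def P_def P'_def)
    also have "\<dots> = (c \<otimes> V \<oplus> P) \<oplus> (N \<otimes> c \<otimes> U \<oplus> P') \<otimes> e \<oplus> e \<otimes> e \<otimes> (c \<otimes> r' \<oplus> r)"
      using cc r(1) r'(1) c(1) assms by algebra
    finally have e: "eval (c # p) (x \<oplus> e) = eval (c # p) x \<oplus> eval (poly_deriv (c # p)) x \<otimes> e \<oplus>
        e \<otimes> e \<otimes> (c \<otimes> r' \<oplus> r)" unfolding d by (simp add: V_def P_def)
    have "c \<otimes> r' \<oplus> r \<in> carrier R" using c r(1) r'(1) by simp
    with e show ?thesis by blast
  qed
qed

section \<open>Composition series given by generators, and lifting from the residue field\<close>

lemma mem_spanned_step:
  assumes "\<And>j. j \<le> i \<Longrightarrow> a j \<in> carrier R"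
  shows "x \<in> spanned R a (Suc i) \<longleftrightarrow> (\<exists>s \<in> spanned R a i. \<exists>r \<in> carrier R. x = s \<oplus> r \<otimes> a i)"
  using assms by (subst spanned_Suc) (auto simp: set_add_def' cgenideal_def)

lemma spanned_step:
  assumes a: "\<And>j. j \<le> i \<Longrightarrow> a j \<in> carrier R"
  shows "spanned R a i \<subseteq> spanned R a (Suc i)" "a i \<in> spanned R a (Suc i)"
proof -
  interpret D: ideal "spanned R a i" R by (rule spanned_ideal) (use a in simp)
  have mem: "x \<in> spanned R a (Suc i) \<longleftrightarrow> (\<exists>s \<in> spanned R a i. \<exists>r \<in> carrier R. x = s \<oplus> r \<otimes> a i)" for x
    by (rule mem_spanned_step) (rule a)
  show "spanned R a i \<subseteq> spanned R a (Suc i)"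
  proof
    fix x assume x: "x \<in> spanned R a i"
    then have "x = x \<oplus> \<zero> \<otimes> a i" using a[of i] D.a_Hcarr by simp
    then show "x \<in> spanned R a (Suc i)" unfolding mem using x zero_closed by blast
  qed
  have "a i = \<zero> \<oplus> \<one> \<otimes> a i" using a[of i] by simp
  then show "a i \<in> spanned R a (Suc i)" unfolding mem using D.zero_closed one_closed by blast
qed

lemma generator_mem_spanned:
  assumes "j < i" "\<And>k. k < i \<Longrightarrow> a k \<in> carrier R"
  shows "a j \<in> spanned R a i"
  using assms
proof (induction i)
  case (Suc i)
  have a: "a k \<in> carrier R" if "k \<le> i" for k using Suc.prems(2) that by simp
  show ?case
  proof (cases "j = i")
    case True
    then show ?thesis using spanned_step(2)[of i a] a by simp
  next
    case False
    then have "a j \<in> spanned R a i" using Suc by simp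
    then show ?thesis using spanned_step(1)[of i a] a by blast
  qed
qed simp

text \<open>A multiplicative system of representatives of the residue field. Closure under addition
  is not demanded, since Teichmueller representatives can fail it.\<close>

definition reps :: "'a set \<Rightarrow> bool" where
  "reps T \<longleftrightarrow> T \<subseteq> carrier R \<and> \<zero> \<in> T \<and> (\<forall>t \<in> T. \<forall>u \<in> T. t \<otimes> u \<in> T) \<and>
     (\<forall>x \<in> carrier R. \<exists>t \<in> T. mod_eq (nonunits R) x t) \<and>
     (\<forall>t \<in> T. \<forall>u \<in> T. mod_eq (nonunits R) t u \<longrightarrow> t = u)"

end

text \<open>A local ring with a composition series. The generators are parameters because the same
  ones, mapped by \<open>f\<close>, have to serve the second ring.\<close>

locale local_series = cring R for R (structure) +
  fixes l :: nat and a :: "nat \<Rightarrow> 'a"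
  assumes one_nz: "\<zero> \<noteq> \<one>"
    and nonunits_add: "\<And>x y. x \<in> nonunits R \<Longrightarrow> y \<in> nonunits R \<Longrightarrow> x \<oplus> y \<in> nonunits R"
    and a_closed: "\<And>i. i < l \<Longrightarrow> a i \<in> carrier R"
    and a_new: "\<And>i. i < l \<Longrightarrow> a i \<notin> spanned R a i"
    and nonunits_a: "\<And>i x. i < l \<Longrightarrow> x \<in> nonunits R \<Longrightarrow> x \<otimes> a i \<in> spanned R a i"
    and spanned_all: "carrier R \<subseteq> spanned R a l"
begin

lemma nonunits_maximal: "maximalideal (nonunits R) R"
  using local_imp[OF one_nz nonunits_add] by blast

lemma nonunits_prime: "primeideal (nonunits R) R"
  by (rule maximalideal_prime[OF nonunits_maximal])

lemma nonunits_is_ideal: "ideal (nonunits R) R"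
  using nonunits_prime by (rule primeideal.axioms(1))

lemma unit_inverse: "x \<in> carrier R \<Longrightarrow> x \<notin> nonunits R \<Longrightarrow> \<exists>u \<in> carrier R. u \<otimes> x = \<one>"
  by (auto simp: nonunits_def m_comm)

lemma one_not_nonunit: "\<one> \<notin> nonunits R"
  using one_closed by (fastforce simp: nonunits_def)

lemma spanned_is_ideal: "i \<le> l \<Longrightarrow> ideal (spanned R a i) R"
  by (rule spanned_ideal) (simp add: a_closed)

lemma mem_spanned_Suc:
  assumes "i < l"
  shows "x \<in> spanned R a (Suc i) \<longleftrightarrow> (\<exists>s \<in> spanned R a i. \<exists>r \<in> carrier R. x = s \<oplus> r \<otimes> a i)"
  by (rule mem_spanned_step) (use assms a_closed in simp)

lemma nonunit_mult_spanned:
  assumes i: "i < l" and x: "x \<in> nonunits R" and y: "y \<in> spanned R a (Suc i)"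
  shows "x \<otimes> y \<in> spanned R a i"
proof -
  interpret D: ideal "spanned R a i" R using spanned_is_ideal i by simp
  obtain s r where sr: "s \<in> spanned R a i" "r \<in> carrier R" "y = s \<oplus> r \<otimes> a i"
    using y mem_spanned_Suc[OF i] by blast
  have c: "x \<in> carrier R" "s \<in> carrier R" "a i \<in> carrier R"
    using x sr D.a_subset a_closed[OF i] by (auto simp: nonunits_def)
  have "x \<otimes> y = x \<otimes> s \<oplus> r \<otimes> (x \<otimes> a i)" unfolding sr(3) using c sr(2) by algebra
  then show ?thesis using D.a_closed D.I_l_closed sr c nonunits_a[OF i x] by simp
qed

lemma spanned_l: "spanned R a l = carrier R"
  using spanned_all ideal.Icarr[OF spanned_is_ideal[of l]] by blast

text \<open>Existence of normal forms: replacing the coefficient \<open>r\<close> of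
  \<open>a i\<close> by its representative \<open>t\<close> leaves \<open>(r - t) a\<^sub>i\<close>,
  which falls into the preceding ideal.\<close>

lemma spanned_sub_NF:
  assumes T: "reps T" and i: "i \<le> l"
  shows "spanned R a i \<subseteq> NF T a i"
  using i
proof (induction i)
  case 0
  show ?case by (simp add: spanned_0)
next
  case (Suc i)
  then have i: "i < l" by simp
  interpret D: ideal "spanned R a i" R using spanned_is_ideal i by simp
  show ?case
  proof
    fix x assume "x \<in> spanned R a (Suc i)"
    then obtain s r where sr: "s \<in> spanned R a i" "r \<in> carrier R" "x = s \<oplus> r \<otimes> a i"
      using mem_spanned_Suc[OF i] by blast
    obtain t where t: "t \<in> T" "mod_eq (nonunits R) r t" "t \<in> carrier R" using T sr(2) unfolding reps_def by blast
    have "(r \<ominus> t) \<otimes> a i \<in> spanned R a i" using nonunits_a[OF i] t(2) by (simp add: mod_eq_def)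
    then have "s \<oplus> (r \<ominus> t) \<otimes> a i \<in> NF T a i" using D.a_closed sr(1) Suc.IH i by auto
    moreover have "x = (s \<oplus> (r \<ominus> t) \<otimes> a i) \<oplus> t \<otimes> a i"
      unfolding sr(3) using sr(2) t(3) a_closed[OF i] D.a_Hcarr[OF sr(1)] by algebra
    ultimately show "x \<in> NF T a (Suc i)" using t(1) by auto
  qed
qed

lemma NF_sub_spanned:
  assumes T: "T \<subseteq> carrier R" and i: "i \<le> l"
  shows "NF T a i \<subseteq> spanned R a i"
  using i
proof (induction i)
  case 0
  show ?case by (simp add: spanned_0)
next
  case (Suc i)
  then have i: "i < l" by simp
  show ?case
  proof
    fix x assume "x \<in> NF T a (Suc i)"
    then obtain n t where "n \<in> NF T a i" "t \<in> T" "x = n \<oplus> t \<otimes> a i" by auto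
    then show "x \<in> spanned R a (Suc i)" unfolding mem_spanned_Suc[OF i] using Suc.IH i T by auto
  qed
qed

lemma nonunit_power_spanned:
  assumes "x \<in> nonunits R" "k \<le> l"
  shows "x [^] k \<in> spanned R a (l - k)"
  using assms(2)
proof (induction k)
  case 0
  show ?case using spanned_l by simp
next
  case (Suc k)
  have "l - k = Suc (l - Suc k)" using Suc.prems by simp
  moreover have "x \<in> carrier R" using assms(1) by (simp add: nonunits_def)
  ultimately show ?case
    using nonunit_mult_spanned[OF _ assms(1), of "l - Suc k" "x [^] k"] Suc by (simp add: m_comm)
qed

lemma nonunit_nilpotent: "x \<in> nonunits R \<Longrightarrow> x [^] l = \<zero>"
  using nonunit_power_spanned[of x l] by (simp add: spanned_0)

text \<open>The origin of the exponent \<open>p^l\<close>: each \<open>p\<close>-th power moves the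
  difference one step down the composition series. If \<open>U = V + d\<close>, then
  \<open>U^p - V^p\<close> consists of \<open>d^p\<close> and of \<open>p\<close> times multiples of
  \<open>d\<close>, so a nonunit multiplies an element of the current ideal. After \<open>l\<close>
  steps the difference is zero.\<close>

lemma power_char_eq:
  assumes p: "prime (p :: nat)" "[p] \<cdot> \<one> \<in> nonunits R"
    and x: "x \<in> carrier R" and y: "y \<in> carrier R" and xy: "mod_eq (nonunits R) x y"
  shows "x [^] (p ^ l) = y [^] (p ^ l)"
proof -
  interpret m: ideal "nonunits R" R by (rule nonunits_is_ideal)
  \<comment> \<open>For \<open>k = 0\<close> the ideal of the series is the whole ring, so
    membership in the maximal ideal is carried along separately; it is what lets \<open>d^p\<close>,
    as \<open>d\<close> times a power of \<open>d\<close>, descend.\<close>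
  have "x [^] (p ^ k) \<ominus> y [^] (p ^ k) \<in> spanned R a (l - k) \<inter> nonunits R" if "k \<le> l" for k
    using that
  proof (induction k)
    case 0
    then show ?case using xy x y by (simp add: spanned_l mod_eq_def)
  next
    case (Suc k)
    define i where "i = l - Suc k"
    have i: "i < l" "l - k = Suc i" using Suc.prems by (auto simp: i_def)
    interpret D: ideal "spanned R a i" R using spanned_is_ideal i by simp
    interpret D': ideal "spanned R a (Suc i)" R using spanned_is_ideal i by simp
    define U V d where "U = x [^] (p ^ k)" and "V = y [^] (p ^ k)" and "d = U \<ominus> V"
    have c: "U \<in> carrier R" "V \<in> carrier R" "d \<in> carrier R" using x y by (auto simp: U_def V_def d_def)
    have d: "d \<in> spanned R a (Suc i)" "d \<in> nonunits R" using Suc i(2) by (auto simp: d_def U_def V_def)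
    have dp: "d [^] (Suc k) \<in> spanned R a (Suc i)" for k
      using D'.I_l_closed[OF d(1)] c(3) by simp
    obtain p' where p': "p = Suc (Suc p')" using prime_ge_2_nat[OF p(1)] le_Suc_ex[of 2 p] by auto
    have "[p] \<cdot> \<one> \<otimes> (V [^] j \<otimes> d [^] (p ^ 1 - j)) \<in> spanned R a i" if "0 < j" "j < p ^ 1" for j
    proof -
      have "p ^ 1 - j \<noteq> 0" using \<open>j < p ^ 1\<close> by simp
      then obtain k where "p ^ 1 - j = Suc k" using not0_implies_Suc by blast
      then have "V [^] j \<otimes> d [^] (p ^ 1 - j) \<in> spanned R a (Suc i)"
        using D'.I_l_closed[OF dp] c(2) by simp
      then show ?thesis by (rule nonunit_mult_spanned[OF i(1) p(2)])
    qed
    from binomial_defect[OF p(1) c(2,3) D.is_additive_subgroup, of 1, OF this]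
    have b: "(V \<oplus> d) [^] p \<ominus> (V [^] p \<oplus> d [^] p) \<in> spanned R a i" by simp
    have Vd: "V \<oplus> d = U" unfolding d_def using c by algebra
    have "d [^] p = d \<otimes> d [^] Suc p'" unfolding p' using c by (simp add: m_ac)
    then have "d [^] p \<in> spanned R a i" using nonunit_mult_spanned[OF i(1) d(2) dp] by simp
    then have "((V \<oplus> d) [^] p \<ominus> (V [^] p \<oplus> d [^] p)) \<oplus> d [^] p \<in> spanned R a i" using b D.a_closed by blast
    moreover have "((V \<oplus> d) [^] p \<ominus> (V [^] p \<oplus> d [^] p)) \<oplus> d [^] p = U [^] p \<ominus> V [^] p"
      unfolding Vd using nat_pow_closed[OF c(1), of p] nat_pow_closed[OF c(2), of p] nat_pow_closed[OF c(3), of p]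
      by algebra
    ultimately have 1: "U [^] p \<ominus> V [^] p \<in> spanned R a i" by simp
    have "mod_eq (nonunits R) (U [^] p) (V [^] p)"
      by (rule mod_eq_pow[OF nonunits_is_ideal]) (use d(2) c in \<open>auto simp: mod_eq_def d_def\<close>)
    then have 2: "U [^] p \<ominus> V [^] p \<in> nonunits R" by (simp add: mod_eq_def)
    have "x [^] (p ^ Suc k) = U [^] p" "y [^] (p ^ Suc k) = V [^] p"
      using x y by (simp_all add: U_def V_def nat_pow_pow mult.commute)
    then show ?case using 1 2 by (simp add: i_def)
  qed
  from this[of l] have "x [^] (p ^ l) \<ominus> y [^] (p ^ l) = \<zero>" by (simp add: spanned_0)
  then show ?thesis using x y r_right_minus_eq by simp
qed

text \<open>Newton iteration. The error is a nonunit in the current ideal of the series, and each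
  correction moves it to the next lower one, so \<open>l\<close> steps give an exact root.\<close>

lemma hensel:
  assumes p: "set p \<subseteq> carrier R" and x: "x \<in> carrier R"
    and root: "eval p x \<in> nonunits R" and simple: "eval (poly_deriv p) x \<notin> nonunits R"
  shows "\<exists>y \<in> carrier R. mod_eq (nonunits R) y x \<and> eval p y = \<zero>"
proof -
  interpret m: ideal "nonunits R" R by (rule nonunits_is_ideal)
  have dp: "set (poly_deriv p) \<subseteq> carrier R" by (rule set_poly_deriv[OF carrier_is_subring p])
  have refl: "list_all2 (mod_eq (nonunits R)) q q" if "set q \<subseteq> carrier R" for q
    using that mod_eq_refl[OF nonunits_is_ideal] by (auto simp: list_all2_same)
  have "\<exists>y \<in> carrier R. mod_eq (nonunits R) y x \<and> eval p y \<in> spanned R a (l - k) \<inter> nonunits R"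
    if "k \<le> l" for k
    using that
  proof (induction k)
    case 0
    show ?case
      using mod_eq_refl[OF nonunits_is_ideal x] x root eval_in_carrier[OF p x] spanned_l
      by (intro bexI[of _ x]) auto
  next
    case (Suc k)
    define i where "i = l - Suc k"
    have i: "i < l" "l - k = Suc i" using Suc.prems by (auto simp: i_def)
    interpret D': ideal "spanned R a (Suc i)" R using spanned_is_ideal i by simp
    obtain y where y: "y \<in> carrier R" "mod_eq (nonunits R) y x" "eval p y \<in> spanned R a (Suc i)"
      "eval p y \<in> nonunits R" using Suc i(2) by auto
    have c: "eval (poly_deriv p) y \<in> carrier R" "eval (poly_deriv p) x \<in> carrier R" "eval p y \<in> carrier R"
      using eval_in_carrier dp p x y by auto
    have "mod_eq (nonunits R) (eval (poly_deriv p) y) (eval (poly_deriv p) x)"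
      by (rule mod_eq_eval[OF nonunits_is_ideal refl[OF dp] dp dp y(2,1) x])
    then have "eval (poly_deriv p) y \<notin> nonunits R"
      using mod_eq_mem[OF nonunits_is_ideal _ c(1,2)] simple by blast
    then obtain u where u: "u \<in> carrier R" "u \<otimes> eval (poly_deriv p) y = \<one>" using unit_inverse c(1) by blast
    \<comment> \<open>The Newton correction: \<open>u\<close> inverts the derivative at
      \<open>y\<close>, so the linear term cancels and only a multiple of \<open>e\<close> squared
      remains.\<close>
    define e where "e = \<ominus> u \<otimes> eval p y"
    have e: "e \<in> carrier R" "e \<in> spanned R a (Suc i)" "e \<in> nonunits R"
      using u c D'.I_l_closed[OF y(3), of "\<ominus> u"] m.I_l_closed[OF y(4), of "\<ominus> u"] by (auto simp: e_def)
    obtain r where r: "r \<in> carrier R"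
      "eval p (y \<oplus> e) = eval p y \<oplus> eval (poly_deriv p) y \<otimes> e \<oplus> e \<otimes> e \<otimes> r"
      using eval_taylor[OF y(1) e(1) p] by blast
    have "eval (poly_deriv p) y \<otimes> e = \<ominus> ((u \<otimes> eval (poly_deriv p) y) \<otimes> eval p y)"
      unfolding e_def using u(1) c by algebra
    then have "eval (poly_deriv p) y \<otimes> e = \<ominus> (eval p y)" using u(2) c by simp
    then have ee: "eval p (y \<oplus> e) = e \<otimes> (e \<otimes> r)"
      using r c e by (simp add: r_neg m_assoc)
    have "e \<otimes> r \<in> spanned R a (Suc i)" using D'.I_r_closed e r by blast
    then have "eval p (y \<oplus> e) \<in> spanned R a i" using nonunit_mult_spanned[OF i(1) e(3)] ee by simp
    moreover have "eval p (y \<oplus> e) \<in> nonunits R" unfolding ee using m.I_r_closed e r by simp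
    moreover have "mod_eq (nonunits R) (y \<oplus> e) y"
    proof -
      have "y \<oplus> e \<ominus> y = e" using y e by algebra
      then show ?thesis using e by (simp add: mod_eq_def)
    qed
    then have "mod_eq (nonunits R) (y \<oplus> e) x"
      using mod_eq_trans[OF nonunits_is_ideal _ y(2)] y(1) e(1) x by blast
    ultimately show ?case using y(1) e(1) by (intro bexI[of _ "y \<oplus> e"]) (auto simp: i_def)
  qed
  from this[of l] show ?thesis by (auto simp: spanned_0)
qed

text \<open>A subring \<open>T\<close> maximal among those that meet the maximal ideal only in zero
  represents every residue class. A class transcendental over \<open>T\<close> would allow adjoining
  an element; for an algebraic one, characteristic 0 makes the minimal polynomial separable, Hensel
  gives an exact root, and adjoining that root is allowed. Starting from \<open>T0\<close> makes it
  possible to extend the image of a coefficient ring later.\<close>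

lemma coefficient_ring_exists:
  assumes char: "\<And>n :: nat. n > 0 \<Longrightarrow> [n] \<cdot> \<one> \<notin> nonunits R"
    and T0: "subring T0 R" "T0 \<inter> nonunits R \<subseteq> {\<zero>}"
  shows "\<exists>T. subring T R \<and> T0 \<subseteq> T \<and> reps T"
proof -
  interpret m: primeideal "nonunits R" R by (rule nonunits_prime)
  let ?A = "{T. subring T R \<and> T0 \<subseteq> T \<and> T \<inter> nonunits R \<subseteq> {\<zero>}}"
  have "\<exists>T \<in> ?A. \<forall>U \<in> ?A. T \<subseteq> U \<longrightarrow> U = T"
  proof (rule subset_Zorn_nonempty)
    show "?A \<noteq> {}" using T0 by blast
    fix C assume C: "C \<noteq> {}" "subset.chain ?A C"
    have CA: "T \<in> ?A" if "T \<in> C" for T using C(2) that by (auto simp: subset.chain_def)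
    have tot: "T \<subseteq> U \<or> U \<subseteq> T" if "T \<in> C" "U \<in> C" for T U
      using C(2) that unfolding subset_chain_def by blast
    obtain T1 where T1: "T1 \<in> C" using C(1) by blast
    have "subring (\<Union>C) R"
    proof (rule subringI)
      show "\<Union>C \<subseteq> carrier R" using CA subringE(1)[of _ R] by blast
      show "\<one> \<in> \<Union>C" using T1 CA[OF T1] subringE(3)[of T1 R] by blast
      show "\<ominus> x \<in> \<Union>C" if x: "x \<in> \<Union>C" for x
      proof -
        obtain T where "T \<in> C" "x \<in> T" using x by blast
        then show ?thesis using subringE(5)[of T R x] CA by blast
      qed
      have "x \<oplus> y \<in> \<Union>C \<and> x \<otimes> y \<in> \<Union>C" if xy: "x \<in> \<Union>C" "y \<in> \<Union>C" for x y
      proof -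
        obtain T U where TU: "T \<in> C" "U \<in> C" "x \<in> T" "y \<in> U" using xy by blast
        then obtain V where V: "V \<in> C" "x \<in> V" "y \<in> V" using tot[OF TU(1,2)] by blast
        have "subring V R" using CA[OF V(1)] by blast
        from subringE(6,7)[OF this V(2,3)] show ?thesis using V(1) by blast
      qed
      then show "x \<oplus> y \<in> \<Union>C" "x \<otimes> y \<in> \<Union>C" if "x \<in> \<Union>C" "y \<in> \<Union>C" for x y using that by auto
    qed
    then show "\<Union>C \<in> ?A" using CA T1 by blast
  qed
  then obtain T where T: "subring T R" "T0 \<subseteq> T" "T \<inter> nonunits R \<subseteq> {\<zero>}"
    and max: "\<And>U. subring U R \<Longrightarrow> T \<subseteq> U \<Longrightarrow> U \<inter> nonunits R \<subseteq> {\<zero>} \<Longrightarrow> U = T" by auto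
  note cl = subringE[OF T(1)]
  have hdT: "hd q \<in> T" if "q \<noteq> []" "set q \<subseteq> T" for q using that by (cases q) auto
  have ev: "eval q y \<in> carrier R" if "set q \<subseteq> T" "y \<in> carrier R" for q y
    using eval_in_carrier[of q y] that cl(1) by blast
  have null: "eval q y = \<zero>" if "set q \<subseteq> T" "set q \<subseteq> nonunits R" "y \<in> carrier R" for q y
  proof -
    have "set q \<subseteq> {\<zero>}" using that T(3) by blast
    from eval_in_ideal[OF zeroideal this that(3)] show ?thesis by simp
  qed
  \<comment> \<open>The maximality of \<open>T\<close> in usable form: \<open>y\<close> can be
    adjoined if its polynomial values over \<open>T\<close> are nonunits only when they
    vanish.\<close>
  have in_T: "y \<in> T" if y: "y \<in> carrier R"
    and z: "\<And>q. set q \<subseteq> T \<Longrightarrow> eval q y \<in> nonunits R \<Longrightarrow> eval q y = \<zero>" for y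
  proof -
    have "adjoin T y \<inter> nonunits R \<subseteq> {\<zero>}" using z by (auto simp: adjoin_def)
    then have "adjoin T y = T" using max adjoin_props[OF T(1) y] by blast
    then show ?thesis using adjoin_props(3)[OF T(1) y] by simp
  qed
  have "\<exists>t \<in> T. mod_eq (nonunits R) x t" if x: "x \<in> carrier R" for x
  proof -
    let ?P = "\<lambda>q. set q \<subseteq> T \<and> q \<noteq> [] \<and> hd q \<notin> nonunits R \<and> eval q x \<in> nonunits R"
    have suffix: "set q \<subseteq> nonunits R"
      if q: "set q \<subseteq> T" "eval q x \<in> nonunits R" and n: "\<And>q'. ?P q' \<Longrightarrow> length q < length q'" for q
    proof (rule ccontr)
      assume "\<not> ?thesis"
      moreover have "set q \<subseteq> carrier R" using q(1) cl(1) by blast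
      ultimately obtain q' where "q' \<noteq> []" "set q' \<subseteq> set q" "length q' \<le> length q"
        "hd q' \<notin> nonunits R" "eval q' x \<in> nonunits R"
        using eval_ideal_suffix[OF m.is_ideal _ x q(2)] by blast
      then show False using n[of q'] q(1) by auto
    qed
    show ?thesis
    proof (cases "\<exists>q. ?P q")
      case False
      have "x \<in> T"
        by (rule in_T[OF x], rule null[OF _ suffix x]) (use False in blast)+
      then show ?thesis using mod_eq_refl[OF m.is_ideal x] by blast
    next
      case True
      then obtain g where g: "?P g" "\<And>q. ?P q \<Longrightarrow> length g \<le> length q"
        using ex_has_least_nat[of ?P _ length] by blast
      obtain r g' where gr: "g = r # g'" using g(1) by (cases g) auto
      have r: "r \<in> T" "r \<in> carrier R" "r \<notin> nonunits R" using g(1) gr cl(1) by auto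
      have gc: "set g \<subseteq> carrier R" using g(1) cl(1) by blast
      have "g' \<noteq> []"
      proof
        assume "g' = []"
        then have "eval g x = r" using gr r x by simp
        then show False using g(1) r by simp
      qed
      \<comment> \<open>Separability: in residue characteristic 0 the head of the derivative is a
        unit, and the derivative is shorter than \<open>g\<close>, so by minimality it does not
        vanish at \<open>x\<close> modulo the maximal ideal.\<close>
      have dg: "poly_deriv g = ([length g'] \<cdot> r) # poly_deriv g'" using gr \<open>g' \<noteq> []\<close> by simp
      have "[length g'] \<cdot> r = [length g'] \<cdot> \<one> \<otimes> r"
        using add_pow_ldistr[OF one_closed r(2), of "length g'"] r by simp
      then have "[length g'] \<cdot> r \<notin> nonunits R"
        using m.I_prime[of "[length g'] \<cdot> \<one>" r] char[of "length g'"] r \<open>g' \<noteq> []\<close> by auto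
      moreover have "set (poly_deriv g) \<subseteq> T" using set_poly_deriv[OF T(1)] g(1) by blast
      moreover have "length (poly_deriv g) < length g" using length_poly_deriv[of g] gr by simp
      ultimately have "eval (poly_deriv g) x \<notin> nonunits R" using g(2)[of "poly_deriv g"] dg by auto
      then obtain y where y: "y \<in> carrier R" "mod_eq (nonunits R) y x" "eval g y = \<zero>"
        using hensel[OF gc x] g(1) by blast
      \<comment> \<open>As \<open>g\<close> vanishes at \<open>y\<close>, \<open>r^k\<close> times
        the value of \<open>q\<close> is the value of the remainder \<open>b\<close>. The latter is
        a nonunit at \<open>x\<close> too, so by minimality the coefficients of \<open>b\<close> are
        nonunits in \<open>T\<close>, that is, zero. Finally \<open>r\<close> is a unit.\<close>
      have "eval q y = \<zero>" if q: "set q \<subseteq> T" "eval q y \<in> nonunits R" for q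
      proof -
        obtain k a' b where ab: "set a' \<subseteq> T" "set b \<subseteq> T" "length b \<le> length g'"
          "r [^] (k::nat) \<otimes> eval q y = eval a' y \<otimes> eval g y \<oplus> eval b y"
          using pseudo_division[OF T(1) _ q(1), of r g'] g(1) y(1) unfolding gr by blast
        have bv: "eval b y = r [^] k \<otimes> eval q y" using ab(4) y(3) ev[OF ab(1) y(1)] ev[OF ab(2) y(1)] by simp
        then have "eval b y \<in> nonunits R" using m.I_l_closed[OF q(2)] r by simp
        moreover have bc: "set b \<subseteq> carrier R" using ab(2) cl(1) by blast
        moreover have "list_all2 (mod_eq (nonunits R)) b b"
          using bc mod_eq_refl[OF m.is_ideal] by (auto simp: list_all2_same)
        ultimately have "eval b x \<in> nonunits R"
          using mod_eq_mem[OF m.is_ideal mod_eq_eval[OF m.is_ideal _ bc bc y(2,1) x]] ev[OF ab(2)] x y(1)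
          by blast
        moreover have "length b < length q'" if "?P q'" for q' using g(2)[OF that] ab(3) gr by simp
        ultimately have "eval b y = \<zero>" using null[OF ab(2) suffix[OF ab(2)] y(1)] by blast
        then have "r [^] k \<otimes> eval q y = \<zero>" using bv by simp
        moreover have "r [^] k \<notin> nonunits R" using prime_pow[OF nonunits_prime r(2)] r(3) by blast
        then obtain u where u: "u \<in> carrier R" "u \<otimes> r [^] k = \<one>" using unit_inverse r(2) by blast
        moreover have "u \<otimes> (r [^] k \<otimes> eval q y) = (u \<otimes> r [^] k) \<otimes> eval q y"
          using u(1) r ev[OF q(1) y(1)] by (simp add: m_assoc[symmetric])
        ultimately show ?thesis using ev[OF q(1) y(1)] by simp
      qed
      then have "y \<in> T" by (rule in_T[OF y(1)])
      then show ?thesis using mod_eq_sym[OF m.is_ideal y(2,1) x] by blast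
    qed
  qed
  moreover have "t = u" if "t \<in> T" "u \<in> T" "mod_eq (nonunits R) t u" for t u
  proof -
    have "t \<ominus> u \<in> T" using that cl(5,7) by (simp add: minus_eq)
    then have "t \<ominus> u = \<zero>" using that(3) T(3) by (auto simp: mod_eq_def)
    then show ?thesis using that cl(1) r_right_minus_eq by blast
  qed
  ultimately have "reps T" using cl(1,2,6) unfolding reps_def by simp
  then show ?thesis using T by blast
qed

end

section \<open>Countable subrings, and transport along homomorphisms\<close>

context cring begin

lemma countable_subring_exists:
  assumes "countable K" "K \<subseteq> carrier R"
  obtains E where "subring E R" "K \<subseteq> E" "countable E"
proof -
  define F where "F A = A \<union> {\<one>} \<union> (\<lambda>x. \<ominus> x) ` A \<union> (\<lambda>(x, y). x \<oplus> y) ` (A \<times> A) \<union>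
    (\<lambda>(x, y). x \<otimes> y) ` (A \<times> A)" for A
  define H where "H n = (F ^^ n) K" for n
  have H0: "H 0 = K" and HS: "H (Suc n) = F (H n)" for n by (simp_all add: H_def)
  have sub: "H n \<subseteq> carrier R" for n
    by (induction n) (use assms in \<open>auto simp: H0 HS F_def\<close>)
  have count: "countable (H n)" for n
    by (induction n) (use assms in \<open>auto simp: H0 HS F_def\<close>)
  have "H n \<subseteq> H (Suc n)" for n unfolding HS F_def by blast
  then have mono: "H m \<subseteq> H n" if "m \<le> n" for m n using lift_Suc_mono_le that by metis
  have "subring (\<Union>n. H n) R"
  proof (rule subringI)
    show "(\<Union>n. H n) \<subseteq> carrier R" using sub by blast
    have "\<one> \<in> H (Suc 0)" by (simp add: HS F_def)
    then show "\<one> \<in> (\<Union>n. H n)" by blast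
    show "\<ominus> x \<in> (\<Union>n. H n)" if x: "x \<in> (\<Union>n. H n)" for x
    proof -
      obtain n where "x \<in> H n" using x by blast
      then have "\<ominus> x \<in> H (Suc n)" by (simp add: HS F_def)
      then show ?thesis by blast
    qed
    have "x \<oplus> y \<in> (\<Union>n. H n) \<and> x \<otimes> y \<in> (\<Union>n. H n)"
      if xy: "x \<in> (\<Union>n. H n)" "y \<in> (\<Union>n. H n)" for x y
    proof -
      obtain m n where mn: "x \<in> H m" "y \<in> H n" using xy by blast
      then have "x \<in> H (max m n)" "y \<in> H (max m n)"
        using mono[of m "max m n"] mono[of n "max m n"] by auto
      then have "x \<oplus> y \<in> H (Suc (max m n))" "x \<otimes> y \<in> H (Suc (max m n))"
        unfolding HS F_def by (auto simp: image_iff)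
      then show ?thesis by blast
    qed
    then show "x \<oplus> y \<in> (\<Union>n. H n)" "x \<otimes> y \<in> (\<Union>n. H n)"
      if "x \<in> (\<Union>n. H n)" "y \<in> (\<Union>n. H n)" for x y
      using that by auto
  qed
  moreover have "countable (\<Union>n. H n)" using count by simp
  moreover have "K \<subseteq> (\<Union>n. H n)" using H0 by blast
  ultimately show ?thesis using that by blast
qed

text \<open>\<open>B\<close> may be uncountable. A countable subring of \<open>B\<close> around
  \<open>K\<close> is taken and saturated by \<open>Q1 \<inter> Q2\<close>; saturation does not
  disturb the agreement of the two ideals.\<close>

lemma residue_graph_exists:
  assumes Q1: "ideal Q1 R" and Q2: "ideal Q2 R" and B: "subring B R" "\<And>s. s \<in> B \<Longrightarrow> s \<in> Q1 \<longleftrightarrow> s \<in> Q2"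
    and K: "countable K" "K \<subseteq> B"
  shows "\<exists>S. residue_graph Q1 Q2 S \<and> K \<subseteq> S"
proof -
  let ?J = "Q1 \<inter> Q2"
  interpret Q1: ideal Q1 R by fact
  interpret Q2: ideal Q2 R by fact
  have J: "ideal ?J R" by (rule i_intersect[OF Q1 Q2])
  interpret J: ideal ?J R by (rule J)
  have Bc: "B \<subseteq> carrier R" using subringE(1)[OF B(1)] .
  have Kc: "K \<subseteq> carrier R" using K(2) Bc by blast
  obtain E' where E': "subring E' R" "K \<subseteq> E'" "countable E'"
    using countable_subring_exists[OF K(1) Kc] by blast
  \<comment> \<open>The countable subring generated around \<open>K\<close> need not be known to
    stay in \<open>B\<close>; the intersection does.\<close>
  define E where "E = E' \<inter> B"
  have E: "subring E R" "K \<subseteq> E" "countable E"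
    using subring_inter[OF E'(1) B(1)] E' K(2) by (auto simp: E_def)
  note cl = subringE[OF E(1)]
  let ?S = "{z \<in> carrier R. \<exists>e \<in> E. mod_eq ?J z e}"
  have ec: "e \<in> carrier R" if "e \<in> E" for e using cl(1) that by blast
  have s1: "subring ?S R"
  proof (rule subringI)
    have "\<one> \<in> carrier R" "\<exists>e \<in> E. mod_eq ?J \<one> e"
      using cl(3) mod_eq_refl[OF J one_closed] by auto
    then show "\<one> \<in> ?S" by blast
    show "\<ominus> x \<in> ?S" if x: "x \<in> ?S" for x
    proof -
      obtain e where "e \<in> E" "mod_eq ?J x e" "x \<in> carrier R" using x by blast
      then have "mod_eq ?J (\<ominus> x) (\<ominus> e)" "\<ominus> e \<in> E" "\<ominus> x \<in> carrier R"
        using mod_eq_minus[OF J] ec cl(5) by auto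
      then show ?thesis by blast
    qed
    have "x \<oplus> y \<in> ?S \<and> x \<otimes> y \<in> ?S" if xy: "x \<in> ?S" "y \<in> ?S" for x y
    proof -
      obtain d e where de: "d \<in> E" "mod_eq ?J x d" "x \<in> carrier R" "e \<in> E" "mod_eq ?J y e" "y \<in> carrier R"
        using xy by blast
      have "mod_eq ?J (x \<oplus> y) (d \<oplus> e)" "mod_eq ?J (x \<otimes> y) (d \<otimes> e)"
        using mod_eq_add[OF J] mod_eq_mult[OF J] de ec by auto
      moreover have "d \<oplus> e \<in> E" "d \<otimes> e \<in> E" using cl(6,7) de by auto
      ultimately show ?thesis using de by blast
    qed
    then show "x \<oplus> y \<in> ?S" "x \<otimes> y \<in> ?S" if "x \<in> ?S" "y \<in> ?S" for x y using that by auto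
  qed auto
  have s2: "?J \<subseteq> ?S"
  proof
    fix z assume z: "z \<in> ?J"
    then have "z \<in> carrier R" by auto
    moreover then have "mod_eq ?J z \<zero>" using z by (simp add: mod_eq_def minus_eq)
    ultimately show "z \<in> ?S" using cl(2) by blast
  qed
  have s3: "s \<in> Q1 \<longleftrightarrow> s \<in> Q2" if s: "s \<in> ?S" for s
  proof -
    obtain e where e: "e \<in> E" "mod_eq ?J s e" "s \<in> carrier R" using s by blast
    then have "mod_eq Q1 s e" "mod_eq Q2 s e" by (auto simp: mod_eq_def)
    then have "s \<in> Q1 \<longleftrightarrow> e \<in> Q1" "s \<in> Q2 \<longleftrightarrow> e \<in> Q2"
      using mod_eq_mem[OF Q1 _ e(3) ec[OF e(1)]] mod_eq_mem[OF Q2 _ e(3) ec[OF e(1)]] by blast+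
    moreover have "e \<in> B" using e(1) by (simp add: E_def)
    ultimately show ?thesis using B(2) by blast
  qed
  have s4: "countable_mod ?J ?S" unfolding countable_mod_def by (rule exI[of _ E]) (use E(3) cl(1) in auto)
  have s5: "K \<subseteq> ?S"
  proof
    fix k assume "k \<in> K"
    then have k: "k \<in> E" "k \<in> carrier R" using E(2) ec by auto
    have "mod_eq ?J k k" by (rule mod_eq_refl[OF J k(2)])
    then have "\<exists>e \<in> E. mod_eq ?J k e" using k(1) by (rule bexI)
    then show "k \<in> ?S" using k(2) by simp
  qed
  show ?thesis
    unfolding residue_graph_def by (intro exI[of _ ?S] conjI ballI s1 s2 s3 s4 s5)
qed

end

context ring_hom_cring
begin

lemma eval_hom_list:
  assumes "x \<in> carrier R" "set p \<subseteq> carrier R"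
  shows "h (R.eval p x) = S.eval (map h p) (h x)"
proof -
  have "ring_hom_ring R S h"
    using R.ring_axioms S.ring_axioms homh by (simp add: ring_hom_ringI2)
  then show ?thesis by (rule ring_hom_ring.eval_hom'[OF _ assms])
qed

lemma hom_minus: "x \<in> carrier R \<Longrightarrow> y \<in> carrier R \<Longrightarrow> h (x \<ominus> y) = h x \<ominus>\<^bsub>S\<^esub> h y"
  by (simp add: R.minus_eq S.minus_eq)

lemma hom_power: "x \<in> carrier R \<Longrightarrow> h (x [^] (n :: nat)) = h x [^]\<^bsub>S\<^esub> n"
  by (induction n) auto

lemma hom_add_pow: "x \<in> carrier R \<Longrightarrow> h ([(n :: nat)] \<cdot> x) = [n] \<cdot>\<^bsub>S\<^esub> h x"
  by (induction n) auto

lemma vimage_primeideal: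
  assumes "primeideal Q S"
  shows "primeideal {x \<in> carrier R. h x \<in> Q} R"
proof -
  interpret Q: primeideal Q S by fact
  show ?thesis
  proof (rule primeidealI)
    show "ideal {x \<in> carrier R. h x \<in> Q} R"
    proof (rule idealI)
      show "ring R" by (rule R.ring_axioms)
      show "subgroup {x \<in> carrier R. h x \<in> Q} (add_monoid R)"
      proof (rule R.add.subgroupI)
        have "\<zero> \<in> {x \<in> carrier R. h x \<in> Q}" by simp
        then show "{x \<in> carrier R. h x \<in> Q} \<noteq> {}" by blast
      qed auto
    qed (auto simp: Q.I_l_closed Q.I_r_closed)
    show "cring R" by (rule R.cring_axioms)
    have "\<one> \<notin> {x \<in> carrier R. h x \<in> Q}" using Q.one_imp_carrier Q.I_notcarr by auto
    then show "carrier R \<noteq> {x \<in> carrier R. h x \<in> Q}" using R.one_closed by metis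
    show "a \<in> {x \<in> carrier R. h x \<in> Q} \<or> b \<in> {x \<in> carrier R. h x \<in> Q}"
      if "a \<in> carrier R" "b \<in> carrier R" "a \<otimes> b \<in> {x \<in> carrier R. h x \<in> Q}" for a b
      using that Q.I_prime[of "h a" "h b"] by auto
  qed
qed

lemma vimage_mod_eq:
  assumes "x \<in> carrier R" "y \<in> carrier R"
  shows "R.mod_eq {x \<in> carrier R. h x \<in> Q} x y \<longleftrightarrow> S.mod_eq Q (h x) (h y)"
  using assms by (simp add: R.mod_eq_def S.mod_eq_def hom_minus)

lemma vimage_uncountable_acf_mod:
  assumes Q: "S.uncountable_acf_mod Q" and surj: "h ` carrier R = carrier S"
  shows "R.uncountable_acf_mod {x \<in> carrier R. h x \<in> Q}"
  unfolding R.uncountable_acf_mod_def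
proof (intro conjI allI impI)
  let ?Q = "{x \<in> carrier R. h x \<in> Q}"
  show "primeideal ?Q R" using Q by (simp add: S.uncountable_acf_mod_def vimage_primeideal)
  show "\<not> R.countable_mod ?Q (carrier R)"
  proof
    assume "R.countable_mod ?Q (carrier R)"
    then obtain C where C: "countable C" "C \<subseteq> carrier R" "\<And>x. x \<in> carrier R \<Longrightarrow> \<exists>c \<in> C. R.mod_eq ?Q x c"
      by (auto simp: R.countable_mod_def)
    have "\<exists>c \<in> h ` C. S.mod_eq Q y c" if y: "y \<in> carrier S" for y
    proof -
      obtain x where x: "x \<in> carrier R" "y = h x" using y surj by blast
      obtain c where c: "c \<in> C" "R.mod_eq ?Q x c" using C(3)[OF x(1)] by blast
      then have "S.mod_eq Q (h x) (h c)" using vimage_mod_eq[OF x(1), of c] C(2) by blast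
      then show ?thesis using c(1) x(2) by blast
    qed
    moreover have "countable (h ` C)" "h ` C \<subseteq> carrier S" using C by auto
    ultimately have "S.countable_mod Q (carrier S)" unfolding S.countable_mod_def by (intro exI[of _ "h ` C"]) simp
    then show False using Q by (simp add: S.uncountable_acf_mod_def)
  qed
  fix p assume p: "set p \<subseteq> carrier R \<and> length p \<ge> 2 \<and> hd p \<notin> ?Q"
  then have "p \<noteq> []" by auto
  then have "hd p \<in> carrier R" "hd (map h p) = h (hd p)" using p by (auto simp: hd_map)
  then have "hd (map h p) \<notin> Q" using p by auto
  moreover have "set (map h p) \<subseteq> carrier S" using p by auto
  ultimately obtain y where y: "y \<in> carrier S" "S.eval (map h p) y \<in> Q"
  proof -
    have "2 \<le> length (map h p)" using p by simp
    with \<open>hd (map h p) \<notin> Q\<close> \<open>set (map h p) \<subseteq> carrier S\<close> that show ?thesis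
      using Q unfolding S.uncountable_acf_mod_def by blast
  qed
  then obtain x where "x \<in> carrier R" "y = h x" using surj by blast
  then show "\<exists>x \<in> carrier R. R.eval p x \<in> ?Q"
    using y p eval_hom_list[of x p] R.eval_in_carrier[of p x] by auto
qed

lemma hom_NF:
  "x \<in> R.NF T a i \<Longrightarrow> T \<subseteq> carrier R \<Longrightarrow> (\<And>j. j < i \<Longrightarrow> a j \<in> carrier R) \<Longrightarrow>
    h x \<in> S.NF (h ` T) (\<lambda>j. h (a j)) i"
proof (induction i arbitrary: x)
  case (Suc i)
  then obtain n t where nt: "n \<in> R.NF T a i" "t \<in> T" "x = n \<oplus> t \<otimes> a i" by auto
  have "h n \<in> S.NF (h ` T) (\<lambda>j. h (a j)) i" using Suc.IH[OF nt(1)] Suc.prems by simp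
  moreover have "n \<in> carrier R" using R.NF_closed[of T i a] Suc.prems nt(1) by fastforce
  moreover have "t \<in> carrier R" "a i \<in> carrier R" using Suc.prems nt by auto
  ultimately show ?case using nt by auto
qed simp

end

section \<open>Algebraically closed residue fields and Teichmueller representatives\<close>

locale residually_closed = local_series +
  assumes residue_roots: "\<And>r. set r \<subseteq> carrier R \<Longrightarrow> r \<noteq> [] \<Longrightarrow> \<exists>x \<in> carrier R. eval (\<one> # r) x \<in> nonunits R"
    and residue_uncountable: "\<not> countable_mod (nonunits R) (carrier R)"
begin

lemma nonunits_uncountable_acf_mod: "uncountable_acf_mod (nonunits R)"
  unfolding uncountable_acf_mod_def
proof (intro conjI allI impI)
  interpret m: primeideal "nonunits R" R by (rule nonunits_prime)
  fix p assume p: "set p \<subseteq> carrier R \<and> length p \<ge> 2 \<and> hd p \<notin> nonunits R"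
  then obtain c p' where pc: "p = c # p'" "p' \<noteq> []" by (cases p; cases "tl p") auto
  have c: "c \<in> carrier R" "c \<notin> nonunits R" using p pc by auto
  then obtain u where u: "u \<in> carrier R" "u \<otimes> c = \<one>" using unit_inverse by blast
  have "set (map ((\<otimes>) u) p') \<subseteq> carrier R" using p pc u by auto
  then obtain x where x: "x \<in> carrier R" "eval (\<one> # map ((\<otimes>) u) p') x \<in> nonunits R"
    using residue_roots pc(2) by blast
  have "\<one> # map ((\<otimes>) u) p' = map ((\<otimes>) u) p" using u(2) pc by simp
  then have "u \<otimes> eval p x \<in> nonunits R" using x eval_map_mult[of p u x] p u by simp
  moreover have "u \<notin> nonunits R"
  proof
    assume "u \<in> nonunits R"
    then have "u \<otimes> c \<in> nonunits R" using m.I_r_closed c by blast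
    then show False using u one_not_nonunit by simp
  qed
  moreover have "eval p x \<in> carrier R" using eval_in_carrier p x by blast
  ultimately show "\<exists>y \<in> carrier R. eval p y \<in> nonunits R" using m.I_prime[of u] u x(1) by blast
qed (use nonunits_prime residue_uncountable in auto)

lemma residue_root:
  assumes "r \<in> carrier R" "(q :: nat) \<ge> 1"
  shows "\<exists>x \<in> carrier R. mod_eq (nonunits R) (x [^] q) r"
proof -
  \<comment> \<open>The coefficients below the leading 1 of the polynomial
    \<open>x^q - r\<close>.\<close>
  let ?r = "replicate (q - 1) \<zero> @ [\<ominus> r]"
  have "set ?r \<subseteq> carrier R" using assms by auto
  then obtain x where x: "x \<in> carrier R" "eval (\<one> # ?r) x \<in> nonunits R"
    using residue_roots[of ?r] by blast
  have "eval ?r x = \<ominus> r" using eval_replicate[of "[\<ominus> r]" x "q - 1"] assms x by simp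
  then have "eval (\<one> # ?r) x = x [^] q \<ominus> r" using assms x by (simp add: minus_eq)
  then show ?thesis using x by (auto simp: mod_eq_def)
qed

text \<open>By \<open>power_char_eq\<close> the power \<open>x^(p^l)\<close> depends only on the
  residue class of \<open>x\<close>, and on the algebraically closed residue field the map is
  bijective. So every class contains exactly one \<open>p^l\<close>-th power.\<close>

lemma teichmuller_reps:
  assumes p: "prime (p :: nat)" "[p] \<cdot> \<one> \<in> nonunits R"
  shows "reps ((\<lambda>x. x [^] (p ^ l)) ` carrier R)" (is "reps ?T")
proof -
  have q: "p ^ l \<ge> 1" using prime_gt_0_nat[OF p(1)] by simp
  have F: "frobenius_additive (nonunits R) p"
    by (rule frobenius_additive_prime[OF p(1) nonunits_is_ideal p(2)])
  have "p ^ l \<noteq> 0" using q by linarith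
  then obtain k where "p ^ l = Suc k" using not0_implies_Suc by blast
  then have "\<zero> [^] (p ^ l) = \<zero>" by simp
  then have 1: "\<zero> \<in> ?T" by (metis image_eqI zero_closed)
  have 2: "t \<otimes> u \<in> ?T" if "t \<in> ?T" "u \<in> ?T" for t u
    using that by (auto simp: nat_pow_distrib[symmetric])
  have 3: "\<exists>t \<in> ?T. mod_eq (nonunits R) x t" if "x \<in> carrier R" for x
    using residue_root[OF that q] mod_eq_sym[OF nonunits_is_ideal] that by blast
  have 4: "t = u" if tu: "t \<in> ?T" "u \<in> ?T" "mod_eq (nonunits R) t u" for t u
  proof -
    obtain x y where xy: "x \<in> carrier R" "y \<in> carrier R" "t = x [^] (p ^ l)" "u = y [^] (p ^ l)"
      using tu by blast
    have d: "x \<ominus> y \<in> carrier R" using xy by simp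
    have "(x \<ominus> y) \<oplus> y = x" using xy by algebra
    then have "mod_eq (nonunits R) (x [^] (p ^ l)) ((x \<ominus> y) [^] (p ^ l) \<oplus> y [^] (p ^ l))"
      using frobenius_additive_power[OF nonunits_is_ideal F d xy(2), of l] by simp
    then have "mod_eq (nonunits R) ((x \<ominus> y) [^] (p ^ l) \<oplus> y [^] (p ^ l)) (x [^] (p ^ l))"
      using mod_eq_sym[OF nonunits_is_ideal] xy d by simp
    then have "mod_eq (nonunits R) ((x \<ominus> y) [^] (p ^ l) \<oplus> y [^] (p ^ l)) (y [^] (p ^ l))"
      using mod_eq_trans[OF nonunits_is_ideal _ tu(3)] xy d by simp
    then have "(x \<ominus> y) [^] (p ^ l) \<in> nonunits R"
      using nat_pow_closed[OF d, of "p ^ l"] nat_pow_closed[OF xy(2), of "p ^ l"]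
      by (simp add: mod_eq_def minus_eq a_assoc r_neg)
    then have "mod_eq (nonunits R) x y" using prime_pow[OF nonunits_prime d] by (simp add: mod_eq_def)
    then show ?thesis using power_char_eq[OF p xy(1,2)] xy by simp
  qed
  show ?thesis unfolding reps_def using 1 2 3 4 by auto
qed

end

section \<open>Partial isomorphisms of two rings\<close>

lemma RDirProd_simps:
  "carrier (RDirProd R S) = carrier R \<times> carrier S"
  "\<zero>\<^bsub>RDirProd R S\<^esub> = (\<zero>\<^bsub>R\<^esub>, \<zero>\<^bsub>S\<^esub>)" "\<one>\<^bsub>RDirProd R S\<^esub> = (\<one>\<^bsub>R\<^esub>, \<one>\<^bsub>S\<^esub>)"
  "z \<oplus>\<^bsub>RDirProd R S\<^esub> w = (fst z \<oplus>\<^bsub>R\<^esub> fst w, snd z \<oplus>\<^bsub>S\<^esub> snd w)"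
  "z \<otimes>\<^bsub>RDirProd R S\<^esub> w = (fst z \<otimes>\<^bsub>R\<^esub> fst w, snd z \<otimes>\<^bsub>S\<^esub> snd w)"
  by (cases z; cases w; simp add: RDirProd_def DirProd_def monoid.defs)+

lemma RDirProd_cring:
  assumes "cring R" "cring S"
  shows "cring (RDirProd R S)"
proof -
  interpret R: cring R by fact
  interpret S: cring S by fact
  interpret P: ring "RDirProd R S" by (rule RDirProd_ring[OF R.ring_axioms S.ring_axioms])
  show ?thesis
    by unfold_locales (auto simp: RDirProd_simps R.m_comm S.m_comm)
qed

lemma fst_hom: "fst \<in> ring_hom (RDirProd R S) R"
  by (auto simp: ring_hom_def RDirProd_simps)

lemma snd_hom: "snd \<in> ring_hom (RDirProd R S) S"
  by (auto simp: ring_hom_def RDirProd_simps)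

text \<open>Uniqueness of normal forms in the shape needed here: dividing a vanishing expression by
  the unit \<open>t\<close> would put \<open>a i\<close> into the ideal of its predecessors.\<close>

lemma (in local_series) unit_step_nonzero:
  assumes i: "i < l" and n: "n \<in> spanned R a i" and t: "t \<in> carrier R" "t \<notin> nonunits R"
  shows "n \<oplus> t \<otimes> a i \<noteq> \<zero>"
proof
  assume e: "n \<oplus> t \<otimes> a i = \<zero>"
  interpret D: ideal "spanned R a i" R using spanned_is_ideal i by simp
  obtain u where u: "u \<in> carrier R" "u \<otimes> t = \<one>" using unit_inverse t by blast
  have c: "n \<in> carrier R" "t \<in> carrier R" "a i \<in> carrier R" using D.a_subset n t a_closed[OF i] by auto
  have "a i = (u \<otimes> t) \<otimes> a i" using u c by simp
  also have "\<dots> = u \<otimes> (n \<oplus> t \<otimes> a i) \<ominus> u \<otimes> n" using u(1) c by algebra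
  also have "\<dots> = \<ominus> (u \<otimes> n)" using e u c by (simp add: minus_eq)
  also have "\<dots> \<in> spanned R a i" using D.a_inv_closed D.I_l_closed[OF n u(1)] by blast
  finally show False using a_new[OF i] by simp
qed

text \<open>A subring of the product in which the components vanish only together is the graph of an
  isomorphism between subrings of \<open>M\<close> and \<open>N\<close>.\<close>

definition back_and_forth_system ::
  "('a, 'm) ring_scheme \<Rightarrow> ('b, 'n) ring_scheme \<Rightarrow> ('a \<times> 'b) set set \<Rightarrow> bool" where
  "back_and_forth_system M N \<G> \<longleftrightarrow> (\<forall>G \<in> \<G>. subring G (RDirProd M N) \<and>
     (\<forall>z \<in> G. fst z = \<zero>\<^bsub>M\<^esub> \<longleftrightarrow> snd z = \<zero>\<^bsub>N\<^esub>) \<and>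
     (\<forall>x \<in> carrier M. \<exists>G' \<in> \<G>. G \<subseteq> G' \<and> (\<exists>z \<in> G'. fst z = x)) \<and>
     (\<forall>y \<in> carrier N. \<exists>G' \<in> \<G>. G \<subseteq> G' \<and> (\<exists>z \<in> G'. snd z = y)))"

locale ring_pair =
  M: residually_closed M l a + N: residually_closed N l "\<lambda>i. f (a i)" +
  f: ring_hom_cring M N f for M (structure) and N (structure) and l a f
begin

definition P where "P = RDirProd M N"
definition Q1 where "Q1 = {z \<in> carrier P. fst z \<in> nonunits M}"
definition Q2 where "Q2 = {z \<in> carrier P. snd z \<in> nonunits N}"
definition emb where "emb x = (x, f x)"

sublocale P: cring P
  unfolding P_def by (rule RDirProd_cring) unfold_locales

sublocale fst: ring_hom_cring P M fst
  by unfold_locales (simp add: P_def fst_hom)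

sublocale snd: ring_hom_cring P N snd
  by unfold_locales (simp add: P_def snd_hom)

lemma P_simps:
  "carrier P = carrier M \<times> carrier N" "\<zero>\<^bsub>P\<^esub> = (\<zero>, \<zero>\<^bsub>N\<^esub>)" "\<one>\<^bsub>P\<^esub> = (\<one>, \<one>\<^bsub>N\<^esub>)"
  "z \<oplus>\<^bsub>P\<^esub> w = (fst z \<oplus> fst w, snd z \<oplus>\<^bsub>N\<^esub> snd w)"
  "z \<otimes>\<^bsub>P\<^esub> w = (fst z \<otimes> fst w, snd z \<otimes>\<^bsub>N\<^esub> snd w)"
  by (simp_all add: P_def RDirProd_simps)

sublocale emb: ring_hom_cring M P emb
proof unfold_locales
  show "emb \<in> ring_hom M P"
    by (auto simp: ring_hom_def P_simps emb_def)
qed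

lemma Q1_closed: "P.uncountable_acf_mod Q1"
  unfolding Q1_def
  by (rule fst.vimage_uncountable_acf_mod[OF M.nonunits_uncountable_acf_mod])
    (use N.zero_closed in \<open>auto simp: P_simps\<close>)

lemma Q2_closed: "P.uncountable_acf_mod Q2"
  unfolding Q2_def
  by (rule snd.vimage_uncountable_acf_mod[OF N.nonunits_uncountable_acf_mod])
    (use M.zero_closed in \<open>auto simp: P_simps\<close>)

lemma Q1_prime: "primeideal Q1 P" using Q1_closed by (simp add: P.uncountable_acf_mod_def)
lemma Q2_prime: "primeideal Q2 P" using Q2_closed by (simp add: P.uncountable_acf_mod_def)
lemma Q1_ideal: "ideal Q1 P" by (rule primeideal.axioms(1)[OF Q1_prime])
lemma Q2_ideal: "ideal Q2 P" by (rule primeideal.axioms(1)[OF Q2_prime])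
lemma J_ideal: "ideal (Q1 \<inter> Q2) P" by (rule P.i_intersect[OF Q1_ideal Q2_ideal])

lemma mod_Q1: "z \<in> carrier P \<Longrightarrow> w \<in> carrier P \<Longrightarrow> P.mod_eq Q1 z w \<longleftrightarrow> M.mod_eq (nonunits M) (fst z) (fst w)"
  unfolding Q1_def by (rule fst.vimage_mod_eq)

lemma mod_Q2: "z \<in> carrier P \<Longrightarrow> w \<in> carrier P \<Longrightarrow> P.mod_eq Q2 z w \<longleftrightarrow> N.mod_eq (nonunits N) (snd z) (snd w)"
  unfolding Q2_def by (rule snd.vimage_mod_eq)

lemma chinese_remainder:
  assumes "x \<in> carrier P" "y \<in> carrier P"
  shows "\<exists>z \<in> carrier P. P.mod_eq Q1 z x \<and> P.mod_eq Q2 z y"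
proof -
  have z: "(fst x, snd y) \<in> carrier P" using assms by (auto simp: P_simps)
  have "P.mod_eq Q1 (fst x, snd y) x" "P.mod_eq Q2 (fst x, snd y) y"
    unfolding mod_Q1[OF z assms(1)] mod_Q2[OF z assms(2)]
    using assms M.mod_eq_refl[OF M.nonunits_is_ideal] N.mod_eq_refl[OF N.nonunits_is_ideal]
    by (auto simp: P_simps)
  then show ?thesis using z by blast
qed

text \<open>Units go to units, and nonunits of \<open>M\<close> are nilpotent, hence so are their
  images. So \<open>f\<close> induces a map of residue fields.\<close>

lemma f_nonunits: "x \<in> carrier M \<Longrightarrow> f x \<in> nonunits N \<longleftrightarrow> x \<in> nonunits M"
proof
  assume x: "x \<in> carrier M"
  show "x \<in> nonunits M" if fx: "f x \<in> nonunits N"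
  proof (rule ccontr)
    assume "x \<notin> nonunits M"
    then obtain u where u: "u \<in> carrier M" "u \<otimes> x = \<one>" using M.unit_inverse[OF x] by blast
    then have "f u \<otimes>\<^bsub>N\<^esub> f x = \<one>\<^bsub>N\<^esub>" using x by (metis f.hom_mult f.hom_one)
    moreover have "f u \<otimes>\<^bsub>N\<^esub> f x \<in> nonunits N" using N.mult_nonunit[OF fx] u by simp
    ultimately show False using N.one_not_nonunit by simp
  qed
  show "f x \<in> nonunits N" if "x \<in> nonunits M"
  proof -
    have "f x [^]\<^bsub>N\<^esub> l = \<zero>\<^bsub>N\<^esub>" using M.nonunit_nilpotent[OF that] f.hom_power[OF x, of l] by simp
    moreover have "\<zero>\<^bsub>N\<^esub> \<in> nonunits N"
      using additive_subgroup.zero_closed[OF ideal.axioms(1)[OF N.nonunits_is_ideal]] .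
    ultimately show ?thesis using N.prime_pow[OF N.nonunits_prime, of "f x" l] x by simp
  qed
qed

end

section \<open>Normal forms over pairs of representatives\<close>

locale ring_embedding = ring_pair +
  fixes TM TN \<pi> p
  assumes TM: "M.reps TM" and TN: "N.reps TN" and f_reps: "f ` TM \<subseteq> TN"
    and \<pi>: "\<pi> \<in> nonunits M" and p: "(p :: nat) \<ge> 1"
begin

definition reps_in where "reps_in S = {z \<in> S. fst z \<in> TM \<and> snd z \<in> TN}"

lemma reps_closed: "t \<in> TM \<Longrightarrow> t \<in> carrier M" "u \<in> TN \<Longrightarrow> u \<in> carrier N"
  using TM TN by (auto simp: M.reps_def N.reps_def)

lemma reps_zero: "\<zero> \<in> TM" "\<zero>\<^bsub>N\<^esub> \<in> TN"
  using TM TN by (auto simp: M.reps_def N.reps_def)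

lemma reps_nonunit_zero:
  "t \<in> TM \<Longrightarrow> t \<in> nonunits M \<Longrightarrow> t = \<zero>" "u \<in> TN \<Longrightarrow> u \<in> nonunits N \<Longrightarrow> u = \<zero>\<^bsub>N\<^esub>"
proof -
  assume t: "t \<in> TM" "t \<in> nonunits M"
  then have "M.mod_eq (nonunits M) t \<zero>" using reps_closed by (simp add: M.mod_eq_def M.minus_eq)
  then show "t = \<zero>" using TM t reps_zero by (auto simp: M.reps_def)
next
  assume t: "u \<in> TN" "u \<in> nonunits N"
  then have "N.mod_eq (nonunits N) u \<zero>\<^bsub>N\<^esub>" using reps_closed by (simp add: N.mod_eq_def N.minus_eq)
  then show "u = \<zero>\<^bsub>N\<^esub>" using TN t reps_zero by (auto simp: N.reps_def)
qed

lemma emb_closed: "i < l \<Longrightarrow> emb (a i) \<in> carrier P"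
  using M.a_closed by simp

text \<open>Look at the top coefficient. If one component is a nonunit, so is the other, and both
  are zero by uniqueness of representatives; the level drops. Otherwise both are units and
  \<open>unit_step_nonzero\<close> applies on each side.\<close>

lemma NF_zero_iff:
  assumes S: "subring S P" "\<And>s. s \<in> S \<Longrightarrow> s \<in> Q1 \<longleftrightarrow> s \<in> Q2"
    and "i \<le> l" "z \<in> P.NF (reps_in S) (\<lambda>i. emb (a i)) i"
  shows "fst z = \<zero> \<longleftrightarrow> snd z = \<zero>\<^bsub>N\<^esub>"
  using assms(3,4)
proof (induction i arbitrary: z)
  case 0
  then show ?case by (simp add: P_simps)
next
  case (Suc i)
  have rP: "reps_in S \<subseteq> carrier P" using subringE(1)[OF S(1)] by (auto simp: reps_in_def)
  obtain n t where nt: "n \<in> P.NF (reps_in S) (\<lambda>i. emb (a i)) i" "t \<in> reps_in S" "z = n \<oplus>\<^bsub>P\<^esub> t \<otimes>\<^bsub>P\<^esub> emb (a i)"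
    using Suc.prems by auto
  have i: "i < l" using Suc.prems by simp
  have tS: "t \<in> S" "fst t \<in> TM" "snd t \<in> TN" "t \<in> carrier P" using nt(2) rP by (auto simp: reps_in_def)
  have tt: "fst t \<in> nonunits M \<longleftrightarrow> snd t \<in> nonunits N"
    using S(2)[OF tS(1)] tS(4) by (auto simp: Q1_def Q2_def)
  have nc: "n \<in> carrier P" using P.NF_closed[OF rP, of i "\<lambda>i. emb (a i)"] emb_closed nt(1) i by auto
  show ?case
  proof (cases "fst t \<in> nonunits M")
    case True
    then have "t = \<zero>\<^bsub>P\<^esub>" using tt tS reps_nonunit_zero by (simp add: P_simps prod_eq_iff)
    then have "z = n" using nt(3) nc emb_closed[OF i] by simp
    then show ?thesis using Suc.IH[OF _ nt(1)] i by simp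
  next
    case False
    have "fst n \<in> M.NF (fst ` reps_in S) (\<lambda>i. fst (emb (a i))) i"
      "snd n \<in> N.NF (snd ` reps_in S) (\<lambda>i. snd (emb (a i))) i"
      by (rule fst.hom_NF[OF nt(1) rP] snd.hom_NF[OF nt(1) rP], use emb_closed i in simp)+
    then have "fst n \<in> M.NF (fst ` reps_in S) a i" "snd n \<in> N.NF (snd ` reps_in S) (\<lambda>i. f (a i)) i"
      by (simp_all add: emb_def)
    moreover have "fst ` reps_in S \<subseteq> carrier M" "snd ` reps_in S \<subseteq> carrier N" using rP by (auto simp: P_simps)
    ultimately have n: "fst n \<in> spanned M a i" "snd n \<in> spanned N (\<lambda>i. f (a i)) i"
      using M.NF_sub_spanned[of "fst ` reps_in S" i] N.NF_sub_spanned[of "snd ` reps_in S" i] i by auto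
    have "fst z \<noteq> \<zero>" "snd z \<noteq> \<zero>\<^bsub>N\<^esub>"
      using M.unit_step_nonzero[OF i n(1), of "fst t"] N.unit_step_nonzero[OF i n(2), of "snd t"] False tt tS nt(3)
      by (auto simp: P_simps emb_def)
    then show ?thesis by simp
  qed
qed

text \<open>The pair of representatives of the components of \<open>w\<close> differs from
  \<open>w\<close> by an element of \<open>Q1 \<inter> Q2\<close>, and \<open>S\<close> contains
  that ideal.\<close>

lemma reps_approx:
  assumes "P.residue_graph Q1 Q2 S" "w \<in> S"
  shows "\<exists>z \<in> reps_in S. P.mod_eq Q1 z w \<and> P.mod_eq Q2 z w"
proof -
  have S: "subring S P" "Q1 \<inter> Q2 \<subseteq> S" using assms(1) by (auto simp: P.residue_graph_def)
  have w: "w \<in> carrier P" using assms(2) subringE(1)[OF S(1)] by blast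
  obtain t where t: "t \<in> TM" "M.mod_eq (nonunits M) (fst w) t" using TM fst.hom_closed[OF w] unfolding M.reps_def by blast
  obtain u where u: "u \<in> TN" "N.mod_eq (nonunits N) (snd w) u" using TN snd.hom_closed[OF w] unfolding N.reps_def by blast
  have z: "(t, u) \<in> carrier P" using t u reps_closed by (simp add: P_simps)
  have m: "P.mod_eq Q1 w (t, u)" "P.mod_eq Q2 w (t, u)" using mod_Q1 mod_Q2 w z t u by auto
  then have m': "P.mod_eq Q1 (t, u) w" "P.mod_eq Q2 (t, u) w"
    using P.mod_eq_sym[OF Q1_ideal] P.mod_eq_sym[OF Q2_ideal] w z by auto
  then have "(t, u) \<ominus>\<^bsub>P\<^esub> w \<in> S" using S(2) by (auto simp: P.mod_eq_def)
  then have "((t, u) \<ominus>\<^bsub>P\<^esub> w) \<oplus>\<^bsub>P\<^esub> w \<in> S" using subringE(7)[OF S(1)] assms(2) by blast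
  moreover have "((t, u) \<ominus>\<^bsub>P\<^esub> w) \<oplus>\<^bsub>P\<^esub> w = (t, u)" using w z by (simp add: P.minus_eq P.a_assoc P.l_neg)
  ultimately have "(t, u) \<in> reps_in S" using t u by (simp add: reps_in_def)
  then show ?thesis using m' by blast
qed

text \<open>A normal form involves finitely many representatives, so countably many suffice for all
  of \<open>Y\<close>. A graph \<open>S\<close> that contains their images then expresses all of
  \<open>Y\<close> over \<open>reps_in S\<close>.\<close>

lemma NF_constants:
  assumes Y: "countable Y" "\<And>x i. (x, i) \<in> Y \<Longrightarrow> i \<le> l \<and> x \<in> spanned M a i"
  obtains C where "countable C" "C \<subseteq> TM"
    "\<And>x i. (x, i) \<in> Y \<Longrightarrow> emb x \<in> P.NF (emb ` C) (\<lambda>i. emb (a i)) i"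
proof -
  have "\<forall>y \<in> Y. \<exists>F. finite F \<and> F \<subseteq> TM \<and> fst y \<in> M.NF F a (snd y)"
  proof
    fix y assume y: "y \<in> Y"
    have "snd y \<le> l" "fst y \<in> spanned M a (snd y)" using Y(2)[of "fst y" "snd y"] y by auto
    then have "fst y \<in> M.NF TM a (snd y)" using M.spanned_sub_NF[OF TM] by blast
    then show "\<exists>F. finite F \<and> F \<subseteq> TM \<and> fst y \<in> M.NF F a (snd y)" by (rule M.NF_finite_support)
  qed
  from bchoice[OF this] obtain F where F: "\<forall>y \<in> Y. finite (F y) \<and> F y \<subseteq> TM \<and> fst y \<in> M.NF (F y) a (snd y)" ..
  let ?C = "\<Union>y \<in> Y. F y"
  have C: "?C \<subseteq> TM" using F by blast
  have "emb x \<in> P.NF (emb ` ?C) (\<lambda>i. emb (a i)) i" if xi: "(x, i) \<in> Y" for x i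
  proof (rule emb.hom_NF)
    have "x \<in> M.NF (F (x, i)) a i" using F xi by force
    then show "x \<in> M.NF ?C a i" using M.NF_mono[of "F (x, i)" ?C a i] xi by blast
    show "?C \<subseteq> carrier M" using C reps_closed by blast
    show "a j \<in> carrier M" if "j < i" for j using M.a_closed Y(2)[OF xi] that by simp
  qed
  moreover have "countable ?C" using Y(1) F by (intro countable_UN) (auto intro: countable_finite)
  ultimately show ?thesis using that C by blast
qed

lemma reps_in_props:
  assumes "subring S P"
  shows "reps_in S \<subseteq> carrier P" "\<zero>\<^bsub>P\<^esub> \<in> reps_in S" "\<And>t u. t \<in> reps_in S \<Longrightarrow> u \<in> reps_in S \<Longrightarrow> t \<otimes>\<^bsub>P\<^esub> u \<in> reps_in S"
proof -
  show "reps_in S \<subseteq> carrier P" using subringE(1)[OF assms] by (auto simp: reps_in_def)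
  show "\<zero>\<^bsub>P\<^esub> \<in> reps_in S" using subringE(2)[OF assms] reps_zero by (auto simp: reps_in_def P_simps)
  show "t \<otimes>\<^bsub>P\<^esub> u \<in> reps_in S" if "t \<in> reps_in S" "u \<in> reps_in S" for t u
    using subringE(6)[OF assms] that TM TN
    by (auto simp: reps_in_def P_simps(5) M.reps_def N.reps_def)
qed

text \<open>The graph is enlarged once per coefficient of the normal form. Stated for a general
  \<open>h\<close> so that both projections are instances.\<close>

lemma lift_NF:
  assumes h: "ring_hom_cring P R h"
    and step: "\<And>S t. P.perfect_graph Q1 Q2 p S \<Longrightarrow> t \<in> T \<Longrightarrow>
      \<exists>S' w. P.perfect_graph Q1 Q2 p S' \<and> S \<subseteq> S' \<and> w \<in> reps_in S' \<and> h w = t"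
    and S: "P.perfect_graph Q1 Q2 p S" and i: "i \<le> l" and x: "x \<in> cring.NF R T (\<lambda>i. h (emb (a i))) i"
  shows "\<exists>S' z. P.perfect_graph Q1 Q2 p S' \<and> S \<subseteq> S' \<and> z \<in> P.NF (reps_in S') (\<lambda>i. emb (a i)) i \<and> h z = x"
  using i x
proof (induction i arbitrary: x)
  interpret h: ring_hom_cring P R h by fact
  case 0
  then have "x = h \<zero>\<^bsub>P\<^esub>" by simp
  then show ?case using S by (intro exI[of _ S] exI[of _ "\<zero>\<^bsub>P\<^esub>"]) simp
next
  interpret h: ring_hom_cring P R h by fact
  case (Suc i)
  then obtain n t where nt: "n \<in> h.S.NF T (\<lambda>i. h (emb (a i))) i" "t \<in> T"
    "x = n \<oplus>\<^bsub>R\<^esub> t \<otimes>\<^bsub>R\<^esub> h (emb (a i))" by auto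
  have i: "i < l" using Suc.prems by simp
  obtain S1 z1 where S1: "P.perfect_graph Q1 Q2 p S1" "S \<subseteq> S1" "z1 \<in> P.NF (reps_in S1) (\<lambda>i. emb (a i)) i" "h z1 = n"
    using Suc.IH[OF _ nt(1)] i by auto
  obtain S2 w where S2: "P.perfect_graph Q1 Q2 p S2" "S1 \<subseteq> S2" "w \<in> reps_in S2" "h w = t"
    using step[OF S1(1) nt(2)] by blast
  have "reps_in S1 \<subseteq> reps_in S2" using S2(2) by (auto simp: reps_in_def)
  then have z1: "z1 \<in> P.NF (reps_in S2) (\<lambda>i. emb (a i)) i" using P.NF_mono S1(3) by blast
  have r: "reps_in S2 \<subseteq> carrier P" using S2(1) reps_in_props by (simp add: P.perfect_graph_def P.residue_graph_def)
  have c: "z1 \<in> carrier P" "w \<in> carrier P"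
    using P.NF_closed[OF r, of i "\<lambda>i. emb (a i)"] emb_closed z1 i S2(3) r by auto
  have "z1 \<oplus>\<^bsub>P\<^esub> w \<otimes>\<^bsub>P\<^esub> emb (a i) \<in> P.NF (reps_in S2) (\<lambda>i. emb (a i)) (Suc i)"
    unfolding P.NF.simps using z1 S2(3) by blast
  moreover have "h (z1 \<oplus>\<^bsub>P\<^esub> w \<otimes>\<^bsub>P\<^esub> emb (a i)) = x"
    using c emb_closed[OF i] nt(3) S1(4) S2(4) by simp
  moreover have "S \<subseteq> S2" using S1(2) S2(2) by blast
  ultimately show ?case using S2(1) by blast
qed

lemma perfect_graph_swap: "P.perfect_graph Q1 Q2 p S \<longleftrightarrow> P.perfect_graph Q2 Q1 p S"
  unfolding P.perfect_graph_def P.residue_graph_def by (auto simp: Int_commute)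

lemma lift_rep_fst:
  assumes F: "P.frobenius_additive (Q1 \<inter> Q2) p" and S: "P.perfect_graph Q1 Q2 p S" and t: "t \<in> TM"
  shows "\<exists>S' w. P.perfect_graph Q1 Q2 p S' \<and> S \<subseteq> S' \<and> w \<in> reps_in S' \<and> fst w = t"
proof -
  \<comment> \<open>The second component is a dummy: only the class modulo \<open>Q1\<close> is
    prescribed. Afterwards \<open>reps_approx\<close> and uniqueness of representatives turn
    congruence to \<open>t\<close> into equality.\<close>
  have c: "(t, \<zero>\<^bsub>N\<^esub>) \<in> carrier P" using reps_closed(1)[OF t] by (simp add: P_simps)
  obtain S' w where S': "P.perfect_graph Q1 Q2 p S'" "S \<subseteq> S'" "w \<in> S'" "P.mod_eq Q1 w (t, \<zero>\<^bsub>N\<^esub>)"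
    using P.perfect_graph_extend[OF Q1_prime Q2_closed p F S c chinese_remainder] by blast
  have pg: "P.residue_graph Q1 Q2 S'" using S'(1) by (simp add: P.perfect_graph_def)
  obtain z where z: "z \<in> reps_in S'" "P.mod_eq Q1 z w" using reps_approx[OF pg S'(3)] by blast
  have "reps_in S' \<subseteq> carrier P" "S' \<subseteq> carrier P"
    using pg reps_in_props subringE(1) unfolding P.residue_graph_def by blast+
  then have zw: "z \<in> carrier P" "w \<in> carrier P" using z(1) S'(3) by auto
  have "P.mod_eq Q1 z (t, \<zero>\<^bsub>N\<^esub>)" by (rule P.mod_eq_trans[OF Q1_ideal z(2) S'(4) zw c])
  then have "M.mod_eq (nonunits M) (fst z) t" using mod_Q1[OF zw(1) c] by simp
  then have "fst z = t" using TM t z(1) by (auto simp: M.reps_def reps_in_def)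
  then show ?thesis using S' z(1) by blast
qed

lemma lift_rep_snd:
  assumes F: "P.frobenius_additive (Q1 \<inter> Q2) p" and S: "P.perfect_graph Q1 Q2 p S" and u: "u \<in> TN"
  shows "\<exists>S' w. P.perfect_graph Q1 Q2 p S' \<and> S \<subseteq> S' \<and> w \<in> reps_in S' \<and> snd w = u"
proof -
  have c: "(\<zero>, u) \<in> carrier P" using reps_closed(2)[OF u] by (simp add: P_simps)
  have F': "P.frobenius_additive (Q2 \<inter> Q1) p" using F by (simp add: Int_commute)
  have crt: "\<exists>z \<in> carrier P. P.mod_eq Q2 z x \<and> P.mod_eq Q1 z y" if "x \<in> carrier P" "y \<in> carrier P" for x y
    using chinese_remainder[OF that(2,1)] by blast
  obtain S' w where "P.perfect_graph Q2 Q1 p S'" and S': "S \<subseteq> S'" "w \<in> S'" "P.mod_eq Q2 w (\<zero>, u)"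
    using P.perfect_graph_extend[OF Q2_prime Q1_closed p F' S[unfolded perfect_graph_swap] c crt] by blast
  then have g: "P.perfect_graph Q1 Q2 p S'" by (simp add: perfect_graph_swap)
  then have pg: "P.residue_graph Q1 Q2 S'" by (simp add: P.perfect_graph_def)
  obtain z where z: "z \<in> reps_in S'" "P.mod_eq Q2 z w" using reps_approx[OF pg S'(2)] by blast
  have "reps_in S' \<subseteq> carrier P" "S' \<subseteq> carrier P"
    using pg reps_in_props subringE(1) unfolding P.residue_graph_def by blast+
  then have zw: "z \<in> carrier P" "w \<in> carrier P" using z(1) S'(2) by auto
  have "P.mod_eq Q2 z (\<zero>, u)" by (rule P.mod_eq_trans[OF Q2_ideal z(2) S'(3) zw c])
  then have "N.mod_eq (nonunits N) (snd z) u" using mod_Q2[OF zw(1) c] by simp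
  then have "snd z = u" using TN u z(1) by (auto simp: N.reps_def reps_in_def)
  then show ?thesis using S' g z(1) by blast
qed

lemma perfect_graph_containing:
  assumes F: "P.frobenius_additive (Q1 \<inter> Q2) p" and K: "countable K" "K \<subseteq> carrier M"
  shows "\<exists>S. P.perfect_graph Q1 Q2 p S \<and> emb ` K \<subseteq> S"
proof -
  let ?n = "nonunits N"
  note id = N.nonunits_is_ideal
  \<comment> \<open>The full graph, usually uncountable, of the map of residue fields induced by
    \<open>f\<close>.\<close>
  let ?B = "{z \<in> carrier P. N.mod_eq ?n (snd z) (f (fst z))}"
  have "subring ?B P"
  proof (rule P.subringI)
    show "\<one>\<^bsub>P\<^esub> \<in> ?B" using N.mod_eq_refl[OF id] by (simp add: P_simps)
    show "\<ominus>\<^bsub>P\<^esub> z \<in> ?B" if "z \<in> ?B" for z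
      using that N.mod_eq_minus[OF id, of "snd z" "f (fst z)"] by simp
    show "z \<oplus>\<^bsub>P\<^esub> w \<in> ?B" if "z \<in> ?B" "w \<in> ?B" for z w
      using that N.mod_eq_add[OF id, of "snd z" "f (fst z)" "snd w" "f (fst w)"] by simp
    show "z \<otimes>\<^bsub>P\<^esub> w \<in> ?B" if "z \<in> ?B" "w \<in> ?B" for z w
      using that N.mod_eq_mult[OF id, of "snd z" "f (fst z)" "snd w" "f (fst w)"] by simp
  qed auto
  moreover have "z \<in> Q1 \<longleftrightarrow> z \<in> Q2" if "z \<in> ?B" for z
  proof -
    have z: "z \<in> carrier P" "N.mod_eq ?n (snd z) (f (fst z))" using that by auto
    have "snd z \<in> ?n \<longleftrightarrow> f (fst z) \<in> ?n" using N.mod_eq_mem[OF id z(2)] z(1) by simp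
    then show ?thesis using f_nonunits[of "fst z"] z(1) by (auto simp: Q1_def Q2_def)
  qed
  moreover have "emb ` K \<subseteq> ?B"
  proof
    fix z assume "z \<in> emb ` K"
    then obtain x where x: "x \<in> carrier M" "z = emb x" using K(2) by blast
    then have "z \<in> carrier P" by simp
    moreover have "N.mod_eq ?n (snd z) (f (fst z))" using x N.mod_eq_refl[OF id] by (simp add: emb_def)
    ultimately show "z \<in> ?B" by blast
  qed
  ultimately obtain S where S: "P.residue_graph Q1 Q2 S" "emb ` K \<subseteq> S"
    using P.residue_graph_exists[OF Q1_ideal Q2_ideal, of ?B "emb ` K"] K(1) by blast
  show ?thesis using P.perfect_graph_perfect_closure[OF Q1_prime Q2_prime p F S(1)] S(2) by blast
qed

text \<open>The partial isomorphisms are the rings of normal forms over \<open>reps_in S\<close>,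
  where \<open>S\<close> runs through the perfect graphs that contain a fixed countable set of
  constants.\<close>

lemma graph_family:
  assumes F: "P.frobenius_additive (Q1 \<inter> Q2) p"
    and qa: "\<And>S. P.perfect_graph Q1 Q2 p S \<Longrightarrow> P.quasi_additive (reps_in S) (emb \<pi>)"
    and W: "countable W" "W \<subseteq> carrier M"
  shows "\<exists>\<G> G0. back_and_forth_system M N \<G> \<and> G0 \<in> \<G> \<and> emb ` W \<subseteq> G0"
proof -
  let ?\<alpha> = "\<lambda>i. emb (a i)"
  \<comment> \<open>What the constants must express: \<open>\<pi> a\<^sub>i\<close> already at level
    \<open>i\<close>, so that defects descend, then the products of generators, 1 and the parameters
    \<open>W\<close>, all at level \<open>l\<close>.\<close>
  define Y where "Y = (\<lambda>i. (\<pi> \<otimes> a i, i)) ` {..<l} \<union> (\<lambda>(i, j). (a i \<otimes> a j, l)) ` ({..<l} \<times> {..<l}) \<union>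
    (\<lambda>x. (x, l)) ` insert \<one> W"
  have "countable Y" using W(1) by (simp add: Y_def countable_finite)
  moreover have "i \<le> l \<and> x \<in> spanned M a i" if "(x, i) \<in> Y" for x i
    using that M.nonunits_a[OF _ \<pi>] M.a_closed W(2) by (auto simp: Y_def M.spanned_l)
  ultimately obtain C where C: "countable C" "C \<subseteq> TM"
    "\<And>x i. (x, i) \<in> Y \<Longrightarrow> emb x \<in> P.NF (emb ` C) ?\<alpha> i" using NF_constants by blast
  define \<S> where "\<S> = {S. P.perfect_graph Q1 Q2 p S \<and> emb ` C \<subseteq> S}"
  define \<G> where "\<G> = (\<lambda>S. P.NF (reps_in S) ?\<alpha> l) ` \<S>"
  have mem: "emb x \<in> P.NF (reps_in S) ?\<alpha> i" if "S \<in> \<S>" "(x, i) \<in> Y" for S x i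
  proof -
    have "f c \<in> TN" "c \<in> TM" if "c \<in> C" for c using C(2) f_reps that by auto
    then have "emb ` C \<subseteq> reps_in S" using that(1) by (auto simp: \<S>_def reps_in_def emb_def)
    then show ?thesis using C(3)[OF that(2)] P.NF_mono by blast
  qed
  have S_props: "P.perfect_graph Q1 Q2 p S" "subring S P" "\<And>s. s \<in> S \<Longrightarrow> s \<in> Q1 \<longleftrightarrow> s \<in> Q2" if "S \<in> \<S>" for S
    using that by (auto simp: \<S>_def P.perfect_graph_def P.residue_graph_def)
  have \<pi>c: "\<pi> \<in> carrier M" using \<pi> by (simp add: nonunits_def)
  have sub: "subring (P.NF (reps_in S) ?\<alpha> l) P" if S: "S \<in> \<S>" for S
  proof (rule P.NF_subring[OF reps_in_props[OF S_props(2)[OF S]] _ _ qa[OF S_props(1)[OF S]]])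
    show "?\<alpha> j \<in> carrier P" if "j < l" for j using emb_closed[OF that] .
    show "emb \<pi> \<in> carrier P" using \<pi>c by simp
    show "emb \<pi> \<otimes>\<^bsub>P\<^esub> ?\<alpha> j \<in> P.NF (reps_in S) ?\<alpha> j" if "j < l" for j
      using mem[OF S, of "\<pi> \<otimes> a j" j] that \<pi>c M.a_closed by (simp add: Y_def)
    show "\<one>\<^bsub>P\<^esub> \<in> P.NF (reps_in S) ?\<alpha> l"
      using mem[OF S, of "\<one>" l] by (simp add: Y_def)
    show "?\<alpha> i \<otimes>\<^bsub>P\<^esub> ?\<alpha> j \<in> P.NF (reps_in S) ?\<alpha> l" if "i < l" "j < l" for i j
    proof -
      have "(a i \<otimes> a j, l) \<in> Y" using that by (auto simp: Y_def)
      from mem[OF S this] show ?thesis using that M.a_closed by simp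
    qed
  qed
  have mono: "P.NF (reps_in S) ?\<alpha> l \<subseteq> P.NF (reps_in S') ?\<alpha> l" if "S \<subseteq> S'" for S S'
    by (rule P.NF_mono) (use that in \<open>auto simp: reps_in_def\<close>)
  have "C \<subseteq> carrier M" using C(2) reps_closed by blast
  then obtain S0 where "P.perfect_graph Q1 Q2 p S0" "emb ` C \<subseteq> S0" using perfect_graph_containing[OF F C(1)] by blast
  then have S0: "S0 \<in> \<S>" by (simp add: \<S>_def)
  have "back_and_forth_system M N \<G>"
    unfolding back_and_forth_system_def P_def[symmetric]
  proof (intro ballI conjI)
    fix G assume "G \<in> \<G>"
    then obtain S where S: "S \<in> \<S>" "G = P.NF (reps_in S) ?\<alpha> l" by (auto simp: \<G>_def)
    show "subring G P" using sub S by simp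
    show "fst z = \<zero> \<longleftrightarrow> snd z = \<zero>\<^bsub>N\<^esub>" if "z \<in> G" for z
      using NF_zero_iff[OF S_props(2,3)[OF S(1)] order_refl] that S(2) by blast
    have in\<G>: "\<exists>G' \<in> \<G>. G \<subseteq> G' \<and> z \<in> G'"
      if "P.perfect_graph Q1 Q2 p S'" "S \<subseteq> S'" "z \<in> P.NF (reps_in S') ?\<alpha> l" for S' z
    proof -
      have "S' \<in> \<S>" using that S(1) by (auto simp: \<S>_def)
      then show ?thesis using that(3) mono[OF that(2)] S(2) by (auto simp: \<G>_def)
    qed
    show "\<exists>G' \<in> \<G>. G \<subseteq> G' \<and> (\<exists>z \<in> G'. fst z = x)" if x: "x \<in> carrier M" for x
    proof -
      have "x \<in> M.NF TM a l" using M.spanned_sub_NF[OF TM order_refl] x M.spanned_l by blast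
      then have "x \<in> M.NF TM (\<lambda>i. fst (emb (a i))) l" by (simp add: emb_def)
      then obtain S' z where "P.perfect_graph Q1 Q2 p S'" "S \<subseteq> S'" "z \<in> P.NF (reps_in S') ?\<alpha> l" "fst z = x"
        using lift_NF[OF fst.ring_hom_cring_axioms lift_rep_fst[OF F] S_props(1)[OF S(1)] order_refl] by blast
      then show ?thesis using in\<G> by blast
    qed
    show "\<exists>G' \<in> \<G>. G \<subseteq> G' \<and> (\<exists>z \<in> G'. snd z = y)" if y: "y \<in> carrier N" for y
    proof -
      have "y \<in> N.NF TN (\<lambda>i. f (a i)) l" using N.spanned_sub_NF[OF TN order_refl] y N.spanned_l by blast
      then have "y \<in> N.NF TN (\<lambda>i. snd (emb (a i))) l" by (simp add: emb_def)
      then obtain S' z where "P.perfect_graph Q1 Q2 p S'" "S \<subseteq> S'" "z \<in> P.NF (reps_in S') ?\<alpha> l" "snd z = y"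
        using lift_NF[OF snd.ring_hom_cring_axioms lift_rep_snd[OF F] S_props(1)[OF S(1)] order_refl] by blast
      then show ?thesis using in\<G> by blast
    qed
  qed
  moreover have "P.NF (reps_in S0) ?\<alpha> l \<in> \<G>" using S0 by (simp add: \<G>_def)
  moreover have "emb ` W \<subseteq> P.NF (reps_in S0) ?\<alpha> l" using mem[OF S0] by (auto simp: Y_def)
  ultimately show ?thesis by blast
qed

end

section \<open>The choice of representatives by residue characteristic\<close>

context ring_pair
begin

lemma RDirProd_power: "z [^]\<^bsub>P\<^esub> (n :: nat) = (fst z [^] n, snd z [^]\<^bsub>N\<^esub> n)"
  by (induction n) (simp_all add: P_simps)

lemma partial_isomorphisms:
  assumes W: "countable W" "W \<subseteq> carrier M"
  shows "\<exists>\<G> G0. back_and_forth_system M N \<G> \<and> G0 \<in> \<G> \<and> emb ` W \<subseteq> G0"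
proof (cases "\<exists>n :: nat. n > 0 \<and> [n] \<cdot> \<one> \<in> nonunits M")
  case True
  interpret m: primeideal "nonunits M" M by (rule M.nonunits_prime)
  let ?P = "\<lambda>n :: nat. n > 0 \<and> [n] \<cdot> \<one> \<in> nonunits M"
  \<comment> \<open>If \<open>p\<close> is a prime factor of the least such \<open>n\<close>, the
    cofactor \<open>k\<close> is smaller, so \<open>k\<close> is a unit in \<open>M\<close> and
    \<open>p\<close> itself is a nonunit.\<close>
  obtain n where n: "?P n" "\<And>k. ?P k \<Longrightarrow> n \<le> k" using True ex_has_least_nat[of ?P _ id] by auto
  have "n \<noteq> 1" using n(1) M.one_not_nonunit by auto
  then obtain p where p: "prime p" "p dvd n" using prime_factor_nat by blast
  then obtain k where k: "n = p * k" by blast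
  then have k0: "k > 0" "k < n" using n(1) prime_gt_1_nat[OF p(1)] by auto
  have "[n] \<cdot> \<one> = [p] \<cdot> ([k] \<cdot> \<one>)"
    unfolding k using M.add.nat_pow_pow[OF M.one_closed, of p k] by (simp add: mult.commute)
  also have "\<dots> = [p] \<cdot> \<one> \<otimes> [k] \<cdot> \<one>"
    using M.add_pow_ldistr[OF M.one_closed, of "[k] \<cdot> \<one>" p] by simp
  finally have "[p] \<cdot> \<one> \<otimes> [k] \<cdot> \<one> \<in> nonunits M" using n(1) by simp
  moreover have "[k] \<cdot> \<one> \<notin> nonunits M" using n(2)[of k] k0 by auto
  ultimately have pM: "[p] \<cdot> \<one> \<in> nonunits M"
    using m.I_prime[of "[p] \<cdot> \<one>" "[k] \<cdot> \<one>"] by simp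
  have pN: "[p] \<cdot>\<^bsub>N\<^esub> \<one>\<^bsub>N\<^esub> \<in> nonunits N"
    using f_nonunits[of "[p] \<cdot> \<one>"] pM f.hom_add_pow[OF M.one_closed, of p] by simp
  define q where "q = p ^ l"
  have p1: "p \<ge> 1" using prime_gt_0_nat[OF p(1)] by simp
  then have q0: "q \<noteq> 0" by (simp add: q_def)
  \<comment> \<open>Both rings have length \<open>l\<close>, so one exponent \<open>q\<close> serves
    both; as \<open>f\<close> commutes with powers, the two systems are compatible.\<close>
  interpret E: ring_embedding M N l a f "(\<lambda>x. x [^] q) ` carrier M" "(\<lambda>x. x [^]\<^bsub>N\<^esub> q) ` carrier N"
    "[p] \<cdot> \<one>" p
  proof unfold_locales
    show "M.reps ((\<lambda>x. x [^] q) ` carrier M)" unfolding q_def by (rule M.teichmuller_reps[OF p(1) pM])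
    show "N.reps ((\<lambda>x. x [^]\<^bsub>N\<^esub> q) ` carrier N)" unfolding q_def by (rule N.teichmuller_reps[OF p(1) pN])
    show "f ` (\<lambda>x. x [^] q) ` carrier M \<subseteq> (\<lambda>x. x [^]\<^bsub>N\<^esub> q) ` carrier N"
      using f.hom_power by auto
  qed (use pM p1 in auto)
  have pP: "emb ([p] \<cdot> \<one>) = [p] \<cdot>\<^bsub>P\<^esub> \<one>\<^bsub>P\<^esub>" using emb.hom_add_pow[OF M.one_closed, of p] by simp
  have "[p] \<cdot>\<^bsub>P\<^esub> \<one>\<^bsub>P\<^esub> \<in> carrier P" by simp
  then have "[p] \<cdot>\<^bsub>P\<^esub> \<one>\<^bsub>P\<^esub> \<in> Q1 \<inter> Q2"
    using pM pN fst.hom_add_pow[OF P.one_closed, of p] snd.hom_add_pow[OF P.one_closed, of p]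
    by (simp add: Q1_def Q2_def)
  then have F: "P.frobenius_additive (Q1 \<inter> Q2) p" by (rule P.frobenius_additive_prime[OF p(1) J_ideal])
  have "P.quasi_additive (E.reps_in S) (emb ([p] \<cdot> \<one>))" if S: "P.perfect_graph Q1 Q2 p S" for S
  proof -
    have pg: "P.residue_graph Q1 Q2 S" using S by (simp add: P.perfect_graph_def)
    have sub: "subring S P" using pg by (simp add: P.residue_graph_def)
    note cl = subringE[OF sub]
    have in_rep: "w [^]\<^bsub>P\<^esub> q \<in> E.reps_in S" if "w \<in> S" for w
      using that P.subring_pow[OF sub that] cl(1) by (auto simp: E.reps_in_def RDirProd_power P_simps)
    have root: "w \<in> S" if "w [^]\<^bsub>P\<^esub> (p ^ k) \<in> S" "w \<in> carrier P" for w k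
      using that
    proof (induction k arbitrary: w)
      case (Suc k)
      have "(w [^]\<^bsub>P\<^esub> p) [^]\<^bsub>P\<^esub> (p ^ k) \<in> S" using Suc.prems by (simp add: P.nat_pow_pow)
      then have "w [^]\<^bsub>P\<^esub> p \<in> S" using Suc by simp
      then show ?case using S Suc.prems by (simp add: P.perfect_graph_def)
    qed simp
    have q_cong: "z [^]\<^bsub>P\<^esub> q = w [^]\<^bsub>P\<^esub> q"
      if "z \<in> carrier P" "w \<in> carrier P" "P.mod_eq Q1 z w" "P.mod_eq Q2 z w" for z w
      using that M.power_char_eq[OF p(1) pM, of "fst z" "fst w"] N.power_char_eq[OF p(1) pN, of "snd z" "snd w"]
      by (auto simp: RDirProd_power q_def mod_Q1 mod_Q2)
    have approx: "\<exists>u \<in> E.reps_in S. u [^]\<^bsub>P\<^esub> q = w [^]\<^bsub>P\<^esub> q \<and> P.mod_eq Q1 u w \<and> P.mod_eq Q2 u w" if w: "w \<in> S" for w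
    proof -
      obtain u where u: "u \<in> E.reps_in S" "P.mod_eq Q1 u w" "P.mod_eq Q2 u w"
        using E.reps_approx[OF pg w] by blast
      have "u \<in> carrier P" "w \<in> carrier P" using u(1) w E.reps_in_props(1)[OF sub] cl(1) by auto
      then show ?thesis using q_cong u by blast
    qed
    show ?thesis unfolding pP
    proof (rule P.quasi_additive_prime[OF p(1) E.reps_in_props(1,3)[OF sub], where n = l, folded q_def])
      show "\<one>\<^bsub>P\<^esub> \<in> E.reps_in S" using in_rep[OF cl(3)] by simp
      show "\<exists>u \<in> E.reps_in S. t = u [^]\<^bsub>P\<^esub> q" if t: "t \<in> E.reps_in S" for t
      proof -
        obtain x y where xy: "x \<in> carrier M" "fst t = x [^] q" "y \<in> carrier N" "snd t = y [^]\<^bsub>N\<^esub> q"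
          using t by (auto simp: E.reps_in_def)
        have w: "(x, y) \<in> carrier P" "(x, y) [^]\<^bsub>P\<^esub> q = t" using xy by (auto simp: P_simps RDirProd_power prod_eq_iff)
        have "t \<in> S" using t by (simp add: E.reps_in_def)
        \<comment> \<open>Perfectness at work: \<open>S\<close> contains the \<open>q\<close>-th
          power of the pair, hence the pair. A congruent pair of representatives has the same
          \<open>q\<close>-th power.\<close>
        then have "(x, y) \<in> S" using root[of "(x, y)" l] w by (simp add: q_def)
        then show ?thesis using approx w(2) by metis
      qed
      show "(t \<oplus>\<^bsub>P\<^esub> u) [^]\<^bsub>P\<^esub> q \<in> E.reps_in S" if "t \<in> E.reps_in S" "u \<in> E.reps_in S" for t u
        using in_rep cl(7) that by (simp add: E.reps_in_def)
      show "\<exists>u \<in> E.reps_in S. (t \<oplus>\<^bsub>P\<^esub> u) [^]\<^bsub>P\<^esub> q = \<zero>\<^bsub>P\<^esub>" if t: "t \<in> E.reps_in S" for t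
      proof -
        have tS: "t \<in> S" "\<ominus>\<^bsub>P\<^esub> t \<in> S" "t \<in> carrier P" using t cl(1,5) by (auto simp: E.reps_in_def)
        \<comment> \<open>The representative \<open>u\<close> of the negative of \<open>t\<close>
          makes \<open>t + u\<close> congruent to zero, so its \<open>q\<close>-th power equals that
          of zero.\<close>
        obtain u where u: "u \<in> E.reps_in S" "P.mod_eq Q1 u (\<ominus>\<^bsub>P\<^esub> t)" "P.mod_eq Q2 u (\<ominus>\<^bsub>P\<^esub> t)"
          using approx[OF tS(2)] by blast
        have uc: "u \<in> carrier P" using u(1) E.reps_in_props(1)[OF sub] by blast
        have "t \<oplus>\<^bsub>P\<^esub> u \<ominus>\<^bsub>P\<^esub> \<zero>\<^bsub>P\<^esub> = u \<ominus>\<^bsub>P\<^esub> (\<ominus>\<^bsub>P\<^esub> t)" using tS(3) uc by (simp add: P.minus_eq P.a_comm)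
        then have "P.mod_eq Q1 (t \<oplus>\<^bsub>P\<^esub> u) \<zero>\<^bsub>P\<^esub>" "P.mod_eq Q2 (t \<oplus>\<^bsub>P\<^esub> u) \<zero>\<^bsub>P\<^esub>"
          using u(2,3) by (simp_all add: P.mod_eq_def)
        then have "(t \<oplus>\<^bsub>P\<^esub> u) [^]\<^bsub>P\<^esub> q = \<zero>\<^bsub>P\<^esub> [^]\<^bsub>P\<^esub> q" using q_cong tS(3) uc by simp
        also have "\<dots> = \<zero>\<^bsub>P\<^esub>" using not0_implies_Suc[OF q0] by auto
        finally show ?thesis using u(1) by blast
      qed
    qed
  qed
  then show ?thesis by (rule E.graph_family[OF F _ W])
next
  case False
  then have charM: "[n] \<cdot> \<one> \<notin> nonunits M" if "n > 0" for n :: nat using that by blast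
  have charN: "[n] \<cdot>\<^bsub>N\<^esub> \<one>\<^bsub>N\<^esub> \<notin> nonunits N" if "n > 0" for n :: nat
    using f_nonunits[of "[n] \<cdot> \<one>"] charM[OF that] f.hom_add_pow[OF M.one_closed, of n] by simp
  \<comment> \<open>The image of the integers. Nonzero integers are units here, so it meets the
    nonunits only in zero and can be the seed of a coefficient ring of \<open>M\<close>.\<close>
  let ?Z = "range (\<lambda>k :: int. [k] \<cdot> \<one>)"
  have "subring ?Z M"
  proof (rule M.subringI)
    have "\<one> = [(1 :: int)] \<cdot> \<one>" using M.add.int_pow_1[OF M.one_closed] by simp
    then show "\<one> \<in> ?Z" by blast
    show "\<ominus> x \<in> ?Z" if "x \<in> ?Z" for x
      using that M.add.int_pow_neg[OF M.one_closed, symmetric] by auto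
    show "x \<oplus> y \<in> ?Z" if "x \<in> ?Z" "y \<in> ?Z" for x y
      using that M.add.int_pow_mult[OF M.one_closed, symmetric] by auto
    show "x \<otimes> y \<in> ?Z" if "x \<in> ?Z" "y \<in> ?Z" for x y
    proof -
      obtain i j :: int where ij: "x = [i] \<cdot> \<one>" "y = [j] \<cdot> \<one>" using \<open>x \<in> ?Z\<close> \<open>y \<in> ?Z\<close> by blast
      have "x \<otimes> y = [i] \<cdot> ([j] \<cdot> \<one>)"
        unfolding ij using M.add_pow_ldistr_int[OF M.one_closed, of "[j] \<cdot> \<one>" i] by simp
      also have "\<dots> = [(j * i)] \<cdot> \<one>" using M.add.int_pow_pow[OF M.one_closed, of i j] by simp
      finally show ?thesis by blast
    qed
  qed auto
  moreover have "?Z \<inter> nonunits M \<subseteq> {\<zero>}"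
  proof
    interpret m: ideal "nonunits M" M by (rule M.nonunits_is_ideal)
    fix x assume x: "x \<in> ?Z \<inter> nonunits M"
    then obtain k :: int where k: "x = [k] \<cdot> \<one>" by blast
    have "k = 0"
    proof (rule ccontr)
      assume "k \<noteq> 0"
      then consider "k > 0" | "k < 0" by linarith
      then show False
      proof cases
        case 1
        then have "x = [nat k] \<cdot> \<one>" using k add_pow_int_ge[of k M] by simp
        then show False using charM[of "nat k"] x 1 by simp
      next
        case 2
        then have "x = \<ominus> ([nat (- k)] \<cdot> \<one>)" using k add_pow_int_lt[of k M] by simp
        then have "\<ominus> x = [nat (- k)] \<cdot> \<one>" by simp
        moreover have "\<ominus> x \<in> nonunits M" using x m.a_inv_closed by blast
        ultimately show False using charM[of "nat (- k)"] 2 by simp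
      qed
    qed
    show "x \<in> {\<zero>}" using k \<open>k = 0\<close> add_pow_int_ge[of 0 M "\<one>"] by simp
  qed
  ultimately obtain TM where TM: "subring TM M" "M.reps TM"
    using M.coefficient_ring_exists[OF charM] by blast
  have "subring (f ` TM) N"
  proof (rule N.subringI)
    note cl = subringE[OF TM(1)]
    have c: "x \<in> carrier M" if "x \<in> TM" for x using cl(1) that by blast
    show "f ` TM \<subseteq> carrier N" using c by auto
    show "\<one>\<^bsub>N\<^esub> \<in> f ` TM" using cl(3) f.hom_one by (metis imageI)
    show "\<ominus>\<^bsub>N\<^esub> x \<in> f ` TM" if "x \<in> f ` TM" for x
      using that cl(5) c by (auto simp: f.hom_a_inv[symmetric] simp del: f.hom_a_inv)
    show "x \<oplus>\<^bsub>N\<^esub> y \<in> f ` TM" if "x \<in> f ` TM" "y \<in> f ` TM" for x y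
      using that cl(7) c by (auto simp: f.hom_add[symmetric] simp del: f.hom_add)
    show "x \<otimes>\<^bsub>N\<^esub> y \<in> f ` TM" if "x \<in> f ` TM" "y \<in> f ` TM" for x y
      using that cl(6) c by (auto simp: f.hom_mult[symmetric] simp del: f.hom_mult)
  qed
  moreover have "f ` TM \<inter> nonunits N \<subseteq> {\<zero>\<^bsub>N\<^esub>}"
  proof
    fix y assume "y \<in> f ` TM \<inter> nonunits N"
    then obtain t where t: "t \<in> TM" "y = f t" "f t \<in> nonunits N" by blast
    have tc: "t \<in> carrier M" using t TM(2) by (auto simp: M.reps_def)
    then have "t \<in> nonunits M" using f_nonunits t(3) by blast
    then have "M.mod_eq (nonunits M) t \<zero>" using tc by (simp add: M.mod_eq_def M.minus_eq)
    then have "t = \<zero>" using TM(2) t(1) by (auto simp: M.reps_def)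
    then show "y \<in> {\<zero>\<^bsub>N\<^esub>}" using t(2) by simp
  qed
  \<comment> \<open>\<open>TN\<close> is grown from the image of \<open>TM\<close>; this provides
    the compatibility of representatives with \<open>f\<close>.\<close>
  ultimately obtain TN where TN: "subring TN N" "f ` TM \<subseteq> TN" "N.reps TN"
    using N.coefficient_ring_exists[OF charN] by blast
  \<comment> \<open>Rings of representatives have no defects, so \<open>\<pi>\<close> is zero, and
    there is no Frobenius to invert, so \<open>p\<close> is 1.\<close>
  interpret E: ring_embedding M N l a f TM TN "\<zero>" 1
    using TM TN additive_subgroup.zero_closed[OF ideal.axioms(1)[OF M.nonunits_is_ideal]]
    by unfold_locales auto
  have F: "P.frobenius_additive (Q1 \<inter> Q2) 1"
    unfolding P.frobenius_additive_def using P.mod_eq_refl[OF J_ideal] by simp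
  have "P.quasi_additive (E.reps_in S) (emb \<zero>)" if S: "P.perfect_graph Q1 Q2 1 S" for S
  proof -
    have sub: "subring S P" using S by (simp add: P.perfect_graph_def P.residue_graph_def)
    note cl = subringE[OF sub] and clM = subringE[OF TM(1)] and clN = subringE[OF TN(1)]
    have "subring (E.reps_in S) P"
    proof (rule P.subringI)
      show "E.reps_in S \<subseteq> carrier P" by (rule E.reps_in_props(1)[OF sub])
      show "\<one>\<^bsub>P\<^esub> \<in> E.reps_in S" using cl(3) clM(3) clN(3) by (simp add: E.reps_in_def P_simps)
      show "\<ominus>\<^bsub>P\<^esub> x \<in> E.reps_in S" if "x \<in> E.reps_in S" for x
      proof -
        have "x \<in> carrier P" using that E.reps_in_props(1)[OF sub] by blast
        then show ?thesis using that cl(5) clM(5) clN(5) by (simp add: E.reps_in_def)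
      qed
      show "x \<oplus>\<^bsub>P\<^esub> y \<in> E.reps_in S" if "x \<in> E.reps_in S" "y \<in> E.reps_in S" for x y
      proof -
        have "x \<oplus>\<^bsub>P\<^esub> y \<in> S" using that cl(7) by (simp add: E.reps_in_def)
        then show ?thesis using that clM(7) clN(7) by (simp add: E.reps_in_def P_simps(4))
      qed
    qed (use E.reps_in_props(3)[OF sub] in auto)
    then show ?thesis using P.quasi_additive_subring by simp
  qed
  then show ?thesis by (rule E.graph_family[OF F _ W])
qed

end

section \<open>Back-and-forth systems and ultrapowers\<close>

lemma back_and_forth:
  fixes M :: "'a ring_structure" and N :: "'b ring_structure"
  assumes "cring M" "cring N"
    and negM: "\<And>x. x \<in> carrier M \<Longrightarrow> neg M x = \<ominus>\<^bsub>M\<^esub> x"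
    and negN: "\<And>x. x \<in> carrier N \<Longrightarrow> neg N x = \<ominus>\<^bsub>N\<^esub> x"
    and \<G>: "back_and_forth_system M N \<G>"
    and G: "G \<in> \<G>" and st: "\<And>v. (s v, t v) \<in> G"
  shows "sat M s \<phi> \<longleftrightarrow> sat N t \<phi>"
proof -
  have sub: "subring G (RDirProd M N)"
    and zero: "\<And>z. z \<in> G \<Longrightarrow> fst z = \<zero>\<^bsub>M\<^esub> \<longleftrightarrow> snd z = \<zero>\<^bsub>N\<^esub>"
    and zig: "\<And>x. x \<in> carrier M \<Longrightarrow> \<exists>G' \<in> \<G>. G \<subseteq> G' \<and> (\<exists>z \<in> G'. fst z = x)"
    and zag: "\<And>y. y \<in> carrier N \<Longrightarrow> \<exists>G' \<in> \<G>. G \<subseteq> G' \<and> (\<exists>z \<in> G'. snd z = y)"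
    if "G \<in> \<G>" for G
    using \<G> that unfolding back_and_forth_system_def by blast+
  interpret M: cring M by fact
  interpret N: cring N by fact
  interpret P: cring "RDirProd M N" by (rule RDirProd_cring) unfold_locales
  interpret fst: ring_hom_cring "RDirProd M N" M fst by unfold_locales (simp add: fst_hom)
  interpret snd: ring_hom_cring "RDirProd M N" N snd by unfold_locales (simp add: snd_hom)
  have minus: "\<ominus>\<^bsub>RDirProd M N\<^esub> (x, y) = (\<ominus>\<^bsub>M\<^esub> x, \<ominus>\<^bsub>N\<^esub> y)" if "(x, y) \<in> carrier (RDirProd M N)" for x y
    using fst.hom_a_inv[OF that] snd.hom_a_inv[OF that] by (simp add: prod_eq_iff)
  have tv: "(tval M s u, tval N t u) \<in> G" if "G \<in> \<G>" "\<And>v. (s v, t v) \<in> G" for G s t u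
  proof (induction u)
    note cl = subringE[OF sub[OF that(1)]]
    have c: "x \<in> carrier M \<and> y \<in> carrier N" if "(x, y) \<in> G" for x y
      using cl(1) that by (auto simp: RDirProd_simps)
    case (Minus u)
    have "\<ominus>\<^bsub>RDirProd M N\<^esub> (tval M s u, tval N t u) \<in> G" by (rule cl(5)[OF Minus])
    then show ?case using minus c[OF Minus] by (simp add: RDirProd_simps negM negN)
  next
    note cl = subringE[OF sub[OF that(1)]]
    { case (Var v) show ?case using that by simp }
    { case Zero show ?case using cl(2) by (simp add: RDirProd_simps) }
    { case One show ?case using cl(3) by (simp add: RDirProd_simps) }
    { case (Plus u w) then show ?case using cl(7)[OF Plus] by (simp add: RDirProd_simps) }
    { case (Times u w) then show ?case using cl(6)[OF Times] by (simp add: RDirProd_simps) }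
  qed
  show ?thesis using G st
  proof (induction \<phi> arbitrary: s t G)
    case (FEq u w)
    note cl = subringE[OF sub[OF FEq.prems(1)]]
    \<comment> \<open>An equation holds iff the difference of its sides vanishes; the pair of
      differences lies in \<open>G\<close>, where the components vanish together.\<close>
    let ?z = "(tval M s u, tval N t u) \<ominus>\<^bsub>RDirProd M N\<^esub> (tval M s w, tval N t w)"
    have uw: "(tval M s u, tval N t u) \<in> G" "(tval M s w, tval N t w) \<in> G" using tv FEq.prems by blast+
    then have z: "?z \<in> G" using cl(5,7) by (simp add: P.minus_eq)
    have c: "(tval M s u, tval N t u) \<in> carrier (RDirProd M N)" "(tval M s w, tval N t w) \<in> carrier (RDirProd M N)"
      using uw cl(1) by auto
    have "fst ?z = tval M s u \<ominus>\<^bsub>M\<^esub> tval M s w" "snd ?z = tval N t u \<ominus>\<^bsub>N\<^esub> tval N t w"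
      using fst.hom_minus[OF c] snd.hom_minus[OF c] by simp_all
    then show ?case using zero[OF FEq.prems(1) z] c M.r_right_minus_eq N.r_right_minus_eq
      by (simp add: RDirProd_simps)
  next
    case (FEx v \<phi>)
    have c: "fst z \<in> carrier M" "snd z \<in> carrier N" if "G' \<in> \<G>" "z \<in> G'" for G' z
      using subringE(1)[OF sub[OF that(1)]] that(2) by (auto simp: RDirProd_simps)
    have IH: "sat M (s(v := fst z)) \<phi> \<longleftrightarrow> sat N (t(v := snd z)) \<phi>"
      if "G' \<in> \<G>" "G \<subseteq> G'" "z \<in> G'" for G' z
      by (rule FEx.IH[OF that(1)]) (use FEx.prems(2) that in auto)
    show ?case
    proof
      assume "sat M s (FEx v \<phi>)"
      then obtain x where x: "x \<in> carrier M" "sat M (s(v := x)) \<phi>" by auto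
      obtain G' z where G': "G' \<in> \<G>" "G \<subseteq> G'" "z \<in> G'" and z: "fst z = x"
        using zig[OF FEx.prems(1) x(1)] by blast
      have "sat N (t(v := snd z)) \<phi>" using IH[OF G'] x(2) z by simp
      then show "sat N t (FEx v \<phi>)" using c(2)[OF G'(1,3)] by auto
    next
      assume "sat N t (FEx v \<phi>)"
      then obtain y where y: "y \<in> carrier N" "sat N (t(v := y)) \<phi>" by auto
      obtain G' z where G': "G' \<in> \<G>" "G \<subseteq> G'" "z \<in> G'" and z: "snd z = y"
        using zag[OF FEx.prems(1) y(1)] by blast
      have "sat M (s(v := fst z)) \<phi>" using IH[OF G'] y(2) z by simp
      then show "sat M s (FEx v \<phi>)" using c(1)[OF G'(1,3)] by auto
    qed
  next
    case (FNot \<phi>)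
    have "sat M s \<phi> \<longleftrightarrow> sat N t \<phi>" by (rule FNot.IH[OF FNot.prems])
    then show ?case by simp
  next
    case (FAnd \<phi> \<psi>)
    have "sat M s \<phi> \<longleftrightarrow> sat N t \<phi>" by (rule FAnd.IH(1)[OF FAnd.prems])
    moreover have "sat M s \<psi> \<longleftrightarrow> sat N t \<psi>" by (rule FAnd.IH(2)[OF FAnd.prems])
    ultimately show ?case by simp
  qed
qed

section \<open>Nonprincipal ultrafilters on the natural numbers\<close>

text \<open>Including all tails makes the maximal filters nonprincipal, and it lets the diagonal
  argument ignore finitely many indices.\<close>

definition proper_filter :: "nat set set \<Rightarrow> bool" where
  "proper_filter F \<longleftrightarrow> {} \<notin> F \<and> (\<forall>A B. A \<in> F \<longrightarrow> A \<subseteq> B \<longrightarrow> B \<in> F) \<and>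
     (\<forall>A B. A \<in> F \<longrightarrow> B \<in> F \<longrightarrow> A \<inter> B \<in> F) \<and> (\<forall>n. {n..} \<in> F)"

lemma proper_filterD:
  assumes "proper_filter F"
  shows "{} \<notin> F" "A \<in> F \<Longrightarrow> A \<subseteq> B \<Longrightarrow> B \<in> F" "A \<in> F \<Longrightarrow> B \<in> F \<Longrightarrow> A \<inter> B \<in> F" "{n..} \<in> F"
  using assms by (auto simp: proper_filter_def)

lemma proper_filterI:
  assumes "{} \<notin> F" "\<And>A B. A \<in> F \<Longrightarrow> A \<subseteq> B \<Longrightarrow> B \<in> F"
    "\<And>A B. A \<in> F \<Longrightarrow> B \<in> F \<Longrightarrow> A \<inter> B \<in> F" "\<And>n. {n..} \<in> F"
  shows "proper_filter F"
  using assms by (simp add: proper_filter_def)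

definition ultrafilter :: "nat set set \<Rightarrow> bool" where
  "ultrafilter U \<longleftrightarrow> proper_filter U \<and> (\<forall>A. A \<in> U \<or> - A \<in> U)"

lemma ultrafilter_exists: "\<exists>U. ultrafilter U"
proof -
  let ?A = "Collect proper_filter"
  have "\<exists>U \<in> ?A. \<forall>W \<in> ?A. U \<subseteq> W \<longrightarrow> W = U"
  proof (rule subset_Zorn_nonempty)
    have "proper_filter {A. \<exists>n. {n..} \<subseteq> A}"
    proof (rule proper_filterI)
      fix A B :: "nat set" assume "A \<in> {A. \<exists>n. {n..} \<subseteq> A}" "B \<in> {A. \<exists>n. {n..} \<subseteq> A}"
      then obtain m n where "{m..} \<subseteq> A" "{n..} \<subseteq> B" by blast
      then have "{max m n..} \<subseteq> A \<inter> B" by auto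
      then show "A \<inter> B \<in> {A. \<exists>n. {n..} \<subseteq> A}" by blast
    qed auto
    then show "?A \<noteq> {}" by blast
    fix C assume C: "C \<noteq> {}" "subset.chain ?A C"
    have CA: "proper_filter F" if "F \<in> C" for F using C(2) that by (auto simp: subset.chain_def)
    obtain F0 where F0: "F0 \<in> C" using C(1) by blast
    have "proper_filter (\<Union>C)"
    proof (rule proper_filterI)
      show "{} \<notin> \<Union>C" using proper_filterD(1)[OF CA] by blast
      show "{n..} \<in> \<Union>C" for n using proper_filterD(4)[OF CA[OF F0]] F0 by blast
      show "B \<in> \<Union>C" if "A \<in> \<Union>C" "A \<subseteq> B" for A B
        using proper_filterD(2)[OF CA] that by blast
      fix A B :: "nat set" assume "A \<in> \<Union>C" "B \<in> \<Union>C"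
      then obtain F F' where F: "F \<in> C" "A \<in> F" "F' \<in> C" "B \<in> F'" by blast
      then have "F \<subseteq> F' \<or> F' \<subseteq> F" using C(2) unfolding subset_chain_def by blast
      then obtain H where "H \<in> C" "A \<in> H" "B \<in> H" using F by blast
      then show "A \<inter> B \<in> \<Union>C" using proper_filterD(3)[OF CA] by blast
    qed
    then show "\<Union>C \<in> ?A" by blast
  qed
  then obtain U where U: "proper_filter U" "\<And>W. proper_filter W \<Longrightarrow> U \<subseteq> W \<Longrightarrow> W = U" by blast
  have "A \<in> U \<or> - A \<in> U" for A
  proof (rule ccontr)
    assume n: "\<not> (A \<in> U \<or> - A \<in> U)"
    \<comment> \<open>The filter generated by \<open>U\<close> and \<open>A\<close>. It is proper
      because a member of \<open>U\<close> disjoint from \<open>A\<close> would put the complement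
      of \<open>A\<close> into \<open>U\<close>.\<close>
    let ?F = "{B. \<exists>C \<in> U. C \<inter> A \<subseteq> B}"
    have UF: "U \<subseteq> ?F" by blast
    have "proper_filter ?F"
    proof (rule proper_filterI)
      show "{} \<notin> ?F"
      proof
        assume "{} \<in> ?F"
        then obtain C where "C \<in> U" "C \<subseteq> - A" by blast
        then show False using proper_filterD(2)[OF U(1)] n by blast
      qed
      show "{n..} \<in> ?F" for n using proper_filterD(4)[OF U(1), of n] UF by blast
      show "B' \<in> ?F" if "B \<in> ?F" "B \<subseteq> B'" for B B' using that by blast
      fix B B' assume "B \<in> ?F" "B' \<in> ?F"
      then obtain C C' where C: "C \<in> U" "C' \<in> U" "C \<inter> A \<subseteq> B" "C' \<inter> A \<subseteq> B'" by blast
      then have "C \<inter> C' \<in> U" using proper_filterD(3)[OF U(1)] by blast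
      moreover have "(C \<inter> C') \<inter> A \<subseteq> B \<inter> B'" using C by blast
      ultimately show "B \<inter> B' \<in> ?F" by blast
    qed
    then have "?F = U" using U(2) UF by blast
    moreover have "UNIV \<in> U" using proper_filterD(2,4)[OF U(1)] by blast
    then have "A \<in> ?F" by blast
    ultimately show False using n by blast
  qed
  then have "ultrafilter U" using U(1) unfolding ultrafilter_def by blast
  then show ?thesis ..
qed

section \<open>Ultrapowers and the theorem of Los\<close>

locale ultrapower =
  fixes U :: "nat set set"
  assumes U: "ultrafilter U"
begin

lemma U_filter: "proper_filter U"
  using U by (simp add: ultrafilter_def)

lemmas U_empty = proper_filterD(1)[OF U_filter] and U_mono = proper_filterD(2)[OF U_filter]
  and U_Int = proper_filterD(3)[OF U_filter] and U_tail = proper_filterD(4)[OF U_filter]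

lemma U_UNIV: "UNIV \<in> U"
  using U_mono[OF U_tail] by blast

lemma U_Compl: "- A \<in> U \<longleftrightarrow> A \<notin> U"
  using U U_Int[of A "- A"] U_empty by (auto simp: ultrafilter_def)

definition eqv :: "(nat \<Rightarrow> 'a) \<Rightarrow> (nat \<Rightarrow> 'a) \<Rightarrow> bool" where
  "eqv g h \<longleftrightarrow> {n. g n = h n} \<in> U"

lemma eqv_refl: "eqv g g"
  using U_UNIV by (simp add: eqv_def)

lemma eqv_sym: "eqv g h \<Longrightarrow> eqv h g"
  by (simp add: eqv_def eq_commute)

lemma eqv_trans: "eqv g h \<Longrightarrow> eqv h k \<Longrightarrow> eqv g k"
  unfolding eqv_def by (drule (1) U_Int, erule U_mono) auto

lemma eqv_map2: "eqv g g' \<Longrightarrow> eqv h h' \<Longrightarrow> eqv (\<lambda>n. F (g n) (h n)) (\<lambda>n. F (g' n) (h' n))"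
  unfolding eqv_def by (drule (1) U_Int, erule U_mono) auto

lemma eqv_map: "eqv g g' \<Longrightarrow> eqv (\<lambda>n. F (g n)) (\<lambda>n. F (g' n))"
  using eqv_map2[of g g' g g' "\<lambda>x _. F x"] by simp

definition seqs :: "('a, 'm) partial_object_scheme \<Rightarrow> (nat \<Rightarrow> 'a) set" where
  "seqs M = {g. \<forall>n. g n \<in> carrier M}"

text \<open>A canonical representative of the class of a sequence, so that the ultrapower needs no
  quotient type.\<close>

definition cls :: "('a, 'm) partial_object_scheme \<Rightarrow> (nat \<Rightarrow> 'a) \<Rightarrow> (nat \<Rightarrow> 'a)" where
  "cls M g = (SOME h. h \<in> seqs M \<and> eqv h g)"

lemma cls: "g \<in> seqs M \<Longrightarrow> cls M g \<in> seqs M" "g \<in> seqs M \<Longrightarrow> eqv (cls M g) g"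
  unfolding cls_def using someI[of "\<lambda>h. h \<in> seqs M \<and> eqv h g" g] eqv_refl by auto

lemma cls_eq_iff:
  assumes "g \<in> seqs M" "h \<in> seqs M"
  shows "cls M g = cls M h \<longleftrightarrow> eqv g h"
proof
  assume "cls M g = cls M h"
  then show "eqv g h" using cls(2)[OF assms(1)] cls(2)[OF assms(2)] eqv_sym eqv_trans by metis
next
  assume "eqv g h"
  then have "(\<lambda>k. k \<in> seqs M \<and> eqv k g) = (\<lambda>k. k \<in> seqs M \<and> eqv k h)"
    using eqv_sym eqv_trans by blast
  then show "cls M g = cls M h" by (simp add: cls_def)
qed

definition upower :: "'a ring_structure \<Rightarrow> (nat \<Rightarrow> 'a) ring_structure" where
  "upower M = \<lparr>carrier = cls M ` seqs M,
     monoid.mult = (\<lambda>g h. cls M (\<lambda>n. g n \<otimes>\<^bsub>M\<^esub> h n)), one = cls M (\<lambda>_. \<one>\<^bsub>M\<^esub>),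
     zero = cls M (\<lambda>_. \<zero>\<^bsub>M\<^esub>), add = (\<lambda>g h. cls M (\<lambda>n. g n \<oplus>\<^bsub>M\<^esub> h n)),
     neg = (\<lambda>g. cls M (\<lambda>n. neg M (g n)))\<rparr>"

lemma upower_simps:
  "carrier (upower M) = cls M ` seqs M" "\<one>\<^bsub>upower M\<^esub> = cls M (\<lambda>_. \<one>\<^bsub>M\<^esub>)"
  "\<zero>\<^bsub>upower M\<^esub> = cls M (\<lambda>_. \<zero>\<^bsub>M\<^esub>)"
  by (simp_all add: upower_def)

context
  fixes M :: "'a ring_structure"
  assumes M: "is_structure M"
begin

lemma seqs_closed:
  "(\<lambda>_. \<one>\<^bsub>M\<^esub>) \<in> seqs M" "(\<lambda>_. \<zero>\<^bsub>M\<^esub>) \<in> seqs M"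
  "g \<in> seqs M \<Longrightarrow> h \<in> seqs M \<Longrightarrow> (\<lambda>n. g n \<oplus>\<^bsub>M\<^esub> h n) \<in> seqs M"
  "g \<in> seqs M \<Longrightarrow> h \<in> seqs M \<Longrightarrow> (\<lambda>n. g n \<otimes>\<^bsub>M\<^esub> h n) \<in> seqs M"
  "g \<in> seqs M \<Longrightarrow> (\<lambda>n. neg M (g n)) \<in> seqs M"
  using M by (auto simp: seqs_def is_structure_def)

lemma upower_ops:
  "g \<in> seqs M \<Longrightarrow> h \<in> seqs M \<Longrightarrow> cls M g \<oplus>\<^bsub>upower M\<^esub> cls M h = cls M (\<lambda>n. g n \<oplus>\<^bsub>M\<^esub> h n)"
  "g \<in> seqs M \<Longrightarrow> h \<in> seqs M \<Longrightarrow> cls M g \<otimes>\<^bsub>upower M\<^esub> cls M h = cls M (\<lambda>n. g n \<otimes>\<^bsub>M\<^esub> h n)"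
  "g \<in> seqs M \<Longrightarrow> neg (upower M) (cls M g) = cls M (\<lambda>n. neg M (g n))"
  by (simp_all add: upower_def cls_eq_iff seqs_closed cls eqv_map2 eqv_map)

lemma upower_structure: "is_structure (upower M)"
  unfolding is_structure_def upower_simps by (auto simp: upower_ops seqs_closed)

lemma upower_tval:
  assumes "\<And>v. g v \<in> seqs M"
  shows "tval (upower M) (\<lambda>v. cls M (g v)) t = cls M (\<lambda>n. tval M (\<lambda>v. g v n) t) \<and>
    (\<lambda>n. tval M (\<lambda>v. g v n) t) \<in> seqs M"
proof (induction t)
  case (Var v)
  then show ?case using assms by simp
qed (auto simp: upower_simps upower_ops seqs_closed)

theorem Los:
  assumes "\<And>v. g v \<in> seqs M"
  shows "sat (upower M) (\<lambda>v. cls M (g v)) \<phi> \<longleftrightarrow> {n. sat M (\<lambda>v. g v n) \<phi>} \<in> U"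
  using assms
proof (induction \<phi> arbitrary: g)
  case (FEq t u)
  then show ?case using upower_tval[of g t] upower_tval[of g u] by (simp add: cls_eq_iff eqv_def)
next
  case (FNot \<phi>)
  have "{n. \<not> sat M (\<lambda>v. g v n) \<phi>} = - {n. sat M (\<lambda>v. g v n) \<phi>}" by blast
  then show ?case using FNot U_Compl by simp
next
  case (FAnd \<phi> \<psi>)
  have "{n. sat M (\<lambda>v. g v n) \<phi> \<and> sat M (\<lambda>v. g v n) \<psi>} \<in> U \<longleftrightarrow>
    {n. sat M (\<lambda>v. g v n) \<phi>} \<in> U \<and> {n. sat M (\<lambda>v. g v n) \<psi>} \<in> U" (is "?L \<longleftrightarrow> ?R")
  proof
    assume ?L
    then show ?R by (auto elim: U_mono)
  next
    assume ?R
    then show ?L using U_Int by (auto simp: Collect_conj_eq)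
  qed
  then show ?case using FAnd by simp
next
  case (FEx w \<phi>)
  have IH: "sat (upower M) ((\<lambda>v. cls M (g v))(w := cls M h)) \<phi> \<longleftrightarrow>
    {n. sat M ((\<lambda>v. g v n)(w := h n)) \<phi>} \<in> U" if h: "h \<in> seqs M" for h
  proof -
    have "(\<lambda>v. cls M (g v))(w := cls M h) = (\<lambda>v. cls M ((g(w := h)) v))"
      "\<And>n. (\<lambda>v. g v n)(w := h n) = (\<lambda>v. (g(w := h)) v n)" by auto
    then show ?thesis using FEx.IH[of "g(w := h)"] FEx.prems h by simp
  qed
  show ?case
  proof
    assume "sat (upower M) (\<lambda>v. cls M (g v)) (FEx w \<phi>)"
    then obtain h where h: "h \<in> seqs M" "sat (upower M) ((\<lambda>v. cls M (g v))(w := cls M h)) \<phi>"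
      by (auto simp: upower_simps)
    then have "{n. sat M ((\<lambda>v. g v n)(w := h n)) \<phi>} \<in> U" using IH by blast
    then show "{n. sat M (\<lambda>v. g v n) (FEx w \<phi>)} \<in> U"
      by (rule U_mono) (use h(1) in \<open>auto simp: seqs_def\<close>)
  next
    assume A: "{n. sat M (\<lambda>v. g v n) (FEx w \<phi>)} \<in> U"
    \<comment> \<open>A witness wherever there is one. The default \<open>\<zero>\<close> elsewhere
      keeps \<open>h\<close> in \<open>seqs M\<close>.\<close>
    define h where "h n = (if \<exists>x \<in> carrier M. sat M ((\<lambda>v. g v n)(w := x)) \<phi>
      then SOME x. x \<in> carrier M \<and> sat M ((\<lambda>v. g v n)(w := x)) \<phi> else \<zero>\<^bsub>M\<^esub>)" for n
    have h: "h n \<in> carrier M" "(\<exists>x \<in> carrier M. sat M ((\<lambda>v. g v n)(w := x)) \<phi>) \<Longrightarrow>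
      sat M ((\<lambda>v. g v n)(w := h n)) \<phi>" for n
      using someI_ex[of "\<lambda>x. x \<in> carrier M \<and> sat M ((\<lambda>v. g v n)(w := x)) \<phi>"] M
      by (auto simp: h_def is_structure_def)
    have "{n. sat M ((\<lambda>v. g v n)(w := h n)) \<phi>} \<in> U"
      using A by (rule U_mono) (use h(2) in auto)
    moreover have hs: "h \<in> seqs M" using h(1) by (simp add: seqs_def)
    ultimately have "sat (upower M) ((\<lambda>v. cls M (g v))(w := cls M h)) \<phi>" using IH by blast
    then show "sat (upower M) (\<lambda>v. cls M (g v)) (FEx w \<phi>)" using hs by (auto simp: upower_simps)
  qed
qed

lemma upower_model:
  assumes "is_model M T"
  shows "is_model (upower M) T"
  unfolding is_model_def
proof (intro conjI ballI allI impI)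
  show "is_structure (upower M)" by (rule upower_structure)
  fix p and s :: "nat \<Rightarrow> nat \<Rightarrow> 'a" assume p: "p \<in> T" and s: "range s \<subseteq> carrier (upower M)"
  have "\<exists>g. g \<in> seqs M \<and> s v = cls M g" for v using s by (auto simp: upower_simps)
  then obtain g where g: "\<And>v. g v \<in> seqs M" "\<And>v. s v = cls M (g v)" by metis
  have "sat M (\<lambda>v. g v n) p" for n
  proof -
    have "range (\<lambda>v. g v n) \<subseteq> carrier M" using g(1) by (auto simp: seqs_def)
    then show ?thesis using assms p unfolding is_model_def by blast
  qed
  then have "sat (upower M) (\<lambda>v. cls M (g v)) p" using Los[OF g(1)] U_UNIV by simp
  moreover have "s = (\<lambda>v. cls M (g v))" using g(2) by blast
  ultimately show "sat (upower M) s p" by simp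
qed

lemma upower_diagonal:
  assumes "range s \<subseteq> carrier M"
  shows "sat (upower M) (\<lambda>v. cls M (\<lambda>_. s v)) \<phi> \<longleftrightarrow> sat M s \<phi>"
proof -
  have "(\<lambda>_. s v) \<in> seqs M" for v using assms by (auto simp: seqs_def)
  from Los[of "\<lambda>v _. s v", OF this] show ?thesis
    using U_UNIV U_empty by (cases "sat M s \<phi>") auto
qed

end

lemma upower_embedding:
  assumes M: "is_structure M" and N: "is_structure N" and f: "embedding M N f"
  shows "embedding (upower M) (upower N) (\<lambda>g. cls N (\<lambda>n. f (g n)))"
    "g \<in> seqs M \<Longrightarrow> cls N (\<lambda>n. f (cls M g n)) = cls N (\<lambda>n. f (g n))"
proof -
  have fs: "(\<lambda>n. f (g n)) \<in> seqs N" if "g \<in> seqs M" for g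
    using f that by (auto simp: seqs_def embedding_def)
  show fc: "cls N (\<lambda>n. f (cls M g n)) = cls N (\<lambda>n. f (g n))" if "g \<in> seqs M" for g
    using cls_eq_iff[OF fs[OF cls(1)[OF that]] fs[OF that]] eqv_map[OF cls(2)[OF that], of f] by blast
  have f': "f \<zero>\<^bsub>M\<^esub> = \<zero>\<^bsub>N\<^esub>" "f \<one>\<^bsub>M\<^esub> = \<one>\<^bsub>N\<^esub>" and inj: "inj_on f (carrier M)"
    using f by (auto simp: embedding_def)
  have hom: "(\<lambda>n. f (g n \<oplus>\<^bsub>M\<^esub> h n)) = (\<lambda>n. f (g n) \<oplus>\<^bsub>N\<^esub> f (h n))"
    "(\<lambda>n. f (g n \<otimes>\<^bsub>M\<^esub> h n)) = (\<lambda>n. f (g n) \<otimes>\<^bsub>N\<^esub> f (h n))"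
    "(\<lambda>n. f (neg M (g n))) = (\<lambda>n. neg N (f (g n)))"
    if "g \<in> seqs M" "h \<in> seqs M" for g h
    using f that by (auto simp: embedding_def seqs_def)
  show "embedding (upower M) (upower N) (\<lambda>g. cls N (\<lambda>n. f (g n)))"
    unfolding embedding_def
  proof (intro conjI ballI)
    show "(\<lambda>g. cls N (\<lambda>n. f (g n))) \<in> carrier (upower M) \<rightarrow> carrier (upower N)"
      using fs fc by (auto simp: upower_simps)
    show "inj_on (\<lambda>g. cls N (\<lambda>n. f (g n))) (carrier (upower M))"
    proof (rule inj_onI, unfold upower_simps, elim imageE)
      fix x y g h
      assume gh: "g \<in> seqs M" "h \<in> seqs M" "x = cls M g" "y = cls M h"
        and e: "cls N (\<lambda>n. f (x n)) = cls N (\<lambda>n. f (y n))"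
      then have "eqv (\<lambda>n. f (g n)) (\<lambda>n. f (h n))" using fc fs cls_eq_iff by metis
      moreover have "f (g n) = f (h n) \<longleftrightarrow> g n = h n" for n
        using inj gh by (auto simp: inj_on_def seqs_def)
      ultimately have "eqv g h" by (simp add: eqv_def)
      then show "x = y" using gh cls_eq_iff by blast
    qed
    show "cls N (\<lambda>n. f (\<zero>\<^bsub>upower M\<^esub> n)) = \<zero>\<^bsub>upower N\<^esub>" "cls N (\<lambda>n. f (\<one>\<^bsub>upower M\<^esub> n)) = \<one>\<^bsub>upower N\<^esub>"
      using fc[OF seqs_closed(1)[OF M]] fc[OF seqs_closed(2)[OF M]] by (simp_all add: upower_simps f')
    fix x assume "x \<in> carrier (upower M)"
    then obtain g where g: "g \<in> seqs M" "x = cls M g" by (auto simp: upower_simps)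
    show "cls N (\<lambda>n. f (neg (upower M) x n)) = neg (upower N) (cls N (\<lambda>n. f (x n)))"
      using g hom(3)[OF g(1) g(1)] fc fs by (simp add: upower_ops[OF M] upower_ops[OF N] seqs_closed[OF M])
    fix y assume "y \<in> carrier (upower M)"
    then obtain h where h: "h \<in> seqs M" "y = cls M h" by (auto simp: upower_simps)
    show "cls N (\<lambda>n. f ((x \<oplus>\<^bsub>upower M\<^esub> y) n)) = cls N (\<lambda>n. f (x n)) \<oplus>\<^bsub>upower N\<^esub> cls N (\<lambda>n. f (y n))"
      using g h hom(1)[OF g(1) h(1)] fc fs by (simp add: upower_ops[OF M] upower_ops[OF N] seqs_closed[OF M])
    show "cls N (\<lambda>n. f ((x \<otimes>\<^bsub>upower M\<^esub> y) n)) = cls N (\<lambda>n. f (x n)) \<otimes>\<^bsub>upower N\<^esub> cls N (\<lambda>n. f (y n))"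
      using g h hom(2)[OF g(1) h(1)] fc fs by (simp add: upower_ops[OF M] upower_ops[OF N] seqs_closed[OF M])
  qed
qed

end

section \<open>Gorenstein rings\<close>

text \<open>Each step of \<open>C\<close> is simple or trivial; omitting the trivial ones leaves a
  proper chain with simple steps. The last clause is for counting: if the chain keeps its full
  length, nothing was omitted.\<close>

lemma (in cring) comp_series_from_steps:
  assumes id: "\<And>i. i \<le> n \<Longrightarrow> ideal (C i) R" and zero: "C 0 = {\<zero>}"
    and sub: "\<And>i. i < n \<Longrightarrow> C i \<subseteq> C (Suc i)"
    and simple: "\<And>i J. i < n \<Longrightarrow> ideal J R \<Longrightarrow> C i \<subseteq> J \<Longrightarrow> J \<subseteq> C (Suc i) \<Longrightarrow> J = C i \<or> J = C (Suc i)"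
  shows "\<exists>k I. k \<le> n \<and> ideal_chain R k I \<and> I 0 = {\<zero>} \<and> I k = C n \<and>
    (\<forall>i < k. \<forall>J. ideal J R \<and> I i \<subseteq> J \<and> J \<subseteq> I (Suc i) \<longrightarrow> J = I i \<or> J = I (Suc i)) \<and>
    (k = n \<longrightarrow> (\<forall>i < n. C i \<noteq> C (Suc i)))"
  using id sub simple
proof (induction n)
  case 0
  then show ?case using zero by (intro exI[of _ 0] exI[of _ C]) (auto simp: ideal_chain_def)
next
  case (Suc n)
  obtain k I where k: "k \<le> n" "ideal_chain R k I" "I 0 = {\<zero>}" "I k = C n"
    "\<And>i J. i < k \<Longrightarrow> ideal J R \<Longrightarrow> I i \<subseteq> J \<Longrightarrow> J \<subseteq> I (Suc i) \<Longrightarrow> J = I i \<or> J = I (Suc i)"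
    "k = n \<Longrightarrow> \<forall>i < n. C i \<noteq> C (Suc i)"
    using Suc.IH[OF Suc.prems(1,2,3)] by (auto simp: less_SucI le_SucI)
  show ?case
  proof (cases "C n = C (Suc n)")
    case True
    then show ?thesis using k by (intro exI[of _ k] exI[of _ I]) auto
  next
    case False
    have s: "C n \<subset> C (Suc n)" using Suc.prems(2)[of n] False by auto
    let ?I = "I(Suc k := C (Suc n))"
    have 1: "ideal_chain R (Suc k) ?I"
      using k(2,4) s Suc.prems(1)[of "Suc n"] by (auto simp: ideal_chain_def le_Suc_eq less_Suc_eq)
    have 2: "J = ?I i \<or> J = ?I (Suc i)"
      if "i < Suc k" "ideal J R \<and> ?I i \<subseteq> J \<and> J \<subseteq> ?I (Suc i)" for i J
    proof (cases "i = k")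
      case True
      then show ?thesis using Suc.prems(3)[of n J] that k(4) by auto
    next
      case False
      then show ?thesis using k(5)[of i J] that by auto
    qed
    have 3: "\<forall>i < Suc n. C i \<noteq> C (Suc i)" if "Suc k = Suc n"
      using k(6) that False by (auto simp: less_Suc_eq)
    have 4: "Suc k \<le> Suc n" "?I 0 = {\<zero>}" "?I (Suc k) = C (Suc n)" using k(1,3) by auto
    show ?thesis
      using 2 3 by (intro exI[of _ "Suc k"] exI[of _ ?I] conjI 1 4) blast+
  qed
qed

lemma (in cring) annihilates_spanned:
  assumes "r \<in> carrier R" "\<And>j. j < i \<Longrightarrow> a j \<in> carrier R" "\<And>j. j < i \<Longrightarrow> r \<otimes> a j = \<zero>"
    and x: "x \<in> spanned R a i"
  shows "r \<otimes> x = \<zero>"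
proof -
  obtain c where c: "\<forall>j < i. c j \<in> carrier R" "x = lin R (\<lambda>j. c j \<otimes> a j) i"
    using x by (auto simp: spanned_def)
  have "r \<otimes> lin R (\<lambda>j. c j \<otimes> a j) i = \<zero>"
    using c(1) assms(2,3)
  proof (induction i)
    case 0
    then show ?case using assms(1) by simp
  next
    case (Suc i)
    have l: "lin R (\<lambda>j. c j \<otimes> a j) i \<in> carrier R" by (rule lin_closed) (use Suc.prems in auto)
    have ca: "c i \<in> carrier R" "a i \<in> carrier R" using Suc.prems by auto
    have "r \<otimes> (c i \<otimes> a i) = c i \<otimes> (r \<otimes> a i)" using ca assms(1) by (simp add: m_ac)
    then have "r \<otimes> (c i \<otimes> a i) = \<zero>" using Suc.prems ca by simp
    then show ?case using Suc l ca assms(1) by (simp add: r_distr)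
  qed
  then show ?thesis using c(2) by simp
qed

lemma (in local_series) length_l: "ring_length R = enat l"
proof -
  have "\<exists>I. comp_series l I"
    by (rule iffD2[OF length_iff[OF one_nz nonunits_add]])
      (use a_closed a_new nonunits_a spanned_all in \<open>auto intro!: exI[of _ a]\<close>)
  then show ?thesis using comp_series_length by blast
qed

text \<open>The map \<open>r \<mapsto> r a\<^sub>i\<close> embeds \<open>Ann(D\<^sub>i)/Ann(D\<^bsub>i+1\<^esub>)\<close> into the socle, which is simple;
  so the \<open>l\<close> steps of the chain of annihilators have length at most one each, and as
  their lengths add up to \<open>l\<close>, no step is trivial.\<close>

lemma (in local_series) annihilator_exists:
  assumes s: "s \<in> carrier R"
    and soc: "\<And>x. x \<in> carrier R \<Longrightarrow> (\<forall>y \<in> nonunits R. y \<otimes> x = \<zero>) \<longleftrightarrow> (\<exists>r \<in> carrier R. x = r \<otimes> s)"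
    and i: "i < l"
  shows "\<exists>r \<in> carrier R. (\<forall>x \<in> spanned R a i. r \<otimes> x = \<zero>) \<and> r \<otimes> a i \<noteq> \<zero>"
proof (rule ccontr)
  assume none: "\<not> ?thesis"
  let ?D = "spanned R a"
  define A where "A i = {r \<in> carrier R. \<forall>x \<in> ?D i. r \<otimes> x = \<zero>}" for i
  have Dc: "x \<in> carrier R" if "i \<le> l" "x \<in> ?D i" for i x
    using ideal.Icarr[OF spanned_is_ideal[OF that(1)] that(2)] .
  have A_ideal: "ideal (A i) R" if i: "i \<le> l" for i
  proof (rule idealI)
    show "ring R" by (rule ring_axioms)
    show "subgroup (A i) (add_monoid R)"
    proof (rule add.subgroupI)
      have "\<zero> \<in> A i" using Dc[OF i] by (auto simp: A_def)
      then show "A i \<noteq> {}" by blast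
      show "\<ominus> x \<in> A i" if "x \<in> A i" for x using that Dc[OF i] by (auto simp: A_def l_minus)
      show "x \<oplus> y \<in> A i" if "x \<in> A i" "y \<in> A i" for x y using that Dc[OF i] by (auto simp: A_def l_distr)
    qed (auto simp: A_def)
    have 1: "x \<otimes> y \<in> A i" if "y \<in> A i" "x \<in> carrier R" for x y
      using that Dc[OF i] by (auto simp: A_def m_assoc)
    show "x \<otimes> y \<in> A i" "y \<otimes> x \<in> A i" if "y \<in> A i" "x \<in> carrier R" for x y
      using 1[OF that] m_comm[of x y] that by (auto simp: A_def)
  qed
  have A_Suc: "A (Suc i) = {r \<in> A i. r \<otimes> a i = \<zero>}" if i: "i < l" for i
  proof
    have "spanned R a i \<subseteq> spanned R a (Suc i)" "a i \<in> spanned R a (Suc i)"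
      using spanned_step[of i a] a_closed i by auto
    then show "A (Suc i) \<subseteq> {r \<in> A i. r \<otimes> a i = \<zero>}" unfolding A_def by blast
    show "{r \<in> A i. r \<otimes> a i = \<zero>} \<subseteq> A (Suc i)"
    proof
      fix r assume r: "r \<in> {r \<in> A i. r \<otimes> a i = \<zero>}"
      have "r \<otimes> x = \<zero>" if x: "x \<in> spanned R a (Suc i)" for x
      proof -
        obtain s c where sc: "s \<in> spanned R a i" "c \<in> carrier R" "x = s \<oplus> c \<otimes> a i"
          using x mem_spanned_Suc[OF i] by blast
        have c: "r \<in> carrier R" "s \<in> carrier R" "a i \<in> carrier R"
          using r Dc[OF _ sc(1)] a_closed[OF i] i by (auto simp: A_def)
        have "r \<otimes> x = r \<otimes> s \<oplus> c \<otimes> (r \<otimes> a i)" unfolding sc(3) using c sc(2) by algebra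
        then show ?thesis using r sc(1,2) by (simp add: A_def)
      qed
      then show "r \<in> A (Suc i)" using r by (simp add: A_def)
    qed
  qed
  have ms: "y \<otimes> s = \<zero>" if "y \<in> nonunits R" for y
  proof -
    have "s = \<one> \<otimes> s" using s by simp
    then have "\<exists>r \<in> carrier R. s = r \<otimes> s" using one_closed by blast
    then show ?thesis using soc[OF s] that by blast
  qed
  have simple: "J = A i \<or> J = A (Suc i)"
    if i: "i < l" and J: "ideal J R" "A (Suc i) \<subseteq> J" "J \<subseteq> A i" for i J
  proof (cases "J \<subseteq> A (Suc i)")
    case False
    interpret J: ideal J R by (rule J(1))
    have ai: "a i \<in> carrier R" using a_closed[OF i] .
    have soc_mem: "\<exists>c \<in> carrier R. r \<otimes> a i = c \<otimes> s" if r: "r \<in> A i" for r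
    proof -
      have rc: "r \<in> carrier R" using r by (simp add: A_def)
      have "y \<otimes> (r \<otimes> a i) = \<zero>" if y: "y \<in> nonunits R" for y
      proof -
        have "y \<in> carrier R" using y by (simp add: nonunits_def)
        then have "y \<otimes> (r \<otimes> a i) = r \<otimes> (y \<otimes> a i)" using rc ai by (simp add: m_ac)
        then show ?thesis using r nonunits_a[OF i y] by (simp add: A_def)
      qed
      then show ?thesis using soc[of "r \<otimes> a i"] rc ai by simp
    qed
    obtain z where z: "z \<in> J" "z \<notin> A (Suc i)" using False by blast
    then have zA: "z \<in> A i" "z \<otimes> a i \<noteq> \<zero>" using J(3) A_Suc[OF i] by auto
    then have zc: "z \<in> carrier R" by (simp add: A_def)
    obtain c where c: "c \<in> carrier R" "z \<otimes> a i = c \<otimes> s" using soc_mem[OF zA(1)] by blast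
    have "c \<notin> nonunits R" using ms c zA(2) by auto
    then obtain u where u: "u \<in> carrier R" "u \<otimes> c = \<one>" using unit_inverse c(1) by blast
    have "x \<in> J" if x: "x \<in> A i" for x
    proof -
      obtain d where d: "d \<in> carrier R" "x \<otimes> a i = d \<otimes> s" using soc_mem[OF x] by blast
      have xc: "x \<in> carrier R" using x by (simp add: A_def)
      \<comment> \<open>Multiplication by \<open>a i\<close> sends \<open>x\<close> to
        \<open>d s\<close> and \<open>z\<close> to \<open>c s\<close>, where \<open>u\<close>
        inverts \<open>c\<close>; subtracting \<open>d u z\<close> from \<open>x\<close> therefore
        leaves something that kills \<open>a i\<close>.\<close>
      let ?w = "x \<ominus> (d \<otimes> u) \<otimes> z"
      have "(d \<otimes> u) \<otimes> z \<otimes> a i = (d \<otimes> u) \<otimes> (z \<otimes> a i)" using d u zc ai by (simp add: m_assoc)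
      also have "\<dots> = d \<otimes> (u \<otimes> c) \<otimes> s" unfolding c(2) using d(1) u(1) c(1) s by (simp add: m_assoc)
      also have "\<dots> = x \<otimes> a i" using d u by simp
      finally have e: "(d \<otimes> u) \<otimes> z \<otimes> a i = x \<otimes> a i" .
      have duz: "(d \<otimes> u) \<otimes> z \<in> J" using J.I_l_closed[OF z(1)] d u by simp
      have duzc: "(d \<otimes> u) \<otimes> z \<in> carrier R" using d u zc by simp
      have "?w \<otimes> a i = x \<otimes> a i \<ominus> (d \<otimes> u) \<otimes> z \<otimes> a i" using xc ai duzc by algebra
      then have "?w \<otimes> a i = \<zero>" unfolding e using xc ai by (simp add: minus_eq r_neg)
      moreover have "?w \<in> A i" using ideal_diff[OF A_ideal x] duz J(3) i by auto
      ultimately have "?w \<in> J" using A_Suc[OF i] J(2) by blast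
      then have "?w \<oplus> (d \<otimes> u) \<otimes> z \<in> J" using duz J.a_closed by blast
      moreover have "?w \<oplus> (d \<otimes> u) \<otimes> z = x" using xc duzc by algebra
      ultimately show ?thesis by simp
    qed
    then show ?thesis using J(3) by blast
  qed (use J in blast)
  have "A l = {\<zero>}"
  proof -
    have "r = \<zero>" if "r \<in> A l" for r
    proof -
      have "r \<in> carrier R" using that by (simp add: A_def)
      moreover have "r \<otimes> \<one> = \<zero>" using that one_closed unfolding A_def spanned_l by blast
      ultimately show ?thesis by simp
    qed
    moreover have "\<zero> \<in> A l" by (simp add: A_def spanned_l)
    ultimately show ?thesis by blast
  qed
  moreover have "A 0 = carrier R" by (auto simp: A_def spanned_0)
  moreover have "A i = A (Suc i)" using none i A_Suc[OF i] by (auto simp: A_def)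
  \<comment> \<open>Annihilators shrink as the ideals grow, so the index is reversed to ascend from
    zero to the whole ring.\<close>
  moreover define C where "C j = A (l - j)" for j
  moreover have "\<exists>k I. k \<le> l \<and> ideal_chain R k I \<and> I 0 = {\<zero>} \<and> I k = C l \<and>
    (\<forall>i < k. \<forall>J. ideal J R \<and> I i \<subseteq> J \<and> J \<subseteq> I (Suc i) \<longrightarrow> J = I i \<or> J = I (Suc i)) \<and>
    (k = l \<longrightarrow> (\<forall>i < l. C i \<noteq> C (Suc i)))"
  proof (rule comp_series_from_steps)
    show "ideal (C j) R" if "j \<le> l" for j using A_ideal by (simp add: C_def)
    show "C 0 = {\<zero>}" using \<open>A l = {\<zero>}\<close> by (simp add: C_def)
    show "C j \<subseteq> C (Suc j)" if j: "j < l" for j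
    proof -
      have "l - j = Suc (l - Suc j)" using j by simp
      then show ?thesis using A_Suc[of "l - Suc j"] j by (simp add: C_def)
    qed
    show "J = C j \<or> J = C (Suc j)" if j: "j < l" and J: "ideal J R" "C j \<subseteq> J" "J \<subseteq> C (Suc j)" for j J
    proof -
      have e: "l - j = Suc (l - Suc j)" using j by simp
      show ?thesis using simple[of "l - Suc j" J] J j unfolding C_def e by auto
    qed
  qed
  ultimately obtain k I where k: "ideal_chain R k I" "I 0 = {\<zero>}" "I k = carrier R"
    "\<forall>i < k. \<forall>J. ideal J R \<and> I i \<subseteq> J \<and> J \<subseteq> I (Suc i) \<longrightarrow> J = I i \<or> J = I (Suc i)"
    "k = l \<longrightarrow> (\<forall>i < l. C i \<noteq> C (Suc i))" by auto
  have "comp_series k I" using k by (simp add: comp_series_def)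
  then have "k = l" using comp_series_length length_l by fastforce
  then have "C (l - Suc i) \<noteq> C (Suc (l - Suc i))" using k(5) i by simp
  moreover have "Suc (l - Suc i) = l - i" using i by simp
  ultimately show False using \<open>A i = A (Suc i)\<close> i by (simp add: C_def)
qed

text \<open>The images of a composition series generate one again: \<open>f a\<^sub>i\<close> is new because
  \<open>f r\<close> separates it from its predecessors, where \<open>r\<close> is as in the preceding lemma.\<close>

lemma local_series_image:
  assumes "local_series M l a" and "ring_hom_cring M N f" and inj: "inj_on f (carrier M)"
    and one: "\<zero>\<^bsub>N\<^esub> \<noteq> \<one>\<^bsub>N\<^esub>"
    and add: "\<And>x y. x \<in> nonunits N \<Longrightarrow> y \<in> nonunits N \<Longrightarrow> x \<oplus>\<^bsub>N\<^esub> y \<in> nonunits N"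
    and len: "ring_length N = enat l"
    and s: "s \<in> carrier M"
    and soc: "\<And>x. x \<in> carrier M \<Longrightarrow> (\<forall>y \<in> nonunits M. y \<otimes>\<^bsub>M\<^esub> x = \<zero>\<^bsub>M\<^esub>) \<longleftrightarrow> (\<exists>r \<in> carrier M. x = r \<otimes>\<^bsub>M\<^esub> s)"
  shows "local_series N l (\<lambda>i. f (a i))"
proof -
  interpret M: local_series M l a by fact
  interpret N: cring N using assms(2) by (rule ring_hom_cring.axioms(2))
  interpret f: ring_hom_cring M N f by fact
  let ?b = "\<lambda>i. f (a i)"
  let ?D = "spanned N ?b"
  have b: "?b i \<in> carrier N" if "i < l" for i using M.a_closed[OF that] by simp
  have D: "ideal (?D i) N" if "i \<le> l" for i by (rule N.spanned_ideal) (use b that in auto)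
  have new: "?b i \<notin> ?D i" if i: "i < l" for i
  proof
    assume bi: "?b i \<in> ?D i"
    obtain r where r: "r \<in> carrier M" "\<And>x. x \<in> spanned M a i \<Longrightarrow> r \<otimes>\<^bsub>M\<^esub> x = \<zero>\<^bsub>M\<^esub>" "r \<otimes>\<^bsub>M\<^esub> a i \<noteq> \<zero>\<^bsub>M\<^esub>"
      using M.annihilator_exists[OF s soc i] by blast
    have aj: "a j \<in> spanned M a i" if "j < i" for j
      using M.generator_mem_spanned[OF that] M.a_closed i by simp
    have "f r \<otimes>\<^bsub>N\<^esub> ?b i = \<zero>\<^bsub>N\<^esub>"
    proof (rule N.annihilates_spanned[OF _ _ _ bi])
      show "f r \<in> carrier N" using r by simp
      show "?b j \<in> carrier N" if "j < i" for j using b that i by simp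
      show "f r \<otimes>\<^bsub>N\<^esub> ?b j = \<zero>\<^bsub>N\<^esub>" if "j < i" for j
        using f.hom_mult[OF r(1), of "a j"] r(2)[OF aj[OF that]] M.a_closed that i by simp
    qed
    then have "f (r \<otimes>\<^bsub>M\<^esub> a i) = f \<zero>\<^bsub>M\<^esub>" using r(1) M.a_closed[OF i] by simp
    then have "r \<otimes>\<^bsub>M\<^esub> a i = \<zero>\<^bsub>M\<^esub>" using inj_onD[OF inj] r(1) M.a_closed[OF i] by simp
    then show False using r(3) by simp
  qed
  have strict: "?D i \<subset> ?D (Suc i) \<and> ?b i \<in> ?D (Suc i)" if i: "i < l" for i
    using N.spanned_step[of i ?b] b i new[OF i] by auto
  have "ideal_chain N l ?D" using D strict by (auto simp: ideal_chain_def)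
  \<comment> \<open>Here the length of \<open>N\<close> enters: the \<open>l\<close> strict
    inclusions exhaust it, so the chain admits no refinement.\<close>
  moreover have "\<not> ideal_chain N (Suc l) I" for I
  proof
    assume "ideal_chain N (Suc l) I"
    then have "enat (Suc l) \<le> ring_length N" unfolding ring_length_def by (intro Sup_upper) blast
    then show False using len by simp
  qed
  ultimately have cs: "N.comp_series l ?D" by (rule N.comp_seriesI)
  have kill: "x \<otimes>\<^bsub>N\<^esub> ?b i \<in> ?D i" if i: "i < l" and x: "x \<in> nonunits N" for i x
  proof (rule ccontr)
    assume n: "x \<otimes>\<^bsub>N\<^esub> ?b i \<notin> ?D i"
    interpret A: ideal "?D i" N using D i by simp
    interpret B: ideal "?D (Suc i)" N using D i by simp
    have xc: "x \<in> carrier N" using x by (simp add: nonunits_def)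
    have bi: "?b i \<in> ?D (Suc i)" using strict[OF i] by blast
    obtain j r where jr: "j \<in> ?D i" "r \<in> carrier N" "?b i = j \<oplus>\<^bsub>N\<^esub> r \<otimes>\<^bsub>N\<^esub> (x \<otimes>\<^bsub>N\<^esub> ?b i)"
      using N.comp_series_step[OF cs i B.I_l_closed[OF bi xc] n bi] by blast
    \<comment> \<open>The Nakayama argument: \<open>u = 1 - r x\<close> is a unit since
      \<open>x\<close> is a nonunit, and \<open>u\<close> times the new generator would equal
      \<open>j\<close>, which lies in the ideal of its predecessors.\<close>
    define u where "u = \<one>\<^bsub>N\<^esub> \<ominus>\<^bsub>N\<^esub> r \<otimes>\<^bsub>N\<^esub> x"
    have c: "u \<in> carrier N" "j \<in> carrier N" "r \<otimes>\<^bsub>N\<^esub> x \<in> carrier N" "?b i \<in> carrier N"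
      using xc jr A.a_Hcarr b[OF i] by (auto simp: u_def)
    have "u \<notin> nonunits N"
    proof
      assume "u \<in> nonunits N"
      then have "u \<oplus>\<^bsub>N\<^esub> r \<otimes>\<^bsub>N\<^esub> x \<in> nonunits N" using add N.mult_nonunit[OF x jr(2)] by blast
      moreover have "u \<oplus>\<^bsub>N\<^esub> r \<otimes>\<^bsub>N\<^esub> x = \<one>\<^bsub>N\<^esub>" unfolding u_def using c(3) by algebra
      ultimately show False by (auto simp: nonunits_def)
    qed
    then obtain v where v: "v \<in> carrier N" "u \<otimes>\<^bsub>N\<^esub> v = \<one>\<^bsub>N\<^esub>" using c(1) by (auto simp: nonunits_def)
    have "u \<otimes>\<^bsub>N\<^esub> ?b i = ?b i \<ominus>\<^bsub>N\<^esub> r \<otimes>\<^bsub>N\<^esub> (x \<otimes>\<^bsub>N\<^esub> ?b i)" unfolding u_def using xc jr(2) c(4) by algebra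
    also have "\<dots> = (j \<oplus>\<^bsub>N\<^esub> r \<otimes>\<^bsub>N\<^esub> (x \<otimes>\<^bsub>N\<^esub> ?b i)) \<ominus>\<^bsub>N\<^esub> r \<otimes>\<^bsub>N\<^esub> (x \<otimes>\<^bsub>N\<^esub> ?b i)" using jr(3) by simp
    also have "\<dots> = j" using xc jr(2) c by algebra
    finally have "v \<otimes>\<^bsub>N\<^esub> (u \<otimes>\<^bsub>N\<^esub> ?b i) \<in> ?D i" using A.I_l_closed[OF jr(1) v(1)] by simp
    moreover have "v \<otimes>\<^bsub>N\<^esub> (u \<otimes>\<^bsub>N\<^esub> ?b i) = (u \<otimes>\<^bsub>N\<^esub> v) \<otimes>\<^bsub>N\<^esub> ?b i" using v(1) c by algebra
    ultimately show False using new[OF i] v c by simp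
  qed
  show ?thesis
  proof unfold_locales
    show "carrier N \<subseteq> ?D l" using cs by (simp add: N.comp_series_def)
  qed (use one add b new kill in auto)
qed

section \<open>Model completeness\<close>

lemma (in cring) vanishing_polynomial:
  assumes "set ys \<subseteq> carrier R"
  shows "\<exists>p. set p \<subseteq> carrier R \<and> length p = Suc (length ys) \<and> hd p = \<one> \<and>
    (\<forall>x \<in> carrier R. \<forall>y \<in> set ys. \<exists>w \<in> carrier R. eval p x = (x \<ominus> y) \<otimes> w)"
  using assms
proof (induction ys)
  case Nil
  show ?case by (intro exI[of _ "[\<one>]"]) simp
next
  case (Cons y ys)
  then obtain p where p: "set p \<subseteq> carrier R" "length p = Suc (length ys)" "hd p = \<one>"
    "\<And>x z. x \<in> carrier R \<Longrightarrow> z \<in> set ys \<Longrightarrow> \<exists>w \<in> carrier R. eval p x = (x \<ominus> z) \<otimes> w" by auto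
  have y: "y \<in> carrier R" using Cons.prems by simp
  have "set (p @ [\<zero>]) \<subseteq> carrier R" "set (map ((\<otimes>) (\<ominus> y)) p) \<subseteq> carrier R" using p y by auto
  from eval_add_exists[OF this carrier_is_subring] obtain r where r: "set r \<subseteq> carrier R"
    "length r = Suc (length p)" "hd r = hd (p @ [\<zero>])"
    "\<And>x. x \<in> carrier R \<Longrightarrow> eval r x = eval (p @ [\<zero>]) x \<oplus> eval (map ((\<otimes>) (\<ominus> y)) p) x" by auto
  have e: "eval r x = (x \<ominus> y) \<otimes> eval p x" if x: "x \<in> carrier R" for x
  proof -
    have px: "eval p x \<in> carrier R" using eval_in_carrier p(1) x by blast
    have "eval r x = (eval p x \<otimes> x \<oplus> \<zero>) \<oplus> \<ominus> y \<otimes> eval p x"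
      using r(4)[OF x] eval_append_aux[OF p(1) zero_closed x] eval_map_mult[OF p(1) _ x, of "\<ominus> y"] y by simp
    also have "\<dots> = (x \<ominus> y) \<otimes> eval p x" using px x y by algebra
    finally show ?thesis .
  qed
  have "\<exists>w \<in> carrier R. eval r x = (x \<ominus> z) \<otimes> w" if x: "x \<in> carrier R" and z: "z \<in> set (y # ys)" for x z
  proof (cases "z = y")
    case True
    then show ?thesis using e[OF x] eval_in_carrier[OF p(1) x] by blast
  next
    case False
    then have zs: "z \<in> set ys" using z by simp
    obtain w where w: "w \<in> carrier R" "eval p x = (x \<ominus> z) \<otimes> w" using p(4)[OF x zs] by blast
    have zc: "z \<in> carrier R" using Cons.prems zs by auto
    have "eval r x = (x \<ominus> z) \<otimes> ((x \<ominus> y) \<otimes> w)" unfolding e[OF x] w(2) using x y zc w(1) by algebra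
    moreover have "(x \<ominus> y) \<otimes> w \<in> carrier R" using x y w by simp
    ultimately show ?thesis by blast
  qed
  moreover have "hd r = \<one>" using r(3) p(2,3) by (cases p) auto
  moreover have "length r = Suc (length (y # ys))" using r(2) p(2) by simp
  ultimately show ?case using r(1) by blast
qed

text \<open>A root modulo \<open>Q\<close> of 1 plus the product of the factors
  \<open>X - y\<close>, \<open>y\<close> in \<open>F\<close>, is congruent to no element of
  \<open>F\<close>: otherwise 1 would lie in \<open>Q\<close>.\<close>

lemma (in cring) infinite_residues:
  assumes Q: "primeideal Q R"
    and roots: "\<And>r. set r \<subseteq> carrier R \<Longrightarrow> r \<noteq> [] \<Longrightarrow> \<exists>x \<in> carrier R. eval (\<one> # r) x \<in> Q"
    and F: "finite F" "F \<subseteq> carrier R"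
  shows "\<exists>x \<in> carrier R. \<forall>y \<in> F. x \<ominus> y \<notin> Q"
proof (cases "F = {}")
  case False
  interpret Q: primeideal Q R by fact
  obtain ys where ys: "set ys = F" using F(1) finite_list by blast
  then obtain p where p: "set p \<subseteq> carrier R" "length p = Suc (length ys)" "hd p = \<one>"
    "\<And>x y. x \<in> carrier R \<Longrightarrow> y \<in> F \<Longrightarrow> \<exists>w \<in> carrier R. eval p x = (x \<ominus> y) \<otimes> w"
    using vanishing_polynomial[of ys] F(2) by auto
  have len: "length p > 1" using p(2) ys False by (cases ys) auto
  have "set [\<one>] \<subseteq> carrier R" by simp
  from eval_add_exists[OF p(1) this carrier_is_subring] len obtain r where r: "set r \<subseteq> carrier R"
    "length r = length p" "hd r = hd p" "\<And>x. x \<in> carrier R \<Longrightarrow> eval r x = eval p x \<oplus> eval [\<one>] x" by auto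
  obtain r' where r': "r = \<one> # r'" using r(2,3) p(3) len by (cases r) auto
  have "r' \<noteq> []" "set r' \<subseteq> carrier R" using r' r(1,2) len by auto
  then obtain x where x: "x \<in> carrier R" "eval r x \<in> Q" using roots[of r'] r' by blast
  then have px: "eval p x \<oplus> \<one> \<in> Q" using r(4) by simp
  have "x \<ominus> y \<notin> Q" if y: "y \<in> F" for y
  proof
    assume *: "x \<ominus> y \<in> Q"
    obtain w where "w \<in> carrier R" "eval p x = (x \<ominus> y) \<otimes> w" using p(4)[OF x(1) y] by blast
    then have "eval p x \<in> Q" using Q.I_r_closed[OF *] by simp
    then have "\<one> \<in> Q" using ideal_cancel[OF Q.is_ideal refl px _ one_closed] by blast
    then show False using Q.one_imp_carrier Q.I_notcarr by blast
  qed
  then show ?thesis using x(1) by blast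
qed blast

lemma Gor_model:
  assumes "is_model M (Gor l)"
  shows "is_structure M" "cring M" "\<And>x. x \<in> carrier M \<Longrightarrow> neg M x = \<ominus>\<^bsub>M\<^esub> x"
    "\<And>x y. x \<in> nonunits M \<Longrightarrow> y \<in> nonunits M \<Longrightarrow> x \<oplus>\<^bsub>M\<^esub> y \<in> nonunits M" "\<zero>\<^bsub>M\<^esub> \<noteq> \<one>\<^bsub>M\<^esub>"
    "\<exists>a. local_series M l a"
    "\<exists>s \<in> carrier M. \<forall>x \<in> carrier M.
       (\<forall>y \<in> nonunits M. y \<otimes>\<^bsub>M\<^esub> x = \<zero>\<^bsub>M\<^esub>) \<longleftrightarrow> (\<exists>r \<in> carrier M. x = r \<otimes>\<^bsub>M\<^esub> s)"
    "\<And>r. set r \<subseteq> carrier M \<Longrightarrow> r \<noteq> [] \<Longrightarrow>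
       \<exists>x \<in> carrier M. ring.eval M (\<one>\<^bsub>M\<^esub> # r) x \<in> nonunits M"
    "ring_length M = enat l"
proof -
  have sat: "is_structure M" "\<And>p s. p \<in> Gor l \<Longrightarrow> sat M s p"
    using assms by (auto simp: is_model_Gor_iff_sat)
  show "is_structure M" by (rule sat(1))
  have ne: "carrier M \<noteq> {}" using sat(1) by (auto simp: is_structure_def)
  have "\<forall>p \<in> ring_axs. \<forall>s. sat M s p" using sat(2) by (simp add: Gor_def)
  then have "cring M \<and> (\<forall>x \<in> carrier M. neg M x = \<ominus>\<^bsub>M\<^esub> x)" unfolding ring_axs_iff[OF sat(1)] .
  then show cr: "cring M" and "\<And>x. x \<in> carrier M \<Longrightarrow> neg M x = \<ominus>\<^bsub>M\<^esub> x" by auto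
  interpret cring M by (rule cr)
  have "\<forall>s. sat M s local_ax" using sat(2) by (simp add: Gor_def)
  then show add: "\<And>x y. x \<in> nonunits M \<Longrightarrow> y \<in> nonunits M \<Longrightarrow> x \<oplus>\<^bsub>M\<^esub> y \<in> nonunits M"
    and one: "\<zero>\<^bsub>M\<^esub> \<noteq> \<one>\<^bsub>M\<^esub>"
    unfolding local_ax_iff by (auto simp: nonunits_def)
  have "\<forall>s. sat M s (length_ax l)" using sat(2) by (simp add: Gor_def)
  then have "\<exists>a. (\<forall>i < l. a i \<in> carrier M) \<and>
    (\<forall>i < l. a i \<notin> spanned M a i \<and> (\<forall>x \<in> nonunits M. x \<otimes>\<^bsub>M\<^esub> a i \<in> spanned M a i)) \<and>
    carrier M \<subseteq> spanned M a l" by (rule iffD1[OF length_ax_iff[OF ne]])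
  then obtain a where a: "\<forall>i < l. a i \<in> carrier M"
    "\<forall>i < l. a i \<notin> spanned M a i \<and> (\<forall>x \<in> nonunits M. x \<otimes>\<^bsub>M\<^esub> a i \<in> spanned M a i)"
    "carrier M \<subseteq> spanned M a l" by (elim exE conjE)
  have "local_series M l a" by unfold_locales (use one add a in auto)
  then show "\<exists>a. local_series M l a" by (rule exI[where x = a])
  have "\<forall>s. sat M s gorenstein_ax" using sat(2) by (simp add: Gor_def)
  then show "\<exists>s \<in> carrier M. \<forall>x \<in> carrier M.
       (\<forall>y \<in> nonunits M. y \<otimes>\<^bsub>M\<^esub> x = \<zero>\<^bsub>M\<^esub>) \<longleftrightarrow> (\<exists>r \<in> carrier M. x = r \<otimes>\<^bsub>M\<^esub> s)"
    unfolding gorenstein_ax_iff .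
  have "\<forall>n \<ge> 1. \<forall>s. sat M s (alg_closed_ax n)" using sat(2) by (auto simp: Gor_def)
  then have "\<forall>r. set r \<subseteq> carrier M \<and> r \<noteq> [] \<longrightarrow> (\<exists>x \<in> carrier M. eval (\<one>\<^bsub>M\<^esub> # r) x \<in> nonunits M)"
    unfolding alg_closed_ax_iff[OF sat(1)] monic_roots_iff[symmetric] .
  then show "\<And>r. set r \<subseteq> carrier M \<Longrightarrow> r \<noteq> [] \<Longrightarrow>
       \<exists>x \<in> carrier M. eval (\<one>\<^bsub>M\<^esub> # r) x \<in> nonunits M" by blast
  show "ring_length M = enat l" using assms unfolding is_model_Gor_iff gor_class_def by blast
qed

lemma elementary_if_uncountable:
  assumes M: "is_model M (Gor l)" and N: "is_model N (Gor l)" and f: "embedding M N f"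
    and bigM: "\<not> cring.countable_mod M (nonunits M) (carrier M)"
    and bigN: "\<not> cring.countable_mod N (nonunits N) (carrier N)"
  shows "elementary M N f"
proof -
  obtain a where "local_series M l a" using Gor_model(6)[OF M] by blast
  then interpret M: local_series M l a .
  interpret N: cring N by (rule Gor_model(2)[OF N])
  have hom: "f \<in> ring_hom M N" and inj: "inj_on f (carrier M)"
    using f by (auto simp: embedding_def ring_hom_def)
  interpret f: ring_hom_cring M N f by unfold_locales (rule hom)
  obtain s where s: "s \<in> carrier M" "\<And>x. x \<in> carrier M \<Longrightarrow>
     (\<forall>y \<in> nonunits M. y \<otimes>\<^bsub>M\<^esub> x = \<zero>\<^bsub>M\<^esub>) \<longleftrightarrow> (\<exists>r \<in> carrier M. x = r \<otimes>\<^bsub>M\<^esub> s)"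
    using Gor_model(7)[OF M] by blast
  interpret N: local_series N l "\<lambda>i. f (a i)"
    by (rule local_series_image[OF M.local_series_axioms f.ring_hom_cring_axioms inj
          Gor_model(5,4,9)[OF N] s])
  interpret M: residually_closed M l a
    by unfold_locales (use Gor_model(8)[OF M] bigM in auto)
  interpret N: residually_closed N l "\<lambda>i. f (a i)"
    by unfold_locales (use Gor_model(8)[OF N] bigN in auto)
  interpret ring_pair M N l a f by unfold_locales
  show ?thesis unfolding elementary_def
  proof (intro allI impI)
    fix \<phi> and t :: "nat \<Rightarrow> 'a" assume t: "range t \<subseteq> carrier M"
    \<comment> \<open>An assignment has countably many values, so a single graph contains all pairs
      of \<open>t v\<close> and its image.\<close>
    obtain \<G> G0 where \<G>: "back_and_forth_system M N \<G>" "G0 \<in> \<G>" "emb ` range t \<subseteq> G0"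
      using partial_isomorphisms[OF _ t] by auto
    show "sat M t \<phi> \<longleftrightarrow> sat N (f \<circ> t) \<phi>"
      by (rule back_and_forth[OF Gor_model(2)[OF M] Gor_model(2)[OF N] Gor_model(3)[OF M] Gor_model(3)[OF N] \<G>(1,2)])
        (use \<G>(3) in \<open>auto simp: emb_def\<close>)
  qed
qed

text \<open>Congruence modulo the maximal ideal is first-order, so the theorem of Los can be applied
  to it.\<close>

lemma nonunits_diff_sat:
  assumes "is_structure M" "\<And>x. x \<in> carrier M \<Longrightarrow> neg M x = \<ominus>\<^bsub>M\<^esub> x"
    "x \<in> carrier M" "y \<in> carrier M"
  shows "x \<ominus>\<^bsub>M\<^esub> y \<in> nonunits M \<longleftrightarrow>
    sat M (\<lambda>v. if v = 0 then x else y) (nonunit_fm 2 (Plus (Var 0) (Minus (Var 1))))"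
proof -
  have "x \<ominus>\<^bsub>M\<^esub> y = x \<oplus>\<^bsub>M\<^esub> neg M y" using assms by (simp add: a_minus_def)
  moreover have "x \<oplus>\<^bsub>M\<^esub> neg M y \<in> carrier M" using assms by (simp add: is_structure_def)
  ultimately show ?thesis by (simp add: sat_nonunit_fm nonunits_def)
qed

text \<open>Diagonalisation: against countably many classes \<open>g i\<close>, choose
  \<open>h n\<close> incongruent to \<open>g i n\<close> for all \<open>i \<le> n\<close>. For fixed
  \<open>i\<close> this covers a tail, which belongs to \<open>U\<close>, so \<open>h\<close> is
  incongruent to every \<open>g i\<close>.\<close>

lemma (in ultrapower) upower_residues_uncountable:
  assumes M: "is_model M (Gor l)"
  shows "\<not> cring.countable_mod (upower M) (nonunits (upower M)) (carrier (upower M))"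
proof
  note str = Gor_model(1)[OF M]
  have MU: "is_model (upower M) (Gor l)" by (rule upower_model[OF str M])
  obtain a where "local_series M l a" using Gor_model(6)[OF M] by blast
  then interpret M: local_series M l a .
  interpret MU: cring "upower M" by (rule Gor_model(2)[OF MU])
  assume "MU.countable_mod (nonunits (upower M)) (carrier (upower M))"
  then obtain C where C: "countable C" "C \<subseteq> carrier (upower M)"
    "\<And>x. x \<in> carrier (upower M) \<Longrightarrow> \<exists>c \<in> C. MU.mod_eq (nonunits (upower M)) x c"
    unfolding MU.countable_mod_def by blast
  have "C \<noteq> {}" using C(3)[OF MU.one_closed] by auto
  then have e: "range (from_nat_into C) = C" using C(1) by (rule range_from_nat_into)
  have "\<exists>g. g \<in> seqs M \<and> from_nat_into C i = cls M g" for i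
  proof -
    have "from_nat_into C i \<in> carrier (upower M)" using e C(2) by blast
    then show ?thesis by (auto simp: upower_simps)
  qed
  then obtain g where g: "\<And>i. g i \<in> seqs M" "\<And>i. from_nat_into C i = cls M (g i)" by metis
  have gc: "g i n \<in> carrier M" for i n using g(1) by (simp add: seqs_def)
  have "\<exists>x \<in> carrier M. \<forall>y \<in> (\<lambda>i. g i n) ` {..n}. x \<ominus>\<^bsub>M\<^esub> y \<notin> nonunits M" for n
    by (rule M.infinite_residues[OF M.nonunits_prime Gor_model(8)[OF M]]) (use gc in auto)
  then obtain h where h: "\<And>n. h n \<in> carrier M" "\<And>n i. i \<le> n \<Longrightarrow> h n \<ominus>\<^bsub>M\<^esub> g i n \<notin> nonunits M"
    unfolding ball_simps by (metis atMost_iff)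
  have hs: "h \<in> seqs M" using h(1) by (simp add: seqs_def)
  then have hc: "cls M h \<in> carrier (upower M)" by (simp add: upower_simps)
  then obtain c where c: "c \<in> C" "MU.mod_eq (nonunits (upower M)) (cls M h) c" using C(3) by blast
  then have "c \<in> range (from_nat_into C)" using e by simp
  then obtain i where i: "c = cls M (g i)" using g(2) by auto
  let ?\<phi> = "nonunit_fm 2 (Plus (Var 0) (Minus (Var 1)))"
  have "cls M h \<ominus>\<^bsub>upower M\<^esub> cls M (g i) \<in> nonunits (upower M)" using c(2) i by (simp add: MU.mod_eq_def)
  then have "sat (upower M) (\<lambda>v. if v = 0 then cls M h else cls M (g i)) ?\<phi>"
    using nonunits_diff_sat[OF Gor_model(1,3)[OF MU] hc, of "cls M (g i)"] C(2) c(1) i by blast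
  moreover have "(\<lambda>v :: nat. if v = 0 then cls M h else cls M (g i)) = (\<lambda>v. cls M (if v = 0 then h else g i))"
    by auto
  ultimately have "{n. sat M (\<lambda>v. (if v = 0 then h else g i) n) ?\<phi>} \<in> U"
    using Los[OF str, of "\<lambda>v. if v = 0 then h else g i" ?\<phi>] hs g(1) by simp
  then have "{n. h n \<ominus>\<^bsub>M\<^esub> g i n \<in> nonunits M} \<in> U"
  proof (rule U_mono)
    have "sat M (\<lambda>v. (if v = 0 then h else g i) n) ?\<phi> \<longleftrightarrow> h n \<ominus>\<^bsub>M\<^esub> g i n \<in> nonunits M" for n
    proof -
      have "(\<lambda>v :: nat. (if v = 0 then h else g i) n) = (\<lambda>v. if v = 0 then h n else g i n)" by auto
      then show ?thesis using nonunits_diff_sat[OF str Gor_model(3)[OF M] h(1) gc] by simp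
    qed
    then show "{n. sat M (\<lambda>v. (if v = 0 then h else g i) n) ?\<phi>} \<subseteq> {n. h n \<ominus>\<^bsub>M\<^esub> g i n \<in> nonunits M}" by blast
  qed
  then have "{n. h n \<ominus>\<^bsub>M\<^esub> g i n \<in> nonunits M} \<inter> {i..} \<in> U" using U_tail U_Int by blast
  moreover have "{n. h n \<ominus>\<^bsub>M\<^esub> g i n \<in> nonunits M} \<inter> {i..} = {}" using h(2) by auto
  ultimately show False using U_empty by simp
qed

theorem theorem4p3:
  fixes l :: nat
  assumes "l \<ge> 1"
  shows "model_complete TYPE('a) TYPE('b) (Gor l)"
  unfolding model_complete_def
proof (intro allI impI)
  fix M :: "'a ring_structure" and N :: "'b ring_structure" and f
  assume "is_model M (Gor l) \<and> is_model N (Gor l) \<and> embedding M N f"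
  then have M: "is_model M (Gor l)" and N: "is_model N (Gor l)" and f: "embedding M N f" by auto
  note strM = Gor_model(1)[OF M] and strN = Gor_model(1)[OF N]
  obtain U where "ultrafilter U" using ultrafilter_exists by blast
  then interpret ultrapower U by unfold_locales
  let ?f = "\<lambda>g. cls N (\<lambda>n. f (g n))"
  have el: "elementary (upower M) (upower N) ?f"
    by (rule elementary_if_uncountable[OF upower_model[OF strM M] upower_model[OF strN N]
          upower_embedding(1)[OF strM strN f] upower_residues_uncountable[OF M] upower_residues_uncountable[OF N]])
  show "elementary M N f" unfolding elementary_def
  proof (intro allI impI)
    fix \<phi> and s :: "nat \<Rightarrow> 'a" assume s: "range s \<subseteq> carrier M"
    let ?d = "\<lambda>v. cls M (\<lambda>_. s v)"
    have c: "(\<lambda>_. s v) \<in> seqs M" for v using s by (auto simp: seqs_def)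
    have fs: "range (f \<circ> s) \<subseteq> carrier N" using f s by (auto simp: embedding_def)
    have "sat M s \<phi> \<longleftrightarrow> sat (upower M) ?d \<phi>" using upower_diagonal[OF strM s] by simp
    also have "\<dots> \<longleftrightarrow> sat (upower N) (?f \<circ> ?d) \<phi>"
    proof -
      have "range ?d \<subseteq> carrier (upower M)" using c by (auto simp: upower_simps)
      then show ?thesis using el unfolding elementary_def by blast
    qed
    \<comment> \<open>The induced embedding of ultrapowers takes diagonal elements to diagonal
      elements, so both ends of the chain return to the original rings.\<close>
    also have "?f \<circ> ?d = (\<lambda>v. cls N (\<lambda>_. (f \<circ> s) v))"
      using upower_embedding(2)[OF strM strN f c] by (simp add: fun_eq_iff)
    also have "sat (upower N) (\<lambda>v. cls N (\<lambda>_. (f \<circ> s) v)) \<phi> \<longleftrightarrow> sat N (f \<circ> s) \<phi>"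
      by (rule upower_diagonal[OF strN fs])
    finally show "sat M s \<phi> \<longleftrightarrow> sat N (f \<circ> s) \<phi>" .
  qed
qed

end
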